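(* In the bond market described in the context, suppose that the support of the Lévy measure $\nu$ consists of infinitely many discrete points $\{x_i\}_{i=1}^\infty$ with $\lim_{i\to\infty}|x_i|=\infty$. Assume that the set $$A=\Big\{(\omega,t)\in\Omega\times[0,T^\ast]:\ G(t,x_i,T)\le0\quad\forall\,T\in[0,T^\ast]\quad\forall\,i=1,2,\dots\Big\}$$ is of positive $P\otimes\lambda$ measure. Then the market is not $L^2$-complete.
   Context: **Noise.** Fix $T^\ast>0$. Let $Z=(Z(t))_{t\in[0,T^\ast]}$ be a càdlàg Lévy process on a probability space $(\Omega,\mathcal{F},P)$, with jump measure $N(t,A)=\#\{s\in[0,t]:\Delta Z(s)\in A\}$, $\Delta Z(s)=Z(s)-Z(s-)$, Lévy measure $\nu$ ($\mathbf{E}N(t,A)=t\,\nu(A)$ when $0\notin\bar A$; $\nu(\{0\})=0$; $\int_{\mathbb{R}}(|x|^2\wedge 1)\,\nu(dx)<\infty$), compensated jump measure $\tilde N(t,A)=N(t,A)-t\,\nu(A)$, and Lévy–Itô decomposition $Z(t)=at+bW(t)+\int_0^t\int_{|x|<1}x\,\tilde N(ds,dx)+\int_0^t\int_{|x|\ge1}x\,N(ds,dx)$ with $a\in\mathbb{R}$, $b\ge0$ and $W$ a standard Wiener process adapted to $\mathcal{F}_t=\sigma\{Z(s):0\le s\le t\}$. $\lambda$ is Lebesgue measure on $[0,T^\ast]$. Dependence on $\omega$ is suppressed in the notation. In the situation of the claim, $\nu$ is given by the sequence of positive numbers $\nu(\{x_i\})$, and $\sum_i\nu(\{x_i\})<\infty$.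 **Integrands.** $\Phi$ is the class of predictable $\phi$ with $\int_0^{T^\ast}|\phi(s)|^2ds<\infty$ $P$-a.s. $\Psi_{1,2}$ is the class of predictable (i.e. $\mathcal{P}\otimes\mathcal{B}(\mathbb{R})$-measurable, $\mathcal{P}$ the predictable $\sigma$-field) $\psi(\omega,s,x)$ with $\int_0^{T^\ast}\int_{\mathbb{R}}(|\psi(s,x)|^2\wedge|\psi(s,x)|)\,\nu(dx)ds<\infty$ $P$-a.s. For such integrands $\int_0^\cdot\phi\,dW$ and $\int_0^\cdot\int_{\mathbb{R}}\psi\,d\tilde N$ are well-defined local martingales. **Bond market.** The forward rate satisfies $df(t,T)=\alpha(t,T)dt+\sigma(t,T)dW(t)+\int_{\mathbb{R}}\gamma(t,x,T)N(dt,dx)$, $t,T\in[0,T^\ast]$, with predictable coefficients such that $P$-a.s. $\int_0^{T^\ast}\int_0^{T^\ast}|\alpha(t,T)|\,dTdt<\infty$, $\int_0^{T^\ast}\int_0^{T^\ast}|\sigma(t,T)|^2dTdt<\infty$, $\int_0^{T^\ast}\int_0^{T^\ast}\int_{\mathbb{R}}|\gamma(t,x,T)|\,\nu(dx)dTdt<\infty$, and $\alpha(t,T)=\sigma(t,T)=\gamma(t,x,T)=0$ for $t>T$ and all $x$. Bond prices are $P(t,T)=e^{-\int_t^Tf(t,s)ds}$; the bank account satisfies $dB(t)=f(t,t)B(t)dt$; discounted bond prices are $\hat P(t,T)=B(t)^{-1}P(t,T)$. Put $S(t,T)=-\int_t^T\sigma(t,s)ds$, $G(t,x,T)=-\int_t^T\gamma(t,x,s)ds$.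 Standing assumption: $P$ is a martingale measure, i.e. $\hat P(\cdot,T)$ is a $P$-local martingale for each $T\in[0,T^\ast]$; then $d\hat P(t,T)=\hat P(t-,T)\big(S(t,T)dW(t)+\int_{\mathbb{R}}(e^{G(t,x,T)}-1)\tilde N(dt,dx)\big)$. **Portfolios.** $J=\{T_i:i\in\mathbb{N}\}$ is a fixed countable dense subset of $[0,T^\ast]$; only bonds with maturities in $J$ are traded. $B$ also denotes the Banach space of bounded real sequences $z=(z_i)$ with $\|z\|_B=\sup_i|z_i|$. Restricting functions of $T$ to $J$, the objects $\hat P(t-)$, $S(t)=(S(t,T_i))_i$, $e^{G(t,x)}-1=(e^{G(t,x,T_i)}-1)_i$ and their componentwise products are treated as elements of $B$. A trading strategy is a predictable $l^1$-valued process $\varphi(t)=(\varphi(t,T_j))_j$, and $\langle\varphi,z\rangle_{B^\ast,B}=\sum_j\varphi(T_j)z_j$ for $\varphi\in l^1$, $z\in B$. It is $\hat P$-integrable if $\langle\varphi(s),\hat P(s-)S(s)\rangle_{B^\ast,B}\in\Phi$ and $\langle\varphi(s),\hat P(s-)(e^{G(s,x)}-1)\rangle_{B^\ast,B}\in\Psi_{1,2}$, and then $$\int_0^t\langle\varphi(s),d\hat P(s)\rangle_{B^\ast,B}:=\int_0^t\langle\varphi(s),\hat P(s-)S(s)\rangle_{B^\ast,B}\,dW(s)+\int_0^t\int_{\mathbb{R}}\langle\varphi(s),\hat P(s-)(e^{G(s,x)}-1)\rangle_{B^\ast,B}\,\tilde N(ds,dx).$$ A $\hat P$-integrable $\varphi$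 is admissible ($\varphi\in\mathcal{A}$) if $\int_0^\cdot\langle\varphi(s),d\hat P(s)\rangle_{B^\ast,B}$ is a martingale. **Completeness.** An $\mathcal{F}_{T^\ast}$-measurable random variable $X$ can be replicated if $X=x+\int_0^{T^\ast}\langle\varphi(t),d\hat P(t)\rangle_{B^\ast,B}$ for some $x\in\mathbb{R}$ and $\varphi\in\mathcal{A}$. The market is $L^2$-complete if every $X\in L^2(\Omega,\mathcal{F}_{T^\ast},P)$ can be replicated; it is not $L^2$-complete if some such $X$ cannot be replicated. *)

theory Defs
  imports "HOL-Probability.Probability" "HOL-Probability.Stopping_Time"
begin

section \<open>Paths, filtrations, martingales on a finite horizon\<close>

text \<open>Processes are written with the time (and mark, maturity) arguments first and the sample
  point last. The horizon is \<open>H\<close>; all processes are only looked at on \<open>[0,H]\<close>.\<close>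

text \<open>Convention: \<open>g(0-) = g(0)\<close>, so that no process jumps at time 0.\<close>
definition left_lim :: "(real \<Rightarrow> real) \<Rightarrow> real \<Rightarrow> real" where
  "left_lim g t = (if t = 0 then g 0 else Lim (at_left t) g)"

definition cadlag_on :: "real \<Rightarrow> (real \<Rightarrow> real) \<Rightarrow> bool" where
  "cadlag_on H g \<longleftrightarrow>
     (\<forall>t\<in>{0..<H}. continuous (at_right t) g) \<and>
     (\<forall>t\<in>{0<..H}. \<exists>l. (g \<longlongrightarrow> l) (at_left t))"

definition natural_filtration ::
    "'a measure \<Rightarrow> real \<Rightarrow> (real \<Rightarrow> 'a \<Rightarrow> real) \<Rightarrow> real \<Rightarrow> 'a measure" where
  "natural_filtration M H Z t =
     sigma (space M) (\<Union>s\<in>{0..min t H}. {Z s -` B \<inter> space M | B. B \<in> sets borel})"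

text \<open>Stochastic integrals are only determined up to null sets; (local) martingale properties are
  therefore stated for the filtration completed by null sets. Predictability of integrands, by
  contrast, refers to the filtration itself.\<close>
definition null_augmentation :: "'a measure \<Rightarrow> (real \<Rightarrow> 'a measure) \<Rightarrow> real \<Rightarrow> 'a measure" where
  "null_augmentation M F t = sigma (space M) (sets (F t) \<union> null_sets M)"

definition predictable_sigma :: "'a measure \<Rightarrow> real \<Rightarrow> (real \<Rightarrow> 'a measure) \<Rightarrow> ('a \<times> real) measure" where
  "predictable_sigma M H F =
     sigma (space M \<times> {0..H})
       ({A \<times> {0} | A. A \<in> sets (F 0)} \<union>
        {A \<times> {s<..t} | A s t. 0 \<le> s \<and> s \<le> t \<and> t \<le> H \<and> A \<in> sets (F s)})"

definition martingale_on ::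
    "'a measure \<Rightarrow> real \<Rightarrow> (real \<Rightarrow> 'a measure) \<Rightarrow> (real \<Rightarrow> 'a \<Rightarrow> real) \<Rightarrow> bool" where
  "martingale_on M H F X \<longleftrightarrow>
     (\<forall>t\<in>{0..H}. X t \<in> borel_measurable (F t) \<and> integrable M (X t)) \<and>
     (\<forall>s t. 0 \<le> s \<and> s \<le> t \<and> t \<le> H \<longrightarrow> (AE \<omega> in M. real_cond_exp M (F s) (X t) \<omega> = X s \<omega>))"

text \<open>On the compact interval \<open>[0,H]\<close> a localizing sequence increases and eventually
  reaches \<open>H\<close>, almost surely.\<close>
definition local_martingale_on ::
    "'a measure \<Rightarrow> real \<Rightarrow> (real \<Rightarrow> 'a measure) \<Rightarrow> (real \<Rightarrow> 'a \<Rightarrow> real) \<Rightarrow> bool" where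
  "local_martingale_on M H F X \<longleftrightarrow>
     (\<forall>t\<in>{0..H}. X t \<in> borel_measurable (F t)) \<and>
     (AE \<omega> in M. cadlag_on H (\<lambda>t. X t \<omega>)) \<and>
     (\<exists>\<tau> :: nat \<Rightarrow> 'a \<Rightarrow> real.
        (\<forall>n. stopping_time F (\<tau> n)) \<and> (\<forall>n. \<forall>\<omega>\<in>space M. 0 \<le> \<tau> n \<omega>) \<and>
        (AE \<omega> in M. incseq (\<lambda>n. \<tau> n \<omega>) \<and> (\<exists>n. \<tau> n \<omega> \<ge> H)) \<and>
        (\<forall>n. martingale_on M H F (\<lambda>t \<omega>. X (min t (\<tau> n \<omega>)) \<omega>)))"

definition measure_support :: "real measure \<Rightarrow> real set" where
  "measure_support \<nu> = {y. \<forall>U. open U \<and> y \<in> U \<longrightarrow> emeasure \<nu> U > 0}"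


section \<open>Levy processes and Wiener processes\<close>

definition (in prob_space) levy_process :: "real \<Rightarrow> (real \<Rightarrow> 'a \<Rightarrow> real) \<Rightarrow> bool" where
  "levy_process H Z \<longleftrightarrow>
     (\<forall>t\<in>{0..H}. Z t \<in> borel_measurable M) \<and>
     (\<forall>\<omega>\<in>space M. cadlag_on H (\<lambda>t. Z t \<omega>)) \<and>
     (AE \<omega> in M. Z 0 \<omega> = 0) \<and>
     (\<forall>(n::nat) t. 0 \<le> t 0 \<and> (\<forall>k<n. t k \<le> t (Suc k)) \<and> t n \<le> H \<longrightarrow>
        indep_vars (\<lambda>_. borel) (\<lambda>k \<omega>. Z (t (Suc k)) \<omega> - Z (t k) \<omega>) {..<n}) \<and>
     (\<forall>s t. 0 \<le> s \<and> s \<le> t \<and> t \<le> H \<longrightarrow>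
        distr M borel (\<lambda>\<omega>. Z t \<omega> - Z s \<omega>) = distr M borel (Z (t - s)))"

definition (in prob_space) wiener_process ::
    "real \<Rightarrow> (real \<Rightarrow> 'a measure) \<Rightarrow> (real \<Rightarrow> 'a \<Rightarrow> real) \<Rightarrow> bool" where
  "wiener_process H F W \<longleftrightarrow>
     (\<forall>t\<in>{0..H}. W t \<in> borel_measurable (F t)) \<and>
     (AE \<omega> in M. W 0 \<omega> = 0 \<and> continuous_on {0..H} (\<lambda>t. W t \<omega>)) \<and>
     (\<forall>s t. 0 \<le> s \<and> s < t \<and> t \<le> H \<longrightarrow>
        distributed M lborel (\<lambda>\<omega>. W t \<omega> - W s \<omega>) (normal_density 0 (sqrt (t - s))) \<and>
        indep_set (sets (F s)) {(\<lambda>\<omega>. W t \<omega> - W s \<omega>) -` B \<inter> space M | B. B \<in> sets borel})"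


section \<open>The noise and its stochastic integrals\<close>

locale levy_setup = prob_space M for M :: "'a measure" +
  fixes H :: real
    and Z :: "real \<Rightarrow> 'a \<Rightarrow> real"
    and \<nu> :: "real measure"
    and W :: "real \<Rightarrow> 'a \<Rightarrow> real"
begin

definition F :: "real \<Rightarrow> 'a measure" where
  "F = natural_filtration M H Z"

definition F_aug :: "real \<Rightarrow> 'a measure" where
  "F_aug = null_augmentation M F"

definition Pred :: "('a \<times> real) measure" where
  "Pred = predictable_sigma M H F"

definition jump :: "real \<Rightarrow> 'a \<Rightarrow> real" where
  "jump s \<omega> = Z s \<omega> - left_lim (\<lambda>u. Z u \<omega>) s"

text \<open>The jump measure \<open>N(t,A)\<close>, used for sets \<open>A\<close> bounded away from 0, where it is finite.\<close>
definition N :: "real \<Rightarrow> real set \<Rightarrow> 'a \<Rightarrow> nat" where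
  "N t A \<omega> = card {s\<in>{0..t}. jump s \<omega> \<in> A}"

text \<open>The integral of \<open>\<psi>(s,x)\<close> with respect to the point measure \<open>N(ds,dx)\<close> over
  \<open>(0,t]\<close> is the sum over the jumps of \<open>Z\<close>.\<close>
definition jump_integral :: "(real \<Rightarrow> real \<Rightarrow> 'a \<Rightarrow> real) \<Rightarrow> real \<Rightarrow> 'a \<Rightarrow> real" where
  "jump_integral \<psi> t \<omega> =
     (\<Sum>\<^sub>\<infinity>s\<in>{s\<in>{0..t}. jump s \<omega> \<noteq> 0}. \<psi> s (jump s \<omega>) \<omega>)"

text \<open>The integral with respect to the compensated jump measure. The Levy measure is finite
  (see \<open>levy_noise\<close> below), so \<open>Z\<close> has almost surely finitely many jumps and, since
  \<open>\<bar>y\<bar> \<le> 1 + min (y\<^sup>2) \<bar>y\<bar>\<close>, every integrand in \<open>Psi12\<close> is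
  \<open>\<nu>(dx)ds\<close>-integrable almost surely: both parts of the difference converge absolutely.\<close>
definition compensated_integral :: "(real \<Rightarrow> real \<Rightarrow> 'a \<Rightarrow> real) \<Rightarrow> real \<Rightarrow> 'a \<Rightarrow> real" where
  "compensated_integral \<psi> t \<omega> =
     jump_integral \<psi> t \<omega> - (LINT s:{0..t}|lborel. (LINT x|\<nu>. \<psi> s x \<omega>))"

text \<open>Integrands are identified when indistinguishable. This matters because, for instance,
  left limits of a process with only almost surely regular paths are predictable only up to a
  null set.\<close>
definition Phi :: "(real \<Rightarrow> 'a \<Rightarrow> real) set" where
  "Phi = {\<phi>.
     (\<exists>\<phi>'. (\<lambda>(\<omega>, s). \<phi>' s \<omega>) \<in> borel_measurable Pred \<and>
        (AE \<omega> in M. \<forall>s\<in>{0..H}. \<phi> s \<omega> = \<phi>' s \<omega>)) \<and>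
     (AE \<omega> in M. (\<integral>\<^sup>+ s\<in>{0..H}. ennreal (\<bar>\<phi> s \<omega>\<bar>\<^sup>2) \<partial>lborel) < \<infinity>)}"

definition Psi12 :: "(real \<Rightarrow> real \<Rightarrow> 'a \<Rightarrow> real) set" where
  "Psi12 = {\<psi>.
     (\<exists>\<psi>'. (\<lambda>((\<omega>, s), x). \<psi>' s x \<omega>) \<in> borel_measurable (Pred \<Otimes>\<^sub>M borel) \<and>
        (AE \<omega> in M. \<forall>s\<in>{0..H}. \<forall>x. \<psi> s x \<omega> = \<psi>' s x \<omega>)) \<and>
     (AE \<omega> in M. (\<integral>\<^sup>+ s\<in>{0..H}.
        (\<integral>\<^sup>+ x. ennreal (min (\<bar>\<psi> s x \<omega>\<bar>\<^sup>2) \<bar>\<psi> s x \<omega>\<bar>) \<partial>\<nu>) \<partial>lborel) < \<infinity>)}"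

text \<open>Ito integrals of elementary predictable integrands
  \<open>\<Sum>k<n. \<xi>\<^sub>k 1\<close> on \<open>(t\<^sub>k, t\<^sub>k\<^sub>+\<^sub>1]\<close>.\<close>
definition elementary :: "nat \<Rightarrow> (nat \<Rightarrow> real) \<Rightarrow> (nat \<Rightarrow> 'a \<Rightarrow> real) \<Rightarrow> bool" where
  "elementary n t \<xi> \<longleftrightarrow>
     0 \<le> t 0 \<and> (\<forall>k<n. t k \<le> t (Suc k)) \<and> t n \<le> H \<and>
     (\<forall>k<n. \<xi> k \<in> borel_measurable (F (t k)) \<and> (\<exists>C. \<forall>\<omega>\<in>space M. \<bar>\<xi> k \<omega>\<bar> \<le> C))"

definition elementary_process ::
    "nat \<Rightarrow> (nat \<Rightarrow> real) \<Rightarrow> (nat \<Rightarrow> 'a \<Rightarrow> real) \<Rightarrow> real \<Rightarrow> 'a \<Rightarrow> real" where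
  "elementary_process n t \<xi> s \<omega> = (\<Sum>k<n. \<xi> k \<omega> * indicator {t k<..t (Suc k)} s)"

definition elementary_integral ::
    "nat \<Rightarrow> (nat \<Rightarrow> real) \<Rightarrow> (nat \<Rightarrow> 'a \<Rightarrow> real) \<Rightarrow> real \<Rightarrow> 'a \<Rightarrow> real" where
  "elementary_integral n t \<xi> u \<omega> =
     (\<Sum>k<n. \<xi> k \<omega> * (W (min (t (Suc k)) u) \<omega> - W (min (t k) u) \<omega>))"

text \<open>\<open>I\<close> is a version of the process \<open>\<integral> \<phi> dW\<close>: along some sequence of elementary
  integrands converging to \<open>\<phi>\<close> in \<open>L\<^sup>2([0,H])\<close> almost surely, the elementary integrals
  converge to \<open>I\<close> uniformly on \<open>[0,H]\<close> almost surely. This is the usual definition by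
  convergence in probability, after passing to a subsequence. It determines \<open>I\<close> up to
  indistinguishability.\<close>
definition wiener_integral :: "(real \<Rightarrow> 'a \<Rightarrow> real) \<Rightarrow> (real \<Rightarrow> 'a \<Rightarrow> real) \<Rightarrow> bool" where
  "wiener_integral \<phi> I \<longleftrightarrow> \<phi> \<in> Phi \<and>
     (\<exists>n t \<xi>. (\<forall>m. elementary (n m) (t m) (\<xi> m)) \<and>
        (AE \<omega> in M. (\<lambda>m. \<integral>\<^sup>+ s\<in>{0..H}.
             ennreal (\<bar>elementary_process (n m) (t m) (\<xi> m) s \<omega> - \<phi> s \<omega>\<bar>\<^sup>2) \<partial>lborel)
           \<longlonglongrightarrow> 0) \<and>
        (AE \<omega> in M. uniform_limit {0..H}
             (\<lambda>m u. elementary_integral (n m) (t m) (\<xi> m) u \<omega>) (\<lambda>u. I u \<omega>) sequentially))"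

end

text \<open>Finiteness of \<open>\<nu>\<close> is part of the situation considered; all other assumptions are those
  of a general Levy process.\<close>
locale levy_noise = levy_setup M H Z \<nu> W
  for M :: "'a measure" and H Z \<nu> W +
  fixes a b :: real
  assumes horizon: "H > 0"
    and levy: "levy_process H Z"
    and levy_measure_sets: "sets \<nu> = sets borel"
    and levy_measure_zero: "emeasure \<nu> {0} = 0"
    and levy_measure_integrable: "(\<integral>\<^sup>+ x. ennreal (min (\<bar>x\<bar>\<^sup>2) 1) \<partial>\<nu>) < \<infinity>"
    and levy_measure_finite: "finite_measure \<nu>"
    and levy_measure_intensity:
      "\<And>t A. t \<in> {0..H} \<Longrightarrow> A \<in> sets borel \<Longrightarrow> 0 \<notin> closure A \<Longrightarrow>
         (\<integral>\<^sup>+ \<omega>. of_nat (N t A \<omega>) \<partial>M) = ennreal t * emeasure \<nu> A"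
    and wiener: "wiener_process H F W"
    and b_nonneg: "b \<ge> 0"
    and levy_ito: "AE \<omega> in M. \<forall>t\<in>{0..H}.
         Z t \<omega> = a * t + b * W t \<omega>
           + compensated_integral (\<lambda>s x \<omega>. x * indicator {x. \<bar>x\<bar> < 1} x) t \<omega>
           + jump_integral (\<lambda>s x \<omega>. x * indicator {x. \<bar>x\<bar> \<ge> 1} x) t \<omega>"


section \<open>The bond market\<close>

text \<open>\<open>bank\<close> is the bank account, \<open>Tm j\<close> are the traded maturities.\<close>
locale bond_setup = levy_setup M H Z \<nu> W
  for M :: "'a measure" and H Z \<nu> W +
  fixes \<sigma> :: "real \<Rightarrow> real \<Rightarrow> 'a \<Rightarrow> real"
    and \<gamma> :: "real \<Rightarrow> real \<Rightarrow> real \<Rightarrow> 'a \<Rightarrow> real"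
    and f :: "real \<Rightarrow> real \<Rightarrow> 'a \<Rightarrow> real"
    and bank :: "real \<Rightarrow> 'a \<Rightarrow> real"
    and Tm :: "nat \<Rightarrow> real"
begin

text \<open>Interval integrals are oriented, so prices after maturity (\<open>t > T\<close>) follow the same
  formula.\<close>
definition bond_price :: "real \<Rightarrow> real \<Rightarrow> 'a \<Rightarrow> real" where
  "bond_price t T \<omega> = exp (- (LBINT s=ereal t..ereal T. f t s \<omega>))"

definition discounted :: "real \<Rightarrow> real \<Rightarrow> 'a \<Rightarrow> real" where
  "discounted t T \<omega> = inverse (bank t \<omega>) * bond_price t T \<omega>"

definition discounted_left :: "real \<Rightarrow> real \<Rightarrow> 'a \<Rightarrow> real" where
  "discounted_left t T \<omega> = left_lim (\<lambda>u. discounted u T \<omega>) t"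

definition S :: "real \<Rightarrow> real \<Rightarrow> 'a \<Rightarrow> real" where
  "S t T \<omega> = - (LBINT s=ereal t..ereal T. \<sigma> t s \<omega>)"

definition G :: "real \<Rightarrow> real \<Rightarrow> real \<Rightarrow> 'a \<Rightarrow> real" where
  "G t x T \<omega> = - (LBINT s=ereal t..ereal T. \<gamma> t x s \<omega>)"

text \<open>A strategy is a predictable \<open>l\<^sup>1\<close>-valued process \<open>\<phi> t j \<omega>\<close>. As \<open>l\<^sup>1\<close> is
  separable, its Borel \<open>\<sigma>\<close>-field is generated by the coordinates.\<close>
definition strategy :: "(real \<Rightarrow> nat \<Rightarrow> 'a \<Rightarrow> real) \<Rightarrow> bool" where
  "strategy \<phi> \<longleftrightarrow>
     (\<forall>j. (\<lambda>(\<omega>, t). \<phi> t j \<omega>) \<in> borel_measurable Pred) \<and>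
     (\<forall>t\<in>{0..H}. \<forall>\<omega>\<in>space M. summable (\<lambda>j. \<bar>\<phi> t j \<omega>\<bar>))"

definition pairing :: "(nat \<Rightarrow> real) \<Rightarrow> (nat \<Rightarrow> real) \<Rightarrow> real" where
  "pairing u z = (\<Sum>j. u j * z j)"

definition wiener_integrand :: "(real \<Rightarrow> nat \<Rightarrow> 'a \<Rightarrow> real) \<Rightarrow> real \<Rightarrow> 'a \<Rightarrow> real" where
  "wiener_integrand \<phi> s \<omega> =
     pairing (\<lambda>j. \<phi> s j \<omega>) (\<lambda>j. discounted_left s (Tm j) \<omega> * S s (Tm j) \<omega>)"

definition jump_integrand :: "(real \<Rightarrow> nat \<Rightarrow> 'a \<Rightarrow> real) \<Rightarrow> real \<Rightarrow> real \<Rightarrow> 'a \<Rightarrow> real" where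
  "jump_integrand \<phi> s x \<omega> =
     pairing (\<lambda>j. \<phi> s j \<omega>)
       (\<lambda>j. discounted_left s (Tm j) \<omega> * (exp (G s x (Tm j) \<omega>) - 1))"

definition P_integrable :: "(real \<Rightarrow> nat \<Rightarrow> 'a \<Rightarrow> real) \<Rightarrow> bool" where
  "P_integrable \<phi> \<longleftrightarrow> strategy \<phi> \<and> wiener_integrand \<phi> \<in> Phi \<and> jump_integrand \<phi> \<in> Psi12"

text \<open>\<open>V\<close> is a version of the gains process \<open>\<integral> \<langle>\<phi>, dP\<rangle>\<close> in the discounted bonds.\<close>
definition gains :: "(real \<Rightarrow> nat \<Rightarrow> 'a \<Rightarrow> real) \<Rightarrow> (real \<Rightarrow> 'a \<Rightarrow> real) \<Rightarrow> bool" where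
  "gains \<phi> V \<longleftrightarrow>
     (\<exists>I. wiener_integral (wiener_integrand \<phi>) I \<and>
        (AE \<omega> in M. \<forall>t\<in>{0..H}. V t \<omega> = I t \<omega> + compensated_integral (jump_integrand \<phi>) t \<omega>))"

definition admissible :: "(real \<Rightarrow> nat \<Rightarrow> 'a \<Rightarrow> real) \<Rightarrow> bool" where
  "admissible \<phi> \<longleftrightarrow> P_integrable \<phi> \<and> (\<exists>V. gains \<phi> V \<and> martingale_on M H F_aug V)"

definition replicable :: "('a \<Rightarrow> real) \<Rightarrow> bool" where
  "replicable X \<longleftrightarrow>
     (\<exists>c \<phi> V. admissible \<phi> \<and> gains \<phi> V \<and> (AE \<omega> in M. X \<omega> = c + V H \<omega>))"

definition L2_complete :: bool where
  "L2_complete \<longleftrightarrow>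
     (\<forall>X. X \<in> borel_measurable (F H) \<and> integrable M (\<lambda>\<omega>. (X \<omega>)\<^sup>2) \<longrightarrow> replicable X)"

end

locale bond_market = levy_noise M H Z \<nu> W a b + bond_setup M H Z \<nu> W \<sigma> \<gamma> f bank Tm
  for M :: "'a measure" and H Z \<nu> W a b
    and \<alpha> :: "real \<Rightarrow> real \<Rightarrow> 'a \<Rightarrow> real" and \<sigma> \<gamma> f bank Tm +
  assumes alpha_predictable:
      "(\<lambda>((\<omega>, t), T). \<alpha> t T \<omega>) \<in> borel_measurable (Pred \<Otimes>\<^sub>M restrict_space borel {0..H})"
    and sigma_predictable:
      "(\<lambda>((\<omega>, t), T). \<sigma> t T \<omega>) \<in> borel_measurable (Pred \<Otimes>\<^sub>M restrict_space borel {0..H})"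
    and gamma_predictable:
      "(\<lambda>(((\<omega>, t), x), T). \<gamma> t x T \<omega>)
         \<in> borel_measurable ((Pred \<Otimes>\<^sub>M borel) \<Otimes>\<^sub>M restrict_space borel {0..H})"
    and alpha_integrable: "AE \<omega> in M.
      (\<integral>\<^sup>+ t\<in>{0..H}. (\<integral>\<^sup>+ T\<in>{0..H}. ennreal \<bar>\<alpha> t T \<omega>\<bar> \<partial>lborel) \<partial>lborel) < \<infinity>"
    and sigma_integrable: "AE \<omega> in M.
      (\<integral>\<^sup>+ t\<in>{0..H}. (\<integral>\<^sup>+ T\<in>{0..H}. ennreal (\<bar>\<sigma> t T \<omega>\<bar>\<^sup>2) \<partial>lborel) \<partial>lborel) < \<infinity>"
    and gamma_integrable: "AE \<omega> in M.
      (\<integral>\<^sup>+ t\<in>{0..H}. (\<integral>\<^sup>+ T\<in>{0..H}. (\<integral>\<^sup>+ x. ennreal \<bar>\<gamma> t x T \<omega>\<bar> \<partial>\<nu>) \<partial>lborel) \<partial>lborel) < \<infinity>"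
    and coefficients_zero:
      "\<And>t T x \<omega>. t \<in> {0..H} \<Longrightarrow> T \<in> {0..H} \<Longrightarrow> t > T \<Longrightarrow> \<omega> \<in> space M \<Longrightarrow>
         \<alpha> t T \<omega> = 0 \<and> \<sigma> t T \<omega> = 0 \<and> \<gamma> t x T \<omega> = 0"
    \<comment> \<open>well-posedness of the rates: the integrals defining bond prices and bank account exist\<close>
    and rate_measurable:
      "(\<lambda>(\<omega>, t, T). f t T \<omega>)
         \<in> borel_measurable (M \<Otimes>\<^sub>M restrict_space borel {0..H} \<Otimes>\<^sub>M restrict_space borel {0..H})"
    and rate_integrable:
      "AE \<omega> in M. \<forall>t\<in>{0..H}. set_integrable lborel {0..H} (\<lambda>T. f t T \<omega>)"
    and short_rate_integrable:
      "AE \<omega> in M. set_integrable lborel {0..H} (\<lambda>s. f s s \<omega>)"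
    and initial_rate_measurable: "\<And>T. T \<in> {0..H} \<Longrightarrow> f 0 T \<in> borel_measurable (F_aug 0)"
    and forward_rate:
      "\<And>T. T \<in> {0..H} \<Longrightarrow>
         (AE \<omega> in M. set_integrable lborel {0..H} (\<lambda>s. \<alpha> s T \<omega>)) \<and>
         (\<exists>I. wiener_integral (\<lambda>s. \<sigma> s T) I \<and>
           (AE \<omega> in M. \<forall>t\<in>{0..H}.
              f t T \<omega> = f 0 T \<omega> + (LINT s:{0..t}|lborel. \<alpha> s T \<omega>) + I t \<omega>
                + jump_integral (\<lambda>s x. \<gamma> s x T) t \<omega>))"
    and bank_initial: "\<exists>c>0. AE \<omega> in M. bank 0 \<omega> = c"
    and bank_account:
      "AE \<omega> in M. set_integrable lborel {0..H} (\<lambda>s. f s s \<omega> * bank s \<omega>) \<and>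
         (\<forall>t\<in>{0..H}. bank t \<omega> = bank 0 \<omega> + (LINT s:{0..t}|lborel. f s s \<omega> * bank s \<omega>))"
    and martingale_measure:
      "\<And>T. T \<in> {0..H} \<Longrightarrow> local_martingale_on M H F_aug (\<lambda>t. discounted t T)"
    and maturities: "range Tm \<subseteq> {0..H}" "{0..H} \<subseteq> closure (range Tm)"
    \<comment> \<open>restricted to the traded maturities, these functions are bounded sequences\<close>
    and bounded_sequences: "AE \<omega> in M. AE t in lborel. t \<in> {0..H} \<longrightarrow>
         bounded (range (\<lambda>j. discounted_left t (Tm j) \<omega>)) \<and>
         bounded (range (\<lambda>j. S t (Tm j) \<omega>)) \<and>
         (AE x in \<nu>. bounded (range (\<lambda>j. exp (G t x (Tm j) \<omega>) - 1)))"

end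

(* Choose jump sizes y k along a subsequence of the support with intensities decaying fast, and let
   X be the sum over k of k times the number of jumps of size y k up to the horizon; X is square
   integrable. If X = c + V(H) with V a martingale, then V(t) = E[X | F(t)] - c, and the right-hand
   side is a pure jump process plus a linear drift. The Wiener and compensator parts of V are
   continuous, so a jump of size y k produces the same jump on both sides: the jump integrand equals
   k at every jump of size y k. By the compensation formula it then equals k almost everywhere, for
   all k simultaneously. But where G <= 0 we have |exp G - 1| <= 1, so there the integrand is bounded
   in the jump size by the l1-norm of the strategy times the supremum of the discounted prices. *)
theory Submission
  imports Defs
begin

section \<open>Regularity of cadlag paths, and grids on the time axis\<close>

section \<open>Jumps of cadlag functions\<close>

text \<open>Two features of the definitions shape the argument. The gains process that replicates X
  and the one that is a martingale are both mere versions of the same stochastic integral and may be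
  different processes; they must be shown to agree at the horizon before the martingale property
  says anything about X. Integrands in \<open>Phi\<close> are square integrable only path by path,
  so this uniqueness of the Wiener integral cannot be read off the Ito isometry; it rests on a
  truncated estimate in probability. Moreover, E[X | F(t)] is identified almost surely for each
  fixed t, hence simultaneously only for countably many t: the jumps of both sides are compared
  through rational times and the horizon.

  The compensation formula enters for one jump size y at a time, as a null set criterion: a
  predictable set that contains no jump of size y is null as soon as \<nu>{y} > 0. Its source is the
  independence of past and future increments. As the sizes tend to infinity, the support leaves a
  gap around 0; hence a path has finitely many jumps and its jump integrals are finite sums.\<close>

lemma cadlag_left_lim:
  assumes "cadlag_on H z" "0 < u" "u \<le> H"
  shows "(z \<longlongrightarrow> left_lim z u) (at_left u)"
proof -
  obtain l where l: "(z \<longlongrightarrow> l) (at_left u)"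
    using assms unfolding cadlag_on_def by force
  then have "Lim (at_left u) z = l"
    by (intro tendsto_Lim) (auto simp: trivial_limit_at_left_real)
  with l assms(2) show ?thesis
    by (simp add: left_lim_def)
qed

text \<open>One-sided limits put all nearby values within \<open>e / 2\<close> of \<open>z u\<close>
  or of \<open>left_lim z u\<close>; subtracting two such values gives the three cases. They are
  phrased by increments, since increments are what the sigma-fields of past and future both make
  measurable.\<close>

lemma cadlag_oscillation:
  fixes z :: "real \<Rightarrow> real"
  assumes z: "cadlag_on H z" and u: "u \<in> {0..H}" and e: "0 < e"
  obtains d where "0 < d"
    "\<And>q q'. u \<le> q \<Longrightarrow> q \<le> q' \<Longrightarrow> q' < u + d \<Longrightarrow> q' \<le> H \<Longrightarrow> \<bar>z q' - z q\<bar> < e"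
    "\<And>q q'. u - d < q \<Longrightarrow> 0 \<le> q \<Longrightarrow> q \<le> q' \<Longrightarrow> q' < u \<Longrightarrow> \<bar>z q' - z q\<bar> < e"
    "\<And>q q'. u - d < q \<Longrightarrow> 0 \<le> q \<Longrightarrow> q < u \<Longrightarrow> u \<le> q' \<Longrightarrow> q' < u + d \<Longrightarrow> q' \<le> H \<Longrightarrow>
        \<bar>z q' - z q - (z u - left_lim z u)\<bar> < e"
proof -
  have "\<exists>d1>0. \<forall>q. u \<le> q \<and> q < u + d1 \<and> q \<le> H \<longrightarrow> \<bar>z q - z u\<bar> < e / 2"
  proof (cases "u < H")
    case True
    then have "(z \<longlongrightarrow> z u) (at_right u)"
      using z u unfolding cadlag_on_def continuous_within by auto
    then have "\<forall>\<^sub>F q in at_right u. dist (z q) (z u) < e / 2"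
      using e tendstoD half_gt_zero by blast
    then obtain b where b: "b > u" "\<And>q. u < q \<Longrightarrow> q < b \<Longrightarrow> dist (z q) (z u) < e / 2"
      unfolding eventually_at_right_field by auto
    show ?thesis
      by (rule exI[of _ "b - u"]) (use b e in \<open>auto simp: dist_real_def order.order_iff_strict\<close>)
  next
    case False
    then show ?thesis
      using u e by (intro exI[of _ 1]) (auto dest: antisym)
  qed
  then obtain d1 where d1: "d1 > 0" "\<And>q. u \<le> q \<Longrightarrow> q < u + d1 \<Longrightarrow> q \<le> H \<Longrightarrow> \<bar>z q - z u\<bar> < e / 2"
    by blast
  have "\<exists>d2>0. \<forall>q. u - d2 < q \<and> 0 \<le> q \<and> q < u \<longrightarrow> \<bar>z q - left_lim z u\<bar> < e / 2"
  proof (cases "u = 0")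
    case False
    then have "(z \<longlongrightarrow> left_lim z u) (at_left u)"
      using cadlag_left_lim[OF z] u by simp
    then have "\<forall>\<^sub>F q in at_left u. dist (z q) (left_lim z u) < e / 2"
      using e tendstoD half_gt_zero by blast
    then obtain b where b: "b < u" "\<And>q. b < q \<Longrightarrow> q < u \<Longrightarrow> dist (z q) (left_lim z u) < e / 2"
      unfolding eventually_at_left_field by auto
    show ?thesis
      by (rule exI[of _ "u - b"]) (use b in \<open>auto simp: dist_real_def\<close>)
  qed (auto intro: exI[of _ 1])
  then obtain d2 where d2: "d2 > 0"
    "\<And>q. u - d2 < q \<Longrightarrow> 0 \<le> q \<Longrightarrow> q < u \<Longrightarrow> \<bar>z q - left_lim z u\<bar> < e / 2"
    by blast
  show ?thesis
  proof (rule that[of "min d1 d2"])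
    show "0 < min d1 d2"
      using d1 d2 by simp
  next
    fix q q' assume *: "u \<le> q" "q \<le> q'" "q' < u + min d1 d2" "q' \<le> H"
    show "\<bar>z q' - z q\<bar> < e"
      using d1(2)[of q] d1(2)[of q'] * by linarith
  next
    fix q q' assume *: "u - min d1 d2 < q" "0 \<le> q" "q \<le> q'" "q' < u"
    show "\<bar>z q' - z q\<bar> < e"
      using d2(2)[of q] d2(2)[of q'] * by linarith
  next
    fix q q' assume *: "u - min d1 d2 < q" "0 \<le> q" "q < u" "u \<le> q'" "q' < u + min d1 d2" "q' \<le> H"
    show "\<bar>z q' - z q - (z u - left_lim z u)\<bar> < e"
      using d2(2)[of q] d1(2)[of q'] * by linarith
  qed
qed

text \<open>The jump at \<open>v\<close> is a limit of increments \<open>z v - z q\<close> taken on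
  one side of \<open>u\<close>, where the oscillation is below \<open>e\<close>; the strict bound
  becomes a weak one in the limit.\<close>

lemma cadlag_jumps_isolated:
  fixes z :: "real \<Rightarrow> real"
  assumes z: "cadlag_on H z" and u: "u \<in> {0..H}" and e: "0 < e"
  obtains d where "0 < d"
    "\<And>v. v \<in> {0..H} \<Longrightarrow> v \<noteq> u \<Longrightarrow> dist v u < d \<Longrightarrow> \<bar>z v - left_lim z v\<bar> \<le> e"
proof -
  obtain d where d: "0 < d"
    "\<And>q q'. u \<le> q \<Longrightarrow> q \<le> q' \<Longrightarrow> q' < u + d \<Longrightarrow> q' \<le> H \<Longrightarrow> \<bar>z q' - z q\<bar> < e"
    "\<And>q q'. u - d < q \<Longrightarrow> 0 \<le> q \<Longrightarrow> q \<le> q' \<Longrightarrow> q' < u \<Longrightarrow> \<bar>z q' - z q\<bar> < e"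
    using cadlag_oscillation[OF assms] by metis
  show ?thesis
  proof (rule that[OF d(1)])
    fix v assume v: "v \<in> {0..H}" "v \<noteq> u" "dist v u < d"
    show "\<bar>z v - left_lim z v\<bar> \<le> e"
    proof (cases "v = 0")
      case True
      then show ?thesis using e by (simp add: left_lim_def)
    next
      case False
      have lim: "((\<lambda>q. \<bar>z v - z q\<bar>) \<longlongrightarrow> \<bar>z v - left_lim z v\<bar>) (at_left v)"
        using cadlag_left_lim[OF z, of v] v False by (intro tendsto_intros) auto
      \<comment> \<open>Confines \<open>q\<close> to the side of \<open>u\<close> on which
        \<open>v\<close> lies, so that the increment from \<open>q\<close> to \<open>v\<close> does
        not pick up the jump at \<open>u\<close>.\<close>
      define m where "m = (if u < v then u else max 0 (u - d))"
      have "m < v" using v False u by (auto simp: m_def dist_real_def)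
      then have "\<forall>\<^sub>F q in at_left v. q \<in> {m<..<v}"
        using eventually_at_left_real by blast
      then have "\<forall>\<^sub>F q in at_left v. \<bar>z v - z q\<bar> \<le> e"
      proof eventually_elim
        case (elim q)
        then show ?case
          using d(2)[of q v] d(3)[of q v] v by (auto simp: m_def dist_real_def split: if_splits)
      qed
      then show ?thesis
        by (intro tendsto_upperbound[OF lim]) (auto simp: trivial_limit_at_left_real)
    qed
  qed
qed

text \<open>Infinitely many jumps of size at least \<open>e\<close> would accumulate in the compact
  interval, against isolation with the bound \<open>e / 2\<close>.\<close>

lemma cadlag_finite_large_jumps:
  fixes z :: "real \<Rightarrow> real"
  assumes z: "cadlag_on H z" and e: "0 < e"
  shows "finite {u\<in>{0..H}. e \<le> \<bar>z u - left_lim z u\<bar>}" (is "finite ?T")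
proof (rule ccontr)
  assume "infinite ?T"
  moreover have "?T \<subseteq> {0..H}" by blast
  ultimately obtain u where u: "u \<in> {0..H}" "u islimpt ?T"
    using compact_Icc[of 0 H] unfolding compact_eq_Bolzano_Weierstrass by meson
  obtain d where d: "0 < d"
    "\<And>v. v \<in> {0..H} \<Longrightarrow> v \<noteq> u \<Longrightarrow> dist v u < d \<Longrightarrow> \<bar>z v - left_lim z v\<bar> \<le> e / 2"
    using cadlag_jumps_isolated[OF z u(1), of "e / 2"] e by auto
  obtain v where v: "v \<in> ?T" "v \<noteq> u" "dist v u < d"
    using u(2) d(1) unfolding islimpt_approachable by blast
  then show False using d(2)[of v] e by auto
qed

text \<open>The condition on the right only involves countably many times; it makes the event that a jump
  in \<open>K\<close> occurs measurable.\<close>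
lemma cadlag_jump_in_iff:
  fixes z :: "real \<Rightarrow> real"
  assumes z: "cadlag_on H z" and K: "closed K" "K \<noteq> {}" "0 \<notin> K" and st: "0 \<le> s" "s \<le> t" "t \<le> H"
  shows "(\<exists>u\<in>{s<..t}. z u - left_lim z u \<in> K) \<longleftrightarrow>
    (\<forall>n::nat. \<exists>q\<in>(\<rat> \<union> {t}) \<inter> {s..t}. \<exists>q'\<in>(\<rat> \<union> {t}) \<inter> {s..t}. q \<le> q' \<and>
       q' - q < 1 / Suc n \<and> infdist (z q' - z q) K < 1 / Suc n)" (is "?L \<longleftrightarrow> ?R")
proof
  assume ?L
  then obtain u where u: "s < u" "u \<le> t" "z u - left_lim z u \<in> K" by auto
  show ?R
  proof
    fix n :: nat
    define e where "e = 1 / real (Suc n)"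
    have e: "e > 0" by (simp add: e_def)
    have uH: "u \<in> {0..H}" using u st by auto
    obtain d where d: "0 < d"
      "\<And>q q'. u \<le> q \<Longrightarrow> q \<le> q' \<Longrightarrow> q' < u + d \<Longrightarrow> q' \<le> H \<Longrightarrow> \<bar>z q' - z q\<bar> < e"
      "\<And>q q'. u - d < q \<Longrightarrow> 0 \<le> q \<Longrightarrow> q \<le> q' \<Longrightarrow> q' < u \<Longrightarrow> \<bar>z q' - z q\<bar> < e"
      "\<And>q q'. u - d < q \<Longrightarrow> 0 \<le> q \<Longrightarrow> q < u \<Longrightarrow> u \<le> q' \<Longrightarrow> q' < u + d \<Longrightarrow> q' \<le> H \<Longrightarrow>
        \<bar>z q' - z q - (z u - left_lim z u)\<bar> < e"
      by (fact cadlag_oscillation[OF z uH e])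
    define d' where "d' = min d (e / 2)"
    have d': "d' > 0" using d e by (simp add: d'_def)
    have "max s (u - d') < u" using u d' by auto
    then obtain q where q: "q \<in> \<rat>" "max s (u - d') < q" "q < u" using Rats_dense_in_real by blast
    \<comment> \<open>A jump at the right end \<open>t\<close> can only be seen from
      \<open>q' = t\<close>, which may be irrational: this is why \<open>t\<close> is adjoined to
      the rationals.\<close>
    have "\<exists>q'\<in>(\<rat> \<union> {t}) \<inter> {s..t}. u \<le> q' \<and> q' < u + d'"
    proof (cases "u = t")
      case True
      then show ?thesis using u d' by (intro bexI[of _ t]) auto
    next
      case False
      then have "u < min t (u + d')" using u d' by auto
      then obtain q' where "q' \<in> \<rat>" "u < q'" "q' < min t (u + d')" using Rats_dense_in_real by blast
      then show ?thesis using u by (intro bexI[of _ q']) auto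
    qed
    then obtain q' where q': "q' \<in> (\<rat> \<union> {t}) \<inter> {s..t}" "u \<le> q'" "q' < u + d'" by blast
    have "\<bar>z q' - z q - (z u - left_lim z u)\<bar> < e"
      using d(4)[of q q'] q q' st u by (auto simp: d'_def)
    then have "infdist (z q' - z q) K < e"
      using infdist_le[OF u(3), of "z q' - z q"] by (simp add: dist_real_def)
    moreover have "q' - q < e" using q q' by (auto simp: d'_def)
    ultimately show "\<exists>q\<in>(\<rat> \<union> {t}) \<inter> {s..t}. \<exists>q'\<in>(\<rat> \<union> {t}) \<inter> {s..t}. q \<le> q' \<and>
       q' - q < 1 / Suc n \<and> infdist (z q' - z q) K < 1 / Suc n"
      using q q' u by (intro bexI[of _ q] bexI[of _ q']) (auto simp: e_def)
  qed
next
  assume ?R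
  then have "\<exists>p. \<forall>n::nat. fst (p n) \<in> {s..t} \<and> snd (p n) \<in> {s..t} \<and> fst (p n) \<le> snd (p n) \<and>
       snd (p n) - fst (p n) < 1 / Suc n \<and> infdist (z (snd (p n)) - z (fst (p n))) K < 1 / Suc n"
    by (intro choice) (metis (no_types, lifting) IntE fst_conv snd_conv)
  then obtain p where p: "\<And>n::nat. fst (p n) \<in> {s..t}" "\<And>n. snd (p n) \<in> {s..t}"
    "\<And>n. fst (p n) \<le> snd (p n)" "\<And>n. snd (p n) - fst (p n) < 1 / Suc n"
    "\<And>n. infdist (z (snd (p n)) - z (fst (p n))) K < 1 / Suc n" by blast
  \<comment> \<open>The candidate for the jump time is a limit point of the left endpoints; as the
    gaps shrink, the right endpoints approach it as well.\<close>
  obtain u r where u: "u \<in> {s..t}" "strict_mono r" "((\<lambda>n. fst (p n)) \<circ> r) \<longlonglongrightarrow> u"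
    using compact_imp_seq_compact[of "{s..t}"] p(1) unfolding seq_compact_def by (metis compact_Icc)
  \<comment> \<open>Positive because \<open>K\<close> is closed and omits 0; an increment within
    \<open>D / 2\<close> of \<open>K\<close> therefore has size at least
    \<open>D / 2\<close>.\<close>
  define D where "D = infdist 0 K"
  have D: "D > 0" using in_closed_iff_infdist_zero[OF K(1,2), of 0] K(3) infdist_nonneg[of 0 K]
    by (auto simp: D_def)
  have uH: "u \<in> {0..H}" using u st by auto
  \<comment> \<open>An increment close to \<open>K\<close> has size at least \<open>e\<close>, while
    increments on one side of \<open>u\<close> stay below \<open>e\<close>. So
    \<open>q < u \<le> q'\<close>, and the increment approximates the jump at \<open>u\<close>; with
    \<open>s \<le> q\<close> this also excludes \<open>u = s\<close>.\<close>
  have key: "s < u \<and> infdist (z u - left_lim z u) K \<le> 2 * e" if e: "0 < e" "e \<le> D / 2" for e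
  proof -
    obtain d where d: "0 < d"
      "\<And>q q'. u \<le> q \<Longrightarrow> q \<le> q' \<Longrightarrow> q' < u + d \<Longrightarrow> q' \<le> H \<Longrightarrow> \<bar>z q' - z q\<bar> < e"
      "\<And>q q'. u - d < q \<Longrightarrow> 0 \<le> q \<Longrightarrow> q \<le> q' \<Longrightarrow> q' < u \<Longrightarrow> \<bar>z q' - z q\<bar> < e"
      "\<And>q q'. u - d < q \<Longrightarrow> 0 \<le> q \<Longrightarrow> q < u \<Longrightarrow> u \<le> q' \<Longrightarrow> q' < u + d \<Longrightarrow> q' \<le> H \<Longrightarrow>
        \<bar>z q' - z q - (z u - left_lim z u)\<bar> < e"
      by (fact cadlag_oscillation[OF z uH e(1)])
    have "\<forall>\<^sub>F n in sequentially. dist (fst (p (r n))) u < d / 2"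
      using u(3) d(1) by (intro tendstoD) (auto simp: comp_def)
    moreover have "\<forall>\<^sub>F n in sequentially. 1 / Suc n < min e (d / 2)"
      using order_tendstoD(2)[OF LIMSEQ_inverse_real_of_nat, of "min e (d / 2)"] e d
      by (simp add: inverse_eq_divide)
    ultimately have "\<forall>\<^sub>F n in sequentially. dist (fst (p (r n))) u < d / 2 \<and> 1 / Suc n < min e (d / 2)"
      by eventually_elim simp
    then obtain n where n: "dist (fst (p (r n))) u < d / 2" "1 / Suc n < min e (d / 2)"
      unfolding eventually_sequentially by blast
    define q q' where "q = fst (p (r n))" "q' = snd (p (r n))"
    have "1 / Suc (r n) \<le> 1 / Suc n"
      using seq_suble[OF u(2), of n] by (simp add: frac_le)
    then have q: "q \<in> {s..t}" "q' \<in> {s..t}" "q \<le> q'" "dist q u < d / 2" "q' - q < d / 2"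
      "infdist (z q' - z q) K < e"
      using p[of "r n"] n unfolding q_q'_def by auto
    have "D \<le> infdist (z q' - z q) K + dist 0 (z q' - z q)"
      unfolding D_def by (rule infdist_triangle)
    then have "e \<le> \<bar>z q' - z q\<bar>" using q e by (simp add: dist_real_def)
    have b: "u - d < q" "q' < u + d"
      using q(4,5) d(1) unfolding dist_real_def by linarith+
    have *: "q < u"
      by (rule ccontr) (use d(2)[of q q'] b q st \<open>e \<le> \<bar>z q' - z q\<bar>\<close> in auto)
    have *: "q < u" "u \<le> q'"
      using d(3)[of q q'] b q st \<open>e \<le> \<bar>z q' - z q\<bar>\<close> * by (force)+
    then have "\<bar>z q' - z q - (z u - left_lim z u)\<bar> < e"
      using d(4)[of q q'] q st by (auto simp: dist_real_def)
    moreover have "infdist (z u - left_lim z u) K \<le>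
        infdist (z q' - z q) K + dist (z u - left_lim z u) (z q' - z q)"
      by (rule infdist_triangle)
    ultimately show ?thesis using * q by (auto simp: dist_real_def)
  qed
  have "infdist (z u - left_lim z u) K \<le> 0 + e" if "0 < e" for e
  proof -
    have "infdist (z u - left_lim z u) K \<le> 2 * min (D / 2) (e / 2)"
      using key[of "min (D / 2) (e / 2)"] D that by simp
    then show ?thesis by linarith
  qed
  then have "infdist (z u - left_lim z u) K = 0"
    using field_le_epsilon[of "infdist (z u - left_lim z u) K" 0] infdist_nonneg[of "z u - left_lim z u" K]
    by force
  then have "z u - left_lim z u \<in> K" using in_closed_iff_infdist_zero[OF K(1,2)] by blast
  moreover have "u \<in> {s<..t}" using key[of "D / 2"] D u by auto
  ultimately show ?L by blast
qed

text \<open>Cells are open on the left and closed on the right, so the cell of \<open>u\<close> is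
  given by the ceiling of its rescaled position, shifted by one because cells are numbered from
  0.\<close>

lemma real_index_iff:
  fixes s t u :: real and n k :: nat
  assumes "s < t" "u \<in> {s<..t}" "0 < n"
  shows "u \<in> {s + k * (t - s) / n<..s + Suc k * (t - s) / n} \<longleftrightarrow>
    k = nat (\<lceil>(u - s) * n / (t - s)\<rceil> - 1)"
proof -
  define w where "w = (u - s) * n / (t - s)"
  have "0 < w" using assms by (auto simp: w_def)
  have "u \<in> {s + k * (t - s) / n<..s + Suc k * (t - s) / n} \<longleftrightarrow> real k < w \<and> w \<le> real k + 1"
    using assms by (auto simp: w_def field_simps)
  also have "\<dots> \<longleftrightarrow> \<lceil>w\<rceil> = int k + 1"
    by (auto simp: ceiling_eq_iff)
  also have "\<dots> \<longleftrightarrow> k = nat (\<lceil>w\<rceil> - 1)"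
    using \<open>0 < w\<close> by (auto simp: nat_eq_iff)
  finally show ?thesis by (simp add: w_def)
qed

text \<open>Each point lies in exactly one cell, so the cells that are hit form the image of
  \<open>S\<close> under the index map, and this map is injective once the mesh is below the
  smallest gap in \<open>S\<close>. Numbers of jumps thereby become limits of finite sums of
  indicators.\<close>

lemma card_partition_hits:
  fixes s t :: real and n :: nat
  assumes st: "s < t" and S: "finite S" "S \<subseteq> {s<..t}"
  shows "0 < n \<Longrightarrow> card {k. k < n \<and> (\<exists>u\<in>S. u \<in> {s + k * (t - s) / n<..s + Suc k * (t - s) / n})} \<le> card S"
    and "\<forall>\<^sub>F n in sequentially.
      card {k. k < n \<and> (\<exists>u\<in>S. u \<in> {s + k * (t - s) / n<..s + Suc k * (t - s) / n})} = card S"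
proof -
  define ix where "ix n u = nat (\<lceil>(u - s) * real n / (t - s)\<rceil> - 1)" for n u
  have eq: "{k. k < n \<and> (\<exists>u\<in>S. u \<in> {s + k * (t - s) / n<..s + Suc k * (t - s) / n})} = ix n ` S"
    (is "?A n = _") if n: "0 < n" for n
  proof -
    have "ix n u < n" if "u \<in> S" for u
    proof -
      have "0 < (u - s) * real n / (t - s)" "(u - s) * real n / (t - s) \<le> n"
        using that S st n by (auto simp: field_simps)
      then have "0 < \<lceil>(u - s) * real n / (t - s)\<rceil>" "\<lceil>(u - s) * real n / (t - s)\<rceil> \<le> int n"
        by (auto simp: ceiling_le_iff)
      then show ?thesis unfolding ix_def by linarith
    qed
    then show ?thesis
      using real_index_iff[OF st _ n] S(2) unfolding ix_def image_def by fast
  qed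
  show "card (?A n) \<le> card S" if "0 < n" for n
    unfolding eq[OF that] by (rule card_image_le[OF S(1)])
  have "\<exists>g>0. \<forall>u\<in>S. \<forall>v\<in>S. u < v \<longrightarrow> g \<le> v - u"
  proof -
    define P where "P = {v - u |u v. u \<in> S \<and> v \<in> S \<and> u < v}"
    have "P \<subseteq> (\<lambda>(u, v). v - u) ` (S \<times> S)" by (auto simp: P_def)
    then have "finite P" using S(1) by (meson finite_SigmaI finite_surj)
    \<comment> \<open>The 1 keeps the minimum defined when \<open>S\<close> has at most one point
      and there are no gaps.\<close>
    then show ?thesis
      by (intro exI[of _ "Min (insert 1 P)"]) (auto simp: P_def Min_gr_iff intro!: Min_le)
  qed
  then obtain g where g: "g > 0" "\<And>u v. u \<in> S \<Longrightarrow> v \<in> S \<Longrightarrow> u < v \<Longrightarrow> g \<le> v - u" by blast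
  obtain n0 :: nat where n0: "n0 > (t - s) / g" using reals_Archimedean2 by blast
  show "\<forall>\<^sub>F n in sequentially. card (?A n) = card S"
    using eventually_ge_at_top[of "max 1 n0"]
  proof eventually_elim
    case (elim n)
    then have n: "0 < n" "n > (t - s) / g" using n0 by auto
    \<comment> \<open>Moving from \<open>u\<close> to \<open>v\<close> raises the rescaled position
      by at least 1, hence its ceiling too.\<close>
    have less: "ix n u < ix n v" if "u \<in> S" "v \<in> S" "u < v" for u v
    proof -
      have "(t - s) < n * g" using n g by (simp add: field_simps)
      also have "\<dots> \<le> n * (v - u)" using g(2)[OF that] by (simp add: mult_left_mono)
      finally have "(u - s) * n + (t - s) \<le> (v - s) * n"
        by (simp add: algebra_simps)
      then have "((u - s) * n + (t - s)) / (t - s) \<le> (v - s) * n / (t - s)"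
        using st by (intro divide_right_mono) auto
      then have "(u - s) * n / (t - s) + 1 \<le> (v - s) * n / (t - s)"
        using st by (simp add: add_divide_distrib)
      moreover have "0 < (u - s) * n / (t - s)" using that S st n by auto
      ultimately show ?thesis unfolding ix_def by linarith
    qed
    have "inj_on (ix n) S"
      using less by (intro inj_onI) (metis less_irrefl linorder_neqE_linordered_idom)
    then show ?case unfolding eq[OF n(1)] by (rule card_image)
  qed
qed

text \<open>From a rational just before \<open>u\<close> to a point of the countable set at or just
  after \<open>u\<close>, the left side changes by exactly \<open>d u\<close> and \<open>h\<close>
  by arbitrarily little. Equality is asked for on a countable set of times, because the identity to
  which this is applied holds almost surely for each fixed time; \<open>H\<close> belongs to the set
  to catch a step at the horizon.\<close>

lemma continuous_step_zero:
  fixes h d :: "real \<Rightarrow> real"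
  assumes h: "continuous_on {0..H} h" and S: "finite S" "S \<subseteq> {0<..H}"
    and eq: "\<And>q. q \<in> (\<rat> \<inter> {0..H}) \<union> {H} \<Longrightarrow> (\<Sum>u | u \<in> S \<and> u \<le> q. d u) = h q"
    and u: "u \<in> S"
  shows "d u = 0"
proof -
  obtain g where g: "g > 0" "\<And>v. v \<in> S \<Longrightarrow> v \<noteq> u \<Longrightarrow> g \<le> dist u v"
    using finite_set_avoid[OF S(1), of u] by blast
  have u0: "0 < u" "u \<le> H" using S u by auto
  have "\<bar>d u\<bar> \<le> 0 + e" if e: "e > 0" for e
  proof -
    obtain c where c: "c > 0" "\<And>q. q \<in> {0..H} \<Longrightarrow> dist q u < c \<Longrightarrow> dist (h q) (h u) < e / 2"
      using h u0 e unfolding continuous_on_iff by (metis atLeastAtMost_iff half_gt_zero less_imp_le)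
    \<comment> \<open>\<open>c\<close> comes from continuity of \<open>h\<close> at
      \<open>u\<close>; \<open>g\<close> keeps all other steps out of the window.\<close>
    define m where "m = min c g"
    have m: "m > 0" using c g by (simp add: m_def)
    have "max 0 (u - m) < u" using u0 m by auto
    then obtain q where q: "q \<in> \<rat>" "max 0 (u - m) < q" "q < u" using Rats_dense_in_real by blast
    have "\<exists>q'\<in>(\<rat> \<inter> {0..H}) \<union> {H}. u \<le> q' \<and> q' < u + m"
    proof (cases "u = H")
      case True
      then show ?thesis using m by auto
    next
      case False
      then have "u < min H (u + m)" using u0 m by auto
      then obtain q' where "q' \<in> \<rat>" "u < q'" "q' < min H (u + m)" using Rats_dense_in_real by blast
      then show ?thesis using u0 by (intro bexI[of _ q']) auto
    qed
    then obtain q' where q': "q' \<in> (\<rat> \<inter> {0..H}) \<union> {H}" "u \<le> q'" "q' < u + m" by blast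
    have "{v. v \<in> S \<and> v \<le> q'} = insert u {v. v \<in> S \<and> v \<le> q}"
    proof (intro set_eqI iffI)
      fix v assume "v \<in> {v. v \<in> S \<and> v \<le> q'}"
      then show "v \<in> insert u {v. v \<in> S \<and> v \<le> q}"
        using g(2)[of v] q q' by (cases "v = u") (auto simp: m_def dist_real_def)
    qed (use q q' u in auto)
    then have "h q' = d u + h q"
      using eq[of q'] eq[of q] q q' S(1) u0 by auto
    moreover have "dist (h q) (h u) < e / 2" "dist (h q') (h u) < e / 2"
      using c(2)[of q] c(2)[of q'] q q' u0 by (auto simp: dist_real_def m_def)
    ultimately show ?thesis unfolding dist_real_def by linarith
  qed
  then have "\<bar>d u\<bar> \<le> 0" by (rule field_le_epsilon)
  then show ?thesis by simp
qed

section \<open>The past of the Levy process is independent of its later increments\<close>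

section \<open>Independence of increments\<close>

text \<open>\<open>indep_var\<close> concerns the sigma-fields generated by the two variables; their
  preimage families are Int-stable and contained in \<open>A\<close> and \<open>B\<close>.\<close>

lemma (in prob_space) indep_set_imp_indep_var:
  assumes ind: "indep_set (sets A) (sets B)" and sp: "space A = space M" "space B = space M"
    and f: "f \<in> measurable A N" and g: "g \<in> measurable B N'"
  shows "indep_var N f N' g"
proof -
  have sub: "sets A \<subseteq> events" "sets B \<subseteq> events"
    using ind by (auto simp: indep_sets2_eq)
  have f': "random_variable N f" and g': "random_variable N' g"
    using f g sp sub by (auto simp: measurable_def)
  have "indep_set {f -` X \<inter> space M |X. X \<in> sets N} {g -` X \<inter> space M |X. X \<in> sets N'}"
    unfolding indep_sets2_eq
  proof (intro conjI ballI)
    fix a b assume "a \<in> {f -` X \<inter> space M |X. X \<in> sets N}" "b \<in> {g -` X \<inter> space M |X. X \<in> sets N'}"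
    then have "a \<in> sets A" "b \<in> sets B"
      using measurable_sets[OF f] measurable_sets[OF g] sp by auto
    then show "prob (a \<inter> b) = prob a * prob b"
      using ind by (auto simp: indep_sets2_eq)
  qed (use f' g' in \<open>auto intro: measurable_sets\<close>)
  moreover have "Int_stable {h -` X \<inter> space M |X. X \<in> sets L}" for h :: "'a \<Rightarrow> 'x" and L
    unfolding Int_stable_def
  proof safe
    fix X Y assume "X \<in> sets L" "Y \<in> sets L"
    then show "\<exists>Xa. h -` X \<inter> space M \<inter> (h -` Y \<inter> space M) = h -` Xa \<inter> space M \<and> Xa \<in> sets L"
      by (intro exI[of _ "X \<inter> Y"]) auto
  qed
  ultimately show ?thesis
    unfolding indep_var_eq using f' g' by (auto intro!: indep_set_sigma_sets)
qed

text \<open>The pi-system of finite-dimensional conditions, on which independence of the generated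
  sigma-fields can be tested.\<close>

definition cylinder_sets :: "'a set \<Rightarrow> ('i \<Rightarrow> 'a \<Rightarrow> real) \<Rightarrow> 'i set \<Rightarrow> 'a set set" where
  "cylinder_sets \<Omega> X T =
     {{\<omega>\<in>\<Omega>. \<forall>u\<in>I. X u \<omega> \<in> B u} | I B. finite I \<and> I \<subseteq> T \<and> (\<forall>u. B u \<in> sets borel)}"

lemma Int_stable_cylinder_sets:
  fixes X :: "'i \<Rightarrow> 'a \<Rightarrow> real"
  shows "Int_stable (cylinder_sets \<Omega> X T)"
  unfolding Int_stable_def cylinder_sets_def
proof safe
  fix I I' :: "'i set" and B B' :: "'i \<Rightarrow> real set"
  assume *: "finite I" "I \<subseteq> T" "\<forall>u. B u \<in> sets borel" "finite I'" "I' \<subseteq> T" "\<forall>u. B' u \<in> sets borel"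
  define C where "C u = (if u \<in> I then B u else UNIV) \<inter> (if u \<in> I' then B' u else UNIV)" for u
  have "{\<omega> \<in> \<Omega>. \<forall>u\<in>I. X u \<omega> \<in> B u} \<inter> {\<omega> \<in> \<Omega>. \<forall>u\<in>I'. X u \<omega> \<in> B' u} =
      {\<omega> \<in> \<Omega>. \<forall>u\<in>I \<union> I'. X u \<omega> \<in> C u}"
    by (auto simp: C_def split: if_splits)
  then show "\<exists>Ia Ba. {\<omega> \<in> \<Omega>. \<forall>u\<in>I. X u \<omega> \<in> B u} \<inter> {\<omega> \<in> \<Omega>. \<forall>u\<in>I'. X u \<omega> \<in> B' u} =
      {\<omega> \<in> \<Omega>. \<forall>u\<in>Ia. X u \<omega> \<in> Ba u} \<and> finite Ia \<and> Ia \<subseteq> T \<and> (\<forall>u. Ba u \<in> sets borel)"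
    using * by (intro exI[of _ "I \<union> I'"] exI[of _ C]) (auto simp: C_def)
qed

lemma sigma_subset_cylinder_sets:
  "sigma_sets \<Omega> (\<Union>u\<in>T. {X u -` B \<inter> \<Omega> |B. B \<in> sets borel}) \<subseteq> sigma_sets \<Omega> (cylinder_sets \<Omega> X T)"
proof (intro sigma_sets_mono subsetI)
  fix a assume "a \<in> (\<Union>u\<in>T. {X u -` B \<inter> \<Omega> |B. B \<in> sets borel})"
  then obtain u B where "u \<in> T" "B \<in> sets borel" "a = X u -` B \<inter> \<Omega>" by auto
  then have "a \<in> cylinder_sets \<Omega> X T"
    unfolding cylinder_sets_def
    by (intro CollectI exI[of _ "{u}"] exI[of _ "\<lambda>_. B"]) auto
  then show "a \<in> sigma_sets \<Omega> (cylinder_sets \<Omega> X T)" by auto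
qed

lemma measurable_sigma_Union:
  fixes X :: "'i \<Rightarrow> 'a \<Rightarrow> real"
  assumes "space N = \<Omega>" "sets N = sigma_sets \<Omega> (\<Union>u\<in>T. {X u -` B \<inter> \<Omega> |B. B \<in> sets borel})"
    and "u \<in> T"
  shows "X u \<in> borel_measurable N"
proof (rule measurableI)
  fix B :: "real set" assume "B \<in> sets borel"
  then have "X u -` B \<inter> \<Omega> \<in> (\<Union>u\<in>T. {X u -` B \<inter> \<Omega> |B. B \<in> sets borel})"
    using assms(3) by blast
  then show "X u -` B \<inter> space N \<in> sets N"
    unfolding assms(1,2) by (rule sigma_sets.Basic)
qed simp

context levy_noise
begin

lemma space_F [simp]: "space (F s) = space M"
  unfolding F_def natural_filtration_def by (intro space_measure_of) auto

lemma sets_F: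
  "sets (F s) = sigma_sets (space M) (\<Union>u\<in>{0..min s H}. {Z u -` B \<inter> space M |B. B \<in> sets borel})"
  unfolding F_def natural_filtration_def by (intro sets_measure_of) auto

lemma Z_measurable: "u \<in> {0..H} \<Longrightarrow> Z u \<in> borel_measurable M"
  using levy unfolding levy_process_def by auto

lemma Z_cadlag: "\<omega> \<in> space M \<Longrightarrow> cadlag_on H (\<lambda>t. Z t \<omega>)"
  using levy unfolding levy_process_def by auto

lemma Z_measurable_F: "0 \<le> u \<Longrightarrow> u \<le> s \<Longrightarrow> u \<le> H \<Longrightarrow> Z u \<in> borel_measurable (F s)"
  by (rule measurable_sigma_Union[OF space_F sets_F]) simp

lemma sets_F_mono: "s \<le> t \<Longrightarrow> sets (F s) \<subseteq> sets (F t)"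
  unfolding sets_F by (intro sigma_sets_mono' UN_mono) auto

lemma sets_F_events: "sets (F s) \<subseteq> events"
  unfolding sets_F
  by (intro sets.sigma_sets_subset) (auto intro!: measurable_sets[OF Z_measurable])

lemma F_subalgebra: "subalgebra M (F s)"
  using sets_F_events by (auto simp: subalgebra_def)

text \<open>Counterpart of \<open>F s\<close>: what the increments after \<open>s\<close>, up to the
  horizon, reveal. All are taken from the base point \<open>s\<close>; increments between two later
  times are differences of these.\<close>

definition future :: "real \<Rightarrow> 'a measure" where
  "future s = sigma (space M) (\<Union>u\<in>{s..H}. {(\<lambda>\<omega>. Z u \<omega> - Z s \<omega>) -` B \<inter> space M |B. B \<in> sets borel})"

lemma space_future [simp]: "space (future s) = space M"
  unfolding future_def by (intro space_measure_of) auto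

lemma sets_future:
  "sets (future s) = sigma_sets (space M) (\<Union>u\<in>{s..H}. {(\<lambda>\<omega>. Z u \<omega> - Z s \<omega>) -` B \<inter> space M |B. B \<in> sets borel})"
  unfolding future_def by (intro sets_measure_of) auto

lemma increment_measurable_future:
  assumes "s \<le> u" "u \<le> v" "v \<le> H"
  shows "(\<lambda>\<omega>. Z v \<omega> - Z u \<omega>) \<in> borel_measurable (future s)"
proof -
  have *: "(\<lambda>\<omega>. Z w \<omega> - Z s \<omega>) \<in> borel_measurable (future s)" if "s \<le> w" "w \<le> H" for w
    by (rule measurable_sigma_Union[OF space_future sets_future]) (use that in simp)
  have "(\<lambda>\<omega>. (Z v \<omega> - Z s \<omega>) - (Z u \<omega> - Z s \<omega>)) \<in> borel_measurable (future s)"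
    using assms by (intro borel_measurable_diff *) auto
  then show ?thesis by simp
qed

text \<open>All times are merged into one grid containing 0 and \<open>s\<close>; the increments
  over this grid are independent, and splitting them at the index of \<open>s\<close> gives the
  product rule. Past values are sums of increments only relative to \<open>Z 0\<close>, which is 0
  merely almost surely, so the past event is exchanged for \<open>a'\<close>, which differs from it
  by a null set.\<close>

lemma indep_cylinders:
  assumes s: "s \<in> {0..H}"
    and I: "finite I" "I \<subseteq> {0..s}" "\<And>u. B u \<in> sets borel"
    and J: "finite J" "J \<subseteq> {s..H}" "\<And>u. C u \<in> sets borel"
  shows "prob ({\<omega>\<in>space M. \<forall>u\<in>I. Z u \<omega> \<in> B u} \<inter> {\<omega>\<in>space M. \<forall>u\<in>J. Z u \<omega> - Z s \<omega> \<in> C u}) =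
    prob {\<omega>\<in>space M. \<forall>u\<in>I. Z u \<omega> \<in> B u} * prob {\<omega>\<in>space M. \<forall>u\<in>J. Z u \<omega> - Z s \<omega> \<in> C u}"
    (is "prob (?a \<inter> ?b) = _")
proof -
  define T where "T = insert 0 (insert s (I \<union> J))"
  define ts where "ts = sorted_list_of_set T"
  define n where "n = length ts - 1"
  define t where "t k = ts ! k" for k
  have T: "finite T" "set ts = T" "sorted ts" "ts \<noteq> []"
  proof -
    show "finite T" using I J by (simp add: T_def)
    then show "set ts = T" "sorted ts" unfolding ts_def by auto
    then show "ts \<noteq> []" by (auto simp: T_def)
  qed
  have T_range: "T \<subseteq> {0..H}" using I J s by (auto simp: T_def)
  have len: "length ts = Suc n" using T(4) by (simp add: n_def)
  have mono: "i \<le> j \<Longrightarrow> j \<le> n \<Longrightarrow> t i \<le> t j" for i j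
    using T(3) len by (auto simp: t_def intro: sorted_nth_mono)
  have index: "\<exists>k\<le>n. u = t k" if "u \<in> T" for u
    using that T(2) len by (metis in_set_conv_nth less_Suc_eq_le t_def)
  have t_T: "t k \<in> T" if "k \<le> n" for k
    using that T(2) len by (metis le_imp_less_Suc nth_mem t_def)
  have t0: "t 0 = 0"
    using index[of 0] mono[of 0] t_T[of 0] T_range by (fastforce simp: T_def)
  obtain m where m: "m \<le> n" "s = t m" using index[of s] by (auto simp: T_def)
  define X where "X k \<omega> = Z (t (Suc k)) \<omega> - Z (t k) \<omega>" for k \<omega>
  have "indep_vars (\<lambda>_. borel) X {..<n}"
    using levy t0 mono t_T[of n] T_range unfolding levy_process_def X_def by auto
  then have ind: "indep_var (PiM {..<m} (\<lambda>_. borel)) (\<lambda>\<omega>. \<lambda>i\<in>{..<m}. X i \<omega>)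
      (PiM {m..<n} (\<lambda>_. borel)) (\<lambda>\<omega>. \<lambda>i\<in>{m..<n}. X i \<omega>)"
    by (rule indep_var_restrict) (use m in auto)
  \<comment> \<open>The past condition as a condition on partial sums of the first block of
    increments; \<open>Q\<close> is its counterpart for the second block.\<close>
  define P where "P = {x \<in> space (PiM {..<m} (\<lambda>_. borel)).
      \<forall>k\<in>{..m}. t k \<in> I \<longrightarrow> (\<Sum>j\<in>{0..<k}. x j) \<in> B (t k)}"
  define Q where "Q = {x \<in> space (PiM {m..<n} (\<lambda>_. borel)).
      \<forall>k\<in>{m..n}. t k \<in> J \<longrightarrow> (\<Sum>j\<in>{m..<k}. x j) \<in> C (t k)}"
  have P: "P \<in> sets (PiM {..<m} (\<lambda>_. borel))"
    unfolding P_def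
  proof (intro sets.sets_Collect_finite_All sets.sets_Collect_imp)
    fix k assume "k \<in> {..m}"
    then have "(\<lambda>x. \<Sum>j\<in>{0..<k}. x j) \<in> borel_measurable (PiM {..<m} (\<lambda>_. borel :: real measure))"
      by (intro borel_measurable_sum measurable_component_singleton) auto
    then show "{x \<in> space (PiM {..<m} (\<lambda>_. borel)). (\<Sum>j\<in>{0..<k}. x j) \<in> B (t k)} \<in> sets (PiM {..<m} (\<lambda>_. borel))"
      using I(3) by measurable
  qed auto
  have Q: "Q \<in> sets (PiM {m..<n} (\<lambda>_. borel))"
    unfolding Q_def
  proof (intro sets.sets_Collect_finite_All sets.sets_Collect_imp)
    fix k assume "k \<in> {m..n}"
    then have "(\<lambda>x. \<Sum>j\<in>{m..<k}. x j) \<in> borel_measurable (PiM {m..<n} (\<lambda>_. borel :: real measure))"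
      by (intro borel_measurable_sum measurable_component_singleton) auto
    then show "{x \<in> space (PiM {m..<n} (\<lambda>_. borel)). (\<Sum>j\<in>{m..<k}. x j) \<in> C (t k)} \<in> sets (PiM {m..<n} (\<lambda>_. borel))"
      using J(3) by measurable
  qed auto
  define a' where "a' = {\<omega>\<in>space M. \<forall>u\<in>I. Z u \<omega> - Z 0 \<omega> \<in> B u}"
  have tele: "(\<Sum>j\<in>{i..<k}. X j \<omega>) = Z (t k) \<omega> - Z (t i) \<omega>" if "i \<le> k" for i k \<omega>
    unfolding X_def using that by (rule sum_Suc_diff')
  have a': "a' = (\<lambda>\<omega>. \<lambda>i\<in>{..<m}. X i \<omega>) -` P \<inter> space M"
  proof -
    have "(\<forall>u\<in>I. Z u \<omega> - Z 0 \<omega> \<in> B u) \<longleftrightarrow> (\<forall>k\<in>{..m}. t k \<in> I \<longrightarrow> Z (t k) \<omega> - Z 0 \<omega> \<in> B (t k))" for \<omega>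
    proof safe
      fix u assume *: "\<forall>k\<in>{..m}. t k \<in> I \<longrightarrow> Z (t k) \<omega> - Z 0 \<omega> \<in> B (t k)" "u \<in> I"
      obtain k where k: "k \<le> n" "u = t k" using index[of u] *(2) by (auto simp: T_def)
      show "Z u \<omega> - Z 0 \<omega> \<in> B u"
      proof (cases "k \<le> m")
        case False
        \<comment> \<open>A grid time of index above \<open>m\<close> is at least \<open>s\<close>,
          and times in \<open>I\<close> are at most \<open>s\<close>.\<close>
        then have "u = s" using mono[of m k] k m I(2) *(2) by auto
        then show ?thesis using * m by auto
      qed (use * k in auto)
    qed auto
    moreover have "(\<Sum>j\<in>{0..<k}. (\<lambda>i\<in>{..<m}. X i \<omega>) j) = Z (t k) \<omega> - Z 0 \<omega>" if "k \<le> m" for k \<omega>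
    proof -
      have "(\<Sum>j\<in>{0..<k}. (\<lambda>i\<in>{..<m}. X i \<omega>) j) = (\<Sum>j\<in>{0..<k}. X j \<omega>)"
        using that by (intro sum.cong) auto
      then show ?thesis using tele[of 0 k \<omega>] t0 by simp
    qed
    ultimately show ?thesis
      by (auto simp: a'_def P_def space_PiM)
  qed
  have b: "?b = (\<lambda>\<omega>. \<lambda>i\<in>{m..<n}. X i \<omega>) -` Q \<inter> space M"
  proof -
    have "(\<forall>u\<in>J. Z u \<omega> - Z s \<omega> \<in> C u) \<longleftrightarrow> (\<forall>k\<in>{m..n}. t k \<in> J \<longrightarrow> Z (t k) \<omega> - Z s \<omega> \<in> C (t k))" for \<omega>
    proof safe
      fix u assume *: "\<forall>k\<in>{m..n}. t k \<in> J \<longrightarrow> Z (t k) \<omega> - Z s \<omega> \<in> C (t k)" "u \<in> J"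
      obtain k where k: "k \<le> n" "u = t k" using index[of u] *(2) by (auto simp: T_def)
      show "Z u \<omega> - Z s \<omega> \<in> C u"
      proof (cases "m \<le> k")
        case False
        then have "u = s" using mono[of k m] k m J(2) *(2) by auto
        then show ?thesis using * m by auto
      qed (use * k in auto)
    qed auto
    moreover have "(\<Sum>j\<in>{m..<k}. (\<lambda>i\<in>{m..<n}. X i \<omega>) j) = Z (t k) \<omega> - Z s \<omega>" if "k \<in> {m..n}" for k \<omega>
    proof -
      have "(\<Sum>j\<in>{m..<k}. (\<lambda>i\<in>{m..<n}. X i \<omega>) j) = (\<Sum>j\<in>{m..<k}. X j \<omega>)"
        using that by (intro sum.cong) auto
      then show ?thesis using tele[of m k \<omega>] that m by simp
    qed
    ultimately show ?thesis
      by (auto simp: Q_def space_PiM)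
  qed
  have Z0: "AE \<omega> in M. Z 0 \<omega> = 0"
    using levy unfolding levy_process_def by auto
  have ev: "?a \<in> events" "?b \<in> events" "a' \<in> events"
  proof -
    show "?b \<in> events" unfolding b
      using measurable_sets[OF _ Q] indep_var_rv2[OF ind] by blast
    show "a' \<in> events" unfolding a'
      using measurable_sets[OF _ P] indep_var_rv1[OF ind] by blast
    show "?a \<in> events"
    proof (intro sets.sets_Collect_finite_All I(1))
      fix u assume "u \<in> I"
      then have "Z u \<in> borel_measurable M" using I(2) s by (intro Z_measurable) auto
      then show "{\<omega> \<in> space M. Z u \<omega> \<in> B u} \<in> events" using I(3)[of u] by measurable
    qed
  qed
  have eq1: "prob ?a = prob a'"
    using Z0 ev by (intro measure_eq_AE) (auto simp: a'_def)
  have eq2: "prob (?a \<inter> ?b) = prob (a' \<inter> ?b)"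
    using Z0 ev by (intro measure_eq_AE) (auto simp: a'_def)
  have "prob (a' \<inter> ?b) = prob ((\<lambda>\<omega>. (\<lambda>i\<in>{..<m}. X i \<omega>, \<lambda>i\<in>{m..<n}. X i \<omega>)) -` (P \<times> Q) \<inter> space M)"
    unfolding a' b by (rule arg_cong[where f = prob]) auto
  also have "\<dots> = prob a' * prob ?b"
    unfolding indep_varD[OF ind P Q] a' b ..
  finally show ?thesis unfolding eq1 eq2 .
qed

text \<open>Both cylinder families are pi-systems satisfying the product rule, so the rule extends
  to the sigma-fields they generate.\<close>

lemma indep_F_future:
  assumes s: "s \<in> {0..H}"
  shows "indep_set (sets (F s)) (sets (future s))"
proof -
  let ?a = "cylinder_sets (space M) Z {0..min s H}"
  let ?b = "cylinder_sets (space M) (\<lambda>u \<omega>. Z u \<omega> - Z s \<omega>) {s..H}"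
  have "indep_set ?a ?b"
    unfolding indep_sets2_eq
  proof (intro conjI ballI)
    show "?a \<subseteq> events"
      unfolding cylinder_sets_def
    proof safe
      fix I and B :: "real \<Rightarrow> real set"
      assume "finite I" "I \<subseteq> {0..min s H}" "\<forall>u. B u \<in> sets borel"
      then show "{\<omega> \<in> space M. \<forall>u\<in>I. Z u \<omega> \<in> B u} \<in> events"
        using measurable_sets[OF Z_measurable]
        by (intro sets.sets_Collect_finite_All) (auto simp: vimage_def Int_def conj_commute)
    qed
    show "?b \<subseteq> events"
      unfolding cylinder_sets_def
    proof safe
      fix I and B :: "real \<Rightarrow> real set"
      assume "finite I" "I \<subseteq> {s..H}" "\<forall>u. B u \<in> sets borel"
      then show "{\<omega> \<in> space M. \<forall>u\<in>I. Z u \<omega> - Z s \<omega> \<in> B u} \<in> events"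
        using measurable_sets[OF borel_measurable_diff[OF Z_measurable Z_measurable]] s
        by (intro sets.sets_Collect_finite_All) (auto simp: vimage_def Int_def conj_commute)
    qed
    fix A C assume "A \<in> ?a" "C \<in> ?b"
    then obtain I B J D where "finite I" "I \<subseteq> {0..min s H}" "\<And>u. B u \<in> sets borel"
      "finite J" "J \<subseteq> {s..H}" "\<And>u. D u \<in> sets borel"
      "A = {\<omega>\<in>space M. \<forall>u\<in>I. Z u \<omega> \<in> B u}" "C = {\<omega>\<in>space M. \<forall>u\<in>J. Z u \<omega> - Z s \<omega> \<in> D u}"
      unfolding cylinder_sets_def by auto
    then show "prob (A \<inter> C) = prob A * prob C"
      using indep_cylinders[OF s, of I B J D] s by (simp add: min_absorb1)
  qed
  then have "indep_set (sigma_sets (space M) ?a) (sigma_sets (space M) ?b)"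
    by (intro indep_set_sigma_sets Int_stable_cylinder_sets)
  then show ?thesis
    using sigma_subset_cylinder_sets[of "space M" Z "{0..min s H}"]
      sigma_subset_cylinder_sets[of "space M" "\<lambda>u \<omega>. Z u \<omega> - Z s \<omega>" "{s..H}"]
    unfolding indep_sets2_eq sets_F sets_future by blast
qed

end

section \<open>The number of jumps of a given size: measurability and moments\<close>

section \<open>Counting jumps\<close>

context levy_noise
begin

definition jump_event :: "real set \<Rightarrow> real \<Rightarrow> real \<Rightarrow> 'a set" where
  "jump_event K s t = {\<omega>\<in>space M. \<exists>u\<in>{s<..t}. jump u \<omega> \<in> K}"

lemma jump_0 [simp]: "jump 0 \<omega> = 0"
  by (simp add: jump_def left_lim_def)

text \<open>A jump in \<open>K\<close> is detected by increments at countably many times inside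
  \<open>[s, t]\<close>. The field \<open>L\<close> is left open so that one argument serves both
  \<open>F\<close>, which knows values up to a time, and \<open>future\<close>, which knows
  increments only.\<close>

lemma jump_event_measurable:
  assumes st: "0 \<le> s" "s \<le> t" "t \<le> H" and K: "closed K" "0 \<notin> K"
    and L: "space L = space M"
      "\<And>q q'. s \<le> q \<Longrightarrow> q \<le> q' \<Longrightarrow> q' \<le> t \<Longrightarrow> (\<lambda>\<omega>. Z q' \<omega> - Z q \<omega>) \<in> borel_measurable L"
  shows "jump_event K s t \<in> sets L"
\<comment> \<open>\<open>infdist\<close> to the empty set is 0 by convention, so the distance
  criterion would be void there.\<close>
proof (cases "K = {}")
  case False
  define D where "D = (\<rat> \<union> {t}) \<inter> {s..t}"
  have D: "countable D" unfolding D_def using countable_rat by auto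
  have "jump_event K s t = {\<omega>\<in>space L. \<forall>n::nat. \<exists>q\<in>D. \<exists>q'\<in>D. q \<le> q' \<and>
       q' - q < 1 / Suc n \<and> infdist (Z q' \<omega> - Z q \<omega>) K < 1 / Suc n}"
    unfolding jump_event_def jump_def L(1) D_def
  proof (intro Collect_cong conj_cong refl)
    fix \<omega> assume "\<omega> \<in> space M"
    then show "(\<exists>u\<in>{s<..t}. Z u \<omega> - left_lim (\<lambda>u. Z u \<omega>) u \<in> K) \<longleftrightarrow>
      (\<forall>n::nat. \<exists>q\<in>(\<rat> \<union> {t}) \<inter> {s..t}. \<exists>q'\<in>(\<rat> \<union> {t}) \<inter> {s..t}. q \<le> q' \<and>
       q' - q < 1 / Suc n \<and> infdist (Z q' \<omega> - Z q \<omega>) K < 1 / Suc n)"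
      using cadlag_jump_in_iff[OF Z_cadlag K(1) False K(2) st] by blast
  qed
  also have "\<dots> \<in> sets L"
  proof (intro sets.sets_Collect_countable_All sets.sets_Collect_countable_Ex' D)
    fix n :: nat and q q' assume qq: "q \<in> D" "q' \<in> D"
    show "{\<omega> \<in> space L. q \<le> q' \<and> q' - q < 1 / Suc n \<and> infdist (Z q' \<omega> - Z q \<omega>) K < 1 / Suc n} \<in> sets L"
    proof (cases "q \<le> q'")
      case True
      then have "(\<lambda>\<omega>. Z q' \<omega> - Z q \<omega>) \<in> borel_measurable L"
        using qq by (intro L(2)) (auto simp: D_def)
      then have "(\<lambda>\<omega>. infdist (Z q' \<omega> - Z q \<omega>) K) \<in> borel_measurable L"
        by (rule measurable_compose) (intro borel_measurable_continuous_onI continuous_intros)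
      then show ?thesis by measurable
    qed simp
  qed
  finally show ?thesis .
qed (simp add: jump_event_def)

lemma jump_event_F:
  assumes "0 \<le> s" "s \<le> t" "t \<le> H" "closed K" "0 \<notin> K" "t \<le> r"
  shows "jump_event K s t \<in> sets (F r)"
  using assms by (intro jump_event_measurable borel_measurable_diff Z_measurable_F) auto

lemma jump_event_future:
  assumes "0 \<le> r" "r \<le> s" "s \<le> t" "t \<le> H" "closed K" "0 \<notin> K"
  shows "jump_event K s t \<in> sets (future r)"
  using assms by (intro jump_event_measurable increment_measurable_future) auto

lemma jump_event_events:
  assumes "0 \<le> s" "s \<le> t" "t \<le> H" "closed K" "0 \<notin> K"
  shows "jump_event K s t \<in> events"
  using jump_event_F[OF assms order_refl] sets_F_events by blast

definition jump_count :: "real \<Rightarrow> real \<Rightarrow> real \<Rightarrow> 'a \<Rightarrow> real" where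
  "jump_count y s t \<omega> = real (card {u\<in>{s<..t}. jump u \<omega> = y})"

lemma jump_count_nonneg [simp]: "0 \<le> jump_count y s t \<omega>"
  by (simp add: jump_count_def)

lemma finite_jumps:
  assumes "\<omega> \<in> space M" "0 < e"
  shows "finite {u\<in>{0..H}. e \<le> \<bar>jump u \<omega>\<bar>}"
  unfolding jump_def by (rule cadlag_finite_large_jumps[OF Z_cadlag[OF assms(1)] assms(2)])

lemma finite_jumps_eq:
  assumes "\<omega> \<in> space M" "y \<noteq> 0" "0 \<le> s" "t \<le> H"
  shows "finite {u\<in>{s<..t}. jump u \<omega> = y}"
  using assms by (intro finite_subset[OF _ finite_jumps[of \<omega> "\<bar>y\<bar>"]]) auto

text \<open>The number of cells of the equidistant partition of \<open>(s, t]\<close> in which a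
  jump of size \<open>y\<close> occurs. As a sum of indicators it has accessible moments; it stays
  below the true count and eventually equals it.\<close>

definition grid_count :: "nat \<Rightarrow> real \<Rightarrow> real \<Rightarrow> real \<Rightarrow> 'a \<Rightarrow> real" where
  "grid_count n y s t \<omega> =
     (\<Sum>k<n. indicator (jump_event {y} (s + real k * (t - s) / real n) (s + real (Suc k) * (t - s) / real n)) \<omega>)"

lemma grid_points:
  fixes s t :: real and n k :: nat
  assumes "s \<le> t" "k < n"
  shows "s \<le> s + k * (t - s) / n" "s + k * (t - s) / n \<le> s + Suc k * (t - s) / n"
    "s + Suc k * (t - s) / n \<le> t"
proof -
  show "s \<le> s + k * (t - s) / n" "s + k * (t - s) / n \<le> s + Suc k * (t - s) / n"
    using assms by (auto intro!: divide_right_mono mult_right_mono)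
  have "real (Suc k) * (t - s) \<le> n * (t - s)"
    using assms by (intro mult_right_mono) auto
  then show "s + Suc k * (t - s) / n \<le> t"
    using assms by (simp add: field_simps)
qed

lemma grid_count_eq:
  assumes st: "s < t" and \<omega>: "\<omega> \<in> space M"
  shows "grid_count n y s t \<omega> = card {k. k < n \<and> (\<exists>u\<in>{u\<in>{s<..t}. jump u \<omega> = y}.
    u \<in> {s + real k * (t - s) / real n<..s + real (Suc k) * (t - s) / real n})}"
proof -
  have "\<omega> \<in> jump_event {y} (s + real k * (t - s) / real n) (s + real (Suc k) * (t - s) / real n) \<longleftrightarrow>
      (\<exists>u\<in>{u\<in>{s<..t}. jump u \<omega> = y}.
        u \<in> {s + real k * (t - s) / real n<..s + real (Suc k) * (t - s) / real n})" if "k < n" for k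
  proof -
    have "{s + real k * (t - s) / real n<..s + real (Suc k) * (t - s) / real n} \<subseteq> {s<..t}"
      using grid_points(1,3)[OF less_imp_le[OF st] that] by (intro subsetI) (simp only: greaterThanAtMost_iff, linarith)
    then show ?thesis using \<omega> unfolding jump_event_def by blast
  qed
  then have "indicator (jump_event {y} (s + real k * (t - s) / real n) (s + real (Suc k) * (t - s) / real n)) \<omega> =
      (if \<exists>u\<in>{u\<in>{s<..t}. jump u \<omega> = y}. u \<in> {s + real k * (t - s) / real n<..s + real (Suc k) * (t - s) / real n}
       then 1 else 0 :: real)" if "k < n" for k
    using that by (simp add: indicator_def)
  then have "grid_count n y s t \<omega> = (\<Sum>k<n.
      if \<exists>u\<in>{u\<in>{s<..t}. jump u \<omega> = y}. u \<in> {s + real k * (t - s) / real n<..s + real (Suc k) * (t - s) / real n}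
      then 1 else 0)"
    unfolding grid_count_def by (intro sum.cong) auto
  also have "\<dots> = card ({..<n} \<inter> {k. \<exists>u\<in>{u\<in>{s<..t}. jump u \<omega> = y}.
      u \<in> {s + real k * (t - s) / real n<..s + real (Suc k) * (t - s) / real n}})"
    by (simp add: sum.If_cases)
  finally show ?thesis
    by (simp add: Int_def lessThan_def)
qed

lemma grid_count_le:
  assumes st: "0 \<le> s" "s < t" "t \<le> H" and \<omega>: "\<omega> \<in> space M" and y: "y \<noteq> 0"
  shows "grid_count n y s t \<omega> \<le> jump_count y s t \<omega>"
proof (cases "n = 0")
  case False
  then have "0 < n" by simp
  then show ?thesis
    unfolding grid_count_eq[OF st(2) \<omega>] jump_count_def of_nat_le_iff
    by (intro card_partition_hits(1)[OF st(2) finite_jumps_eq[OF \<omega> y st(1,3)]]) auto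
qed (simp add: grid_count_def)

lemma grid_count_tendsto:
  assumes st: "0 \<le> s" "s < t" "t \<le> H" and \<omega>: "\<omega> \<in> space M" and y: "y \<noteq> 0"
  shows "(\<lambda>n. grid_count n y s t \<omega>) \<longlonglongrightarrow> jump_count y s t \<omega>"
proof (rule tendsto_eventually)
  show "\<forall>\<^sub>F n in sequentially. grid_count n y s t \<omega> = jump_count y s t \<omega>"
    unfolding grid_count_eq[OF st(2) \<omega>] jump_count_def of_nat_eq_iff
    by (intro card_partition_hits(2)[OF st(2) finite_jumps_eq[OF \<omega> y st(1,3)]]) auto
qed

text \<open>A limit of grid counts, which are built from jump events; again \<open>L\<close> may be
  a past or a future field.\<close>

lemma jump_count_measurable_general:
  assumes st: "0 \<le> s" "s \<le> t" "t \<le> H" and y: "y \<noteq> 0" and L: "space L = space M"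
    "\<And>p q. s \<le> p \<Longrightarrow> p \<le> q \<Longrightarrow> q \<le> t \<Longrightarrow> jump_event {y} p q \<in> sets L"
  shows "jump_count y s t \<in> borel_measurable L"
proof (cases "s < t")
  case True
  have meas: "grid_count n y s t \<in> borel_measurable L" for n
    unfolding grid_count_def using grid_points[of s t _ n] st
    by (intro borel_measurable_sum borel_measurable_indicator L(2)) auto
  show ?thesis
    by (rule borel_measurable_LIMSEQ_real[OF _ meas])
       (use grid_count_tendsto[OF st(1) True st(3) _ y] L(1) in auto)
next
  case False
  then have "jump_count y s t = (\<lambda>_. 0)" by (auto simp: jump_count_def fun_eq_iff)
  then show ?thesis by simp
qed

lemma jump_count_F:
  assumes "0 \<le> s" "s \<le> t" "t \<le> H" "y \<noteq> 0" "t \<le> r"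
  shows "jump_count y s t \<in> borel_measurable (F r)"
  using assms by (intro jump_count_measurable_general jump_event_F) auto

lemma jump_count_future:
  assumes "0 \<le> s" "s \<le> t" "t \<le> H" "y \<noteq> 0"
  shows "jump_count y s t \<in> borel_measurable (future s)"
  using assms by (intro jump_count_measurable_general jump_event_future) auto

lemma jump_count_measurable:
  assumes "0 \<le> s" "s \<le> t" "t \<le> H" "y \<noteq> 0"
  shows "jump_count y s t \<in> borel_measurable M"
  using jump_count_F[OF assms order_refl] F_subalgebra measurable_from_subalg by blast

lemma jump_count_add:
  assumes "0 \<le> s" "s \<le> t" "t \<le> r" "r \<le> H" "y \<noteq> 0" "\<omega> \<in> space M"
  shows "jump_count y s r \<omega> = jump_count y s t \<omega> + jump_count y t r \<omega>"
proof -
  have "{u\<in>{s<..r}. jump u \<omega> = y} = {u\<in>{s<..t}. jump u \<omega> = y} \<union> {u\<in>{t<..r}. jump u \<omega> = y}"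
    using assms by auto
  then show ?thesis
    using card_Un_disjoint[OF finite_jumps_eq[of \<omega> y s t] finite_jumps_eq[of \<omega> y t r]] assms
    unfolding jump_count_def of_nat_add[symmetric] of_nat_eq_iff by (auto simp: disjoint_iff)
qed

lemma N_eq_jump_count:
  assumes "y \<noteq> 0"
  shows "real (N t {y} \<omega>) = jump_count y 0 t \<omega>"
proof -
  have "{s\<in>{0..t}. jump s \<omega> \<in> {y}} = {u\<in>{0<..t}. jump u \<omega> = y}"
    using assms by (auto simp: less_le)
  then show ?thesis by (simp add: N_def jump_count_def)
qed

text \<open>The set \<open>{y}\<close> stays away from 0, so the intensity assumption applies to it,
  and finiteness of \<nu> turns \<open>emeasure\<close> into a real number.\<close>

lemma expectation_jump_count_0:
  assumes t: "t \<in> {0..H}" and y: "y \<noteq> 0"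
  shows "integrable M (jump_count y 0 t)" "expectation (jump_count y 0 t) = t * measure \<nu> {y}"
proof -
  interpret \<nu>: finite_measure \<nu> by (rule levy_measure_finite)
  have "(\<integral>\<^sup>+ \<omega>. ennreal (jump_count y 0 t \<omega>) \<partial>M) = ennreal t * emeasure \<nu> {y}"
    using levy_measure_intensity[OF t, of "{y}"] y
    by (simp add: N_eq_jump_count[OF y, symmetric] ennreal_of_nat_eq_real_of_nat)
  also have "\<dots> = ennreal (t * measure \<nu> {y})"
    using t by (simp add: \<nu>.emeasure_eq_measure ennreal_mult)
  finally have *: "(\<integral>\<^sup>+ \<omega>. ennreal (jump_count y 0 t \<omega>) \<partial>M) = ennreal (t * measure \<nu> {y})" .
  have m: "jump_count y 0 t \<in> borel_measurable M"
    using t y by (intro jump_count_measurable) auto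
  show "integrable M (jump_count y 0 t)"
    using * m by (intro integrableI_nonneg) auto
  show "expectation (jump_count y 0 t) = t * measure \<nu> {y}"
    using * t by (subst integral_eq_nn_integral[OF m]) auto
qed

lemma expectation_jump_count:
  assumes st: "0 \<le> s" "s \<le> t" "t \<le> H" and y: "y \<noteq> 0"
  shows "integrable M (jump_count y s t)" "expectation (jump_count y s t) = (t - s) * measure \<nu> {y}"
proof -
  have eq: "jump_count y s t \<omega> = jump_count y 0 t \<omega> - jump_count y 0 s \<omega>" if "\<omega> \<in> space M" for \<omega>
    using jump_count_add[of 0 s t y \<omega>] st y that by simp
  have int: "integrable M (jump_count y 0 t)" "integrable M (jump_count y 0 s)"
    using expectation_jump_count_0(1)[OF _ y] st by auto
  show "integrable M (jump_count y s t)"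
    using Bochner_Integration.integrable_diff[OF int]
    by (subst Bochner_Integration.integrable_cong[OF refl eq]) auto
  have "expectation (jump_count y s t) = expectation (\<lambda>\<omega>. jump_count y 0 t \<omega> - jump_count y 0 s \<omega>)"
    by (rule Bochner_Integration.integral_cong[OF refl eq])
  also have "\<dots> = (t - s) * measure \<nu> {y}"
    using int expectation_jump_count_0(2)[OF _ y] st by (simp add: algebra_simps)
  finally show "expectation (jump_count y s t) = (t - s) * measure \<nu> {y}" .
qed

text \<open>\<open>A\<close> is decided by time \<open>s\<close> and the count by the increments
  after \<open>s\<close>, so the two factors are independent. This is the compensation formula on a
  predictable rectangle.\<close>

lemma nn_integral_jump_count:
  assumes st: "0 \<le> s" "s \<le> t" "t \<le> H" and y: "y \<noteq> 0" and A: "A \<in> sets (F s)"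
  shows "(\<integral>\<^sup>+ \<omega>. ennreal (indicator A \<omega> * jump_count y s t \<omega>) \<partial>M) =
    ennreal (prob A * ((t - s) * measure \<nu> {y}))"
proof -
  have Ae: "A \<in> events" using A sets_F_events by auto
  have ind: "indep_var borel (indicator A :: 'a \<Rightarrow> real) borel (jump_count y s t)"
    using st A jump_count_future[OF st y]
    by (intro indep_set_imp_indep_var[OF indep_F_future[of s]] borel_measurable_indicator) auto
  note int = expectation_jump_count[OF st y]
  have "integrable M (\<lambda>\<omega>. indicator A \<omega> * jump_count y s t \<omega>)"
    using Ae by (intro indep_var_integrable[OF ind _ int(1)]) (auto simp: less_top[symmetric])
  moreover have "expectation (\<lambda>\<omega>. indicator A \<omega> * jump_count y s t \<omega>) = prob A * ((t - s) * measure \<nu> {y})"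
    using Ae int(2) by (subst indep_var_lebesgue_integral[OF ind _ int(1)]) (auto simp: less_top[symmetric])
  ultimately show ?thesis
    by (subst nn_integral_eq_integral) auto
qed

lemma prob_jump_event_Int:
  assumes "0 \<le> s" "s \<le> t" "t \<le> p" "p \<le> q" "q \<le> H" "closed K" "0 \<notin> K"
  shows "prob (jump_event K s t \<inter> jump_event K p q) = prob (jump_event K s t) * prob (jump_event K p q)"
  using assms
  by (intro indep_setD[OF indep_F_future[of p]] jump_event_F jump_event_future) auto

text \<open>The indicators of jump events over disjoint intervals are independent, so the second moment
  of a grid count is at most that of a Poisson variable with the same mean.\<close>
lemma second_moment_jump_count:
  assumes y: "y \<noteq> 0"
  shows "(\<integral>\<^sup>+ \<omega>. ennreal ((jump_count y 0 H \<omega>)\<^sup>2) \<partial>M) \<le>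
    ennreal (H * measure \<nu> {y} + (H * measure \<nu> {y})\<^sup>2)" (is "_ \<le> ennreal ?c")
proof -
  define l where "l = H * measure \<nu> {y}"
  have grid: "(\<integral>\<^sup>+ \<omega>. ennreal ((grid_count n y 0 H \<omega>)\<^sup>2) \<partial>M) \<le> ennreal ?c" for n
  proof -
    define E where "E k = jump_event {y} (0 + real k * (H - 0) / real n) (0 + real (Suc k) * (H - 0) / real n)" for k :: nat
    have E: "E k \<in> events" if "k < n" for k
      unfolding E_def using grid_points[of 0 H k n] that horizon y by (intro jump_event_events) auto
    have gc: "grid_count n y 0 H \<omega> = (\<Sum>k<n. indicator (E k) \<omega>)" for \<omega>
      by (simp add: grid_count_def E_def)
    have ind: "prob (E j \<inter> E k) = prob (E j) * prob (E k)" if "j < k" "k < n" for j k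
    proof -
      have "real (Suc j) * H / n \<le> real k * H / n"
        using that horizon by (intro divide_right_mono mult_right_mono) auto
      then show ?thesis
        unfolding E_def using grid_points[of 0 H k n] grid_points[of 0 H j n] that horizon y
        by (intro prob_jump_event_Int) auto
    qed
    \<comment> \<open>Independence covers all terms off the diagonal; on the diagonal the indicator
      is its own square.\<close>
    have pair: "prob (E j \<inter> E k) \<le> prob (E j) * prob (E k) + (if k = j then prob (E j) else 0)"
      if "j < n" "k < n" for j k
      using ind[of j k] ind[of k j] that by (cases j k rule: linorder_cases) (auto simp: Int_commute mult.commute)
    define p where "p = (\<Sum>k<n. prob (E k))"
    have p0: "0 \<le> p" by (auto simp: p_def intro: sum_nonneg)
    have int_gc: "integrable M (grid_count n y 0 H)"
      unfolding gc[abs_def] using E by (intro Bochner_Integration.integrable_sum) (auto simp: less_top[symmetric])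
    have "p = expectation (grid_count n y 0 H)"
      unfolding gc[abs_def] p_def using E by (subst Bochner_Integration.integral_sum) (auto simp: less_top[symmetric])
    also have "\<dots> \<le> expectation (jump_count y 0 H)"
      using grid_count_le[of 0 H] horizon y int_gc expectation_jump_count(1)[of 0 H]
      by (intro integral_mono) auto
    \<comment> \<open>The cells that are hit are at most as many as the jumps, so the mean of the
      grid count is at most that of the true count.\<close>
    finally have pl: "p \<le> l"
      using expectation_jump_count(2)[of 0 H y] horizon y by (simp add: l_def)
    have sq: "(grid_count n y 0 H \<omega>)\<^sup>2 = (\<Sum>j<n. \<Sum>k<n. indicator (E j \<inter> E k) \<omega>)" for \<omega>
      unfolding gc power2_eq_square sum_product by (simp add: indicator_inter_arith)
    have "expectation (\<lambda>\<omega>. (grid_count n y 0 H \<omega>)\<^sup>2) = (\<Sum>j<n. \<Sum>k<n. prob (E j \<inter> E k))"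
      unfolding sq using E
      by (subst Bochner_Integration.integral_sum)
         (auto simp: less_top[symmetric] Bochner_Integration.integral_sum intro!: sum.cong)
    also have "\<dots> \<le> (\<Sum>j<n. \<Sum>k<n. prob (E j) * prob (E k) + (if k = j then prob (E j) else 0))"
      by (intro sum_mono pair) auto
    also have "\<dots> = p\<^sup>2 + p"
      by (simp add: p_def power2_eq_square sum_product sum.distrib)
    also have "\<dots> \<le> ?c"
      using power_mono[OF pl p0, of 2] pl unfolding l_def by linarith
    finally have *: "expectation (\<lambda>\<omega>. (grid_count n y 0 H \<omega>)\<^sup>2) \<le> ?c" by simp
    have "integrable M (\<lambda>\<omega>. (grid_count n y 0 H \<omega>)\<^sup>2)"
      unfolding sq using E
      by (intro Bochner_Integration.integrable_sum) (auto simp: less_top[symmetric])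
    then show ?thesis
      using * by (subst nn_integral_eq_integral) (auto intro: ennreal_leI)
  qed
  have meas: "grid_count n y 0 H \<in> borel_measurable M" for n
    unfolding grid_count_def using grid_points[of 0 H _ n] horizon y
    by (intro borel_measurable_sum borel_measurable_indicator jump_event_events) auto
  \<comment> \<open>Fatou's lemma carries the bound, uniform in \<open>n\<close>, from the grids to
    the count.\<close>
  have "(\<integral>\<^sup>+ \<omega>. ennreal ((jump_count y 0 H \<omega>)\<^sup>2) \<partial>M) =
      (\<integral>\<^sup>+ \<omega>. liminf (\<lambda>n. ennreal ((grid_count n y 0 H \<omega>)\<^sup>2)) \<partial>M)"
  proof (intro nn_integral_cong)
    fix \<omega> assume "\<omega> \<in> space M"
    then have "(\<lambda>n. ennreal ((grid_count n y 0 H \<omega>)\<^sup>2)) \<longlonglongrightarrow> ennreal ((jump_count y 0 H \<omega>)\<^sup>2)"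
      using horizon y by (intro tendsto_ennrealI tendsto_power grid_count_tendsto) auto
    then show "ennreal ((jump_count y 0 H \<omega>)\<^sup>2) = liminf (\<lambda>n. ennreal ((grid_count n y 0 H \<omega>)\<^sup>2))"
      by (intro lim_imp_Liminf[symmetric]) auto
  qed
  also have "\<dots> \<le> liminf (\<lambda>n. \<integral>\<^sup>+ \<omega>. ennreal ((grid_count n y 0 H \<omega>)\<^sup>2) \<partial>M)"
    using meas by (intro nn_integral_liminf) auto
  also have "\<dots> \<le> liminf (\<lambda>n. ennreal ?c)"
    by (intro Liminf_mono always_eventually allI grid)
  finally show ?thesis by (simp add: Liminf_const)
qed

end

section \<open>The compensation formula for jumps of one size\<close>

section \<open>The compensator of the jumps\<close>

lemma closed_measure_support: "closed (measure_support \<nu>)"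
  unfolding closed_def open_subopen[of "- measure_support \<nu>"]
proof
  fix y assume "y \<in> - measure_support \<nu>"
  then obtain U where U: "open U" "y \<in> U" "\<not> 0 < emeasure \<nu> U"
    by (auto simp: measure_support_def)
  then have "U \<subseteq> - measure_support \<nu>"
    by (auto simp: measure_support_def)
  then show "\<exists>T. open T \<and> y \<in> T \<and> T \<subseteq> - measure_support \<nu>"
    using U by blast
qed

text \<open>The complement is the union of all open null sets, and Lindelof's theorem leaves a
  countable union of them.\<close>

lemma measure_support_compl_null:
  assumes "sets \<nu> = sets borel"
  shows "- measure_support \<nu> \<in> null_sets \<nu>"
proof -
  define \<U> where "\<U> = {U. open U \<and> emeasure \<nu> U = 0}"
  have eq: "- measure_support \<nu> = \<Union>\<U>"
    unfolding measure_support_def \<U>_def by (auto simp: zero_less_iff_neq_zero)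
  obtain \<V> where "\<V> \<subseteq> \<U>" "countable \<V>" "\<Union>\<V> = \<Union>\<U>"
    using Lindelof[of \<U>] by (auto simp: \<U>_def)
  moreover have "U \<in> null_sets \<nu>" if "U \<in> \<U>" for U
    using that assms by (auto simp: \<U>_def null_sets_def)
  ultimately have "(\<Union>U\<in>\<V>. U) \<in> null_sets \<nu>"
    using \<open>\<V> \<subseteq> \<U>\<close> by (intro null_sets_UN') auto
  then show ?thesis
    unfolding eq using \<open>\<Union>\<V> = \<Union>\<U>\<close> by simp
qed

context levy_noise
begin

abbreviation prod_time :: "('a \<times> real) measure" where
  "prod_time \<equiv> M \<Otimes>\<^sub>M restrict_space lborel {0..H}"

lemma finite_measure_time: "finite_measure (restrict_space lborel {0..H})"
  by (intro finite_measureI) (simp add: emeasure_restrict_space space_restrict_space emeasure_lborel_Icc_eq)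

definition predictable_rectangles :: "('a \<times> real) set set" where
  "predictable_rectangles = {A \<times> {0} | A. A \<in> sets (F 0)} \<union>
        {A \<times> {s<..t} | A s t. 0 \<le> s \<and> s \<le> t \<and> t \<le> H \<and> A \<in> sets (F s)}"

lemma predictable_rectangles_cases [consumes 1, case_names zero interval]:
  assumes "R \<in> predictable_rectangles"
  obtains A where "R = A \<times> {0}" "A \<in> sets (F 0)"
    | A s t where "R = A \<times> {s<..t}" "0 \<le> s" "s \<le> t" "t \<le> H" "A \<in> sets (F s)"
  using assms unfolding predictable_rectangles_def by blast

lemma predictable_rectangles_subset: "predictable_rectangles \<subseteq> Pow (space M \<times> {0..H})"
proof
  fix a assume "a \<in> predictable_rectangles"
  then show "a \<in> Pow (space M \<times> {0..H})"
  proof (cases rule: predictable_rectangles_cases)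
    case (zero A)
    then show ?thesis using sets.sets_into_space[of A "F 0"] horizon by auto
  next
    case (interval A s t)
    then show ?thesis using sets.sets_into_space[of A "F s"] by auto
  qed
qed

lemma sets_Pred: "sets Pred = sigma_sets (space M \<times> {0..H}) predictable_rectangles"
  unfolding Pred_def predictable_sigma_def predictable_rectangles_def[symmetric]
  by (rule sets_measure_of[OF predictable_rectangles_subset])

text \<open>Monotonicity of the filtration puts the intersection of the two events into the field at
  the later left endpoint. Sets at time 0 and half-open strips never meet.\<close>

lemma Int_stable_predictable_rectangles: "Int_stable predictable_rectangles"
proof (rule Int_stableI)
  have empty: "{} \<in> predictable_rectangles"
    unfolding predictable_rectangles_def by (intro UnI1 CollectI exI[of _ "{}"]) auto
  fix a b assume a: "a \<in> predictable_rectangles" and b: "b \<in> predictable_rectangles"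
  consider (zero) A B where "a = A \<times> {0}" "b = B \<times> {0}" "A \<in> sets (F 0)" "B \<in> sets (F 0)"
    | (mixed) "a \<inter> b = {}"
    | (intervals) A B s t s' t' where "a = A \<times> {s<..t}" "b = B \<times> {s'<..t'}"
      "A \<in> sets (F s)" "B \<in> sets (F s')" "0 \<le> s" "s \<le> t" "t \<le> H" "0 \<le> s'" "s' \<le> t'" "t' \<le> H"
  proof (cases rule: predictable_rectangles_cases[OF a]; cases rule: predictable_rectangles_cases[OF b])
    fix A B assume "a = A \<times> {0}" "b = B \<times> {0}" "A \<in> sets (F 0)" "B \<in> sets (F 0)"
    then show thesis by (rule that(1))
  next
    fix A B s t s' t' assume "a = A \<times> {s<..t}" "0 \<le> s" "s \<le> t" "t \<le> H" "A \<in> sets (F s)"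
      "b = B \<times> {s'<..t'}" "0 \<le> s'" "s' \<le> t'" "t' \<le> H" "B \<in> sets (F s')"
    then show thesis by (intro that(3)[of A s t B s' t']) auto
  qed (rule that(2); auto)+
  then show "a \<inter> b \<in> predictable_rectangles"
  proof cases
    case zero
    then have "a \<inter> b = (A \<inter> B) \<times> {0}" "A \<inter> B \<in> sets (F 0)" by auto
    then show ?thesis unfolding predictable_rectangles_def by blast
  next
    case mixed
    then show ?thesis using empty by simp
  next
    case intervals
    have eq: "a \<inter> b = (A \<inter> B) \<times> {max s s'<..min t t'}" using intervals by auto
    show ?thesis
    proof (cases "max s s' \<le> min t t'")
      case True
      have "A \<inter> B \<in> sets (F (max s s'))"
        using sets_F_mono[of s "max s s'"] sets_F_mono[of s' "max s s'"] intervals by auto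
      then show ?thesis
        unfolding eq predictable_rectangles_def using True intervals
        by (intro UnI2 CollectI exI[of _ "A \<inter> B"] exI[of _ "max s s'"] exI[of _ "min t t'"]) auto
    next
      case False
      then have "a \<inter> b = {}" unfolding eq by auto
      then show ?thesis using empty by simp
    qed
  qed
qed

lemma sets_Pred_subset: "sets Pred \<subseteq> sets prod_time"
proof -
  have "predictable_rectangles \<subseteq> sets prod_time"
  proof
    fix a assume "a \<in> predictable_rectangles"
    then show "a \<in> sets prod_time"
    proof (cases rule: predictable_rectangles_cases)
      case (zero A)
      then show ?thesis
        using sets_F_events[of 0] horizon
        by (auto simp: sets_restrict_space_iff intro!: pair_measureI)
    next
      case (interval A s t)
      then show ?thesis
        using sets_F_events[of s]
        by (auto simp: sets_restrict_space_iff intro!: pair_measureI)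
    qed
  qed
  then have "sigma_sets (space prod_time) predictable_rectangles \<subseteq> sets prod_time"
    by (rule sets.sigma_sets_subset)
  then show ?thesis
    by (simp add: sets_Pred space_pair_measure space_restrict_space)
qed

text \<open>Taking values in \<open>ennreal\<close> from the counting measure makes this countably
  additive in \<open>A\<close> without any finiteness condition.\<close>

definition jumps_in :: "real \<Rightarrow> ('a \<times> real) set \<Rightarrow> 'a \<Rightarrow> ennreal" where
  "jumps_in y A \<omega> = emeasure (count_space UNIV) {u\<in>{0<..H}. jump u \<omega> = y \<and> (\<omega>, u) \<in> A}"

lemma jumps_in_rectangle:
  assumes "\<omega> \<in> space M" "y \<noteq> 0" "0 \<le> s" "t \<le> H"
  shows "jumps_in y (A \<times> {s<..t}) \<omega> = ennreal (indicator A \<omega> * jump_count y s t \<omega>)"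
proof -
  have "{u\<in>{0<..H}. jump u \<omega> = y \<and> (\<omega>, u) \<in> A \<times> {s<..t}} =
      (if \<omega> \<in> A then {u\<in>{s<..t}. jump u \<omega> = y} else {})"
    using assms by auto
  then show ?thesis
    using finite_jumps_eq[OF assms]
    by (auto simp: jumps_in_def jump_count_def emeasure_count_space_finite ennreal_of_nat_eq_real_of_nat
        simp del: greaterThanAtMost_iff mem_Sigma_iff)
qed

text \<open>The compensator of the jumps of size \<open>y\<close> is \<open>\<nu>{y} ds\<close>: on predictable rectangles this is
  the independence of increments.\<close>
lemma compensation:
  assumes y: "y \<noteq> 0" and A: "A \<in> sets Pred"
  shows "jumps_in y A \<in> borel_measurable M \<and>
    (\<integral>\<^sup>+ \<omega>. jumps_in y A \<omega> \<partial>M) = ennreal (measure \<nu> {y}) * emeasure prod_time A"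
proof -
  interpret R: finite_measure "restrict_space lborel {0..H}" by (rule finite_measure_time)
  interpret P: pair_sigma_finite M "restrict_space lborel {0..H}" ..
  define \<Omega> where "\<Omega> = space M \<times> {0..H}"
  have rect: "jumps_in y (A \<times> {s<..t}) \<in> borel_measurable M \<and>
      (\<integral>\<^sup>+ \<omega>. jumps_in y (A \<times> {s<..t}) \<omega> \<partial>M) = ennreal (measure \<nu> {y}) * emeasure prod_time (A \<times> {s<..t})"
    if A: "A \<in> sets (F s)" and st: "0 \<le> s" "s \<le> t" "t \<le> H" for A s t
  proof
    have Ae: "A \<in> events" using A sets_F_events by auto
    have "(\<lambda>\<omega>. ennreal (indicator A \<omega> * jump_count y s t \<omega>)) \<in> borel_measurable M"
      using Ae jump_count_measurable[OF st y] by measurable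
    then show "jumps_in y (A \<times> {s<..t}) \<in> borel_measurable M"
      by (subst measurable_cong[OF jumps_in_rectangle]) (use st y in auto)
    have "(\<integral>\<^sup>+ \<omega>. jumps_in y (A \<times> {s<..t}) \<omega> \<partial>M) =
        (\<integral>\<^sup>+ \<omega>. ennreal (indicator A \<omega> * jump_count y s t \<omega>) \<partial>M)"
      using st y by (intro nn_integral_cong jumps_in_rectangle) auto
    also have "\<dots> = ennreal (prob A * ((t - s) * measure \<nu> {y}))"
      by (rule nn_integral_jump_count[OF st y A])
    also have "\<dots> = ennreal (measure \<nu> {y}) * (ennreal (prob A) * ennreal (t - s))"
      using st by (simp add: ennreal_mult[symmetric] mult_ac)
    also have "ennreal (prob A) * ennreal (t - s) = emeasure prod_time (A \<times> {s<..t})"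
    proof -
      have "emeasure (restrict_space lborel {0..H}) {s<..t} = ennreal (t - s)"
        using st by (subst emeasure_restrict_space) auto
      then show ?thesis
        using Ae st
        by (subst R.emeasure_pair_measure_Times) (auto simp: sets_restrict_space_iff emeasure_eq_measure)
    qed
    finally show "(\<integral>\<^sup>+ \<omega>. jumps_in y (A \<times> {s<..t}) \<omega> \<partial>M) =
      ennreal (measure \<nu> {y}) * emeasure prod_time (A \<times> {s<..t})" .
  qed
  have full: "jumps_in y \<Omega> \<omega> = jumps_in y (space M \<times> {0<..H}) \<omega>" for \<omega>
    unfolding jumps_in_def \<Omega>_def by (rule arg_cong[where f = "emeasure _"]) auto
  \<comment> \<open>A finite bound common to all sets; it justifies the subtraction in the
    complement step.\<close>
  have full_fin: "jumps_in y B \<omega> \<le> ennreal (jump_count y 0 H \<omega>)" if "\<omega> \<in> space M" for B \<omega>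
  proof -
    have "jumps_in y B \<omega> \<le> jumps_in y (space M \<times> {0<..H}) \<omega>"
      unfolding jumps_in_def using that by (intro emeasure_mono) auto
    then show ?thesis using jumps_in_rectangle[OF that y, of 0 H "space M"] that by simp
  qed
  have A': "A \<in> sigma_sets \<Omega> predictable_rectangles"
    using A by (simp add: sets_Pred \<Omega>_def)
  have in_Prod: "B \<in> sets prod_time" if "B \<in> sigma_sets \<Omega> predictable_rectangles" for B
    using sets_Pred_subset that by (auto simp: sets_Pred \<Omega>_def)
  \<comment> \<open>Dynkin's argument: the predictable rectangles form a pi-system, so complements
    and disjoint countable unions remain to be treated.\<close>
  show ?thesis
    using Int_stable_predictable_rectangles predictable_rectangles_subset[folded \<Omega>_def] A'
  proof (induction rule: sigma_sets_induct_disjoint)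
    case (basic B)
    then show ?case
    proof (cases rule: predictable_rectangles_cases)
      \<comment> \<open>Jumps are counted after time 0, and a single time has no length, so both
        sides vanish.\<close>
      case (zero C)
      have "jumps_in y B \<omega> = 0" for \<omega>
      proof -
        have e: "{u\<in>{0<..H}. jump u \<omega> = y \<and> (\<omega>, u) \<in> B} = {}" using zero by auto
        show ?thesis unfolding jumps_in_def e by simp
      qed
      then have "jumps_in y B = (\<lambda>_. 0)" by auto
      moreover have "emeasure prod_time B = 0"
        using zero sets_F_events[of 0] horizon
        by (subst zero(1), subst R.emeasure_pair_measure_Times)
           (auto simp: sets_restrict_space_iff emeasure_restrict_space)
      ultimately show ?thesis by simp
    next
      case (interval C s t)
      then show ?thesis using rect by blast
    qed
  next
    case empty
    have "jumps_in y {} = (\<lambda>_. 0)" by (simp add: jumps_in_def fun_eq_iff)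
    then show ?case by simp
  next
    case (compl B)
    have split: "jumps_in y B \<omega> + jumps_in y (\<Omega> - B) \<omega> = jumps_in y (space M \<times> {0<..H}) \<omega>"
      if "\<omega> \<in> space M" for \<omega>
      unfolding jumps_in_def using that by (subst plus_emeasure) (auto simp: \<Omega>_def intro!: arg_cong[where f = "emeasure _"])
    have diff: "jumps_in y (\<Omega> - B) \<omega> = jumps_in y (space M \<times> {0<..H}) \<omega> - jumps_in y B \<omega>"
      if "\<omega> \<in> space M" for \<omega>
    proof -
      have "jumps_in y B \<omega> < \<infinity>"
        using full_fin[OF that, of B] le_less_trans by fastforce
      then show ?thesis
        using split[OF that] by (metis add.commute ennreal_add_diff_cancel_right infinity_ennreal_def less_irrefl)
    qed
    have "jumps_in y (space M \<times> {0<..H}) \<in> borel_measurable M"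
      using rect[of "space M" 0 H] horizon sets.top[of "F 0"] by simp
    then have "(\<lambda>\<omega>. jumps_in y (space M \<times> {0<..H}) \<omega> - jumps_in y B \<omega>) \<in> borel_measurable M"
      using compl by (intro borel_measurable_minus_ennreal) auto
    then have meas: "jumps_in y (\<Omega> - B) \<in> borel_measurable M"
      by (subst measurable_cong[OF diff])
    have "emeasure prod_time B + emeasure prod_time (\<Omega> - B) = emeasure prod_time (space M \<times> {0..H})"
      using in_Prod[OF compl(1)] in_Prod[OF sigma_sets.Compl[OF compl(1)]]
        sets.sets_into_space[OF in_Prod[OF compl(1)]]
      by (subst plus_emeasure) (auto simp: \<Omega>_def space_pair_measure space_restrict_space intro!: arg_cong[where f = "emeasure _"])
    \<comment> \<open>Jumps are counted on \<open>(0, H]\<close>, while \<Omega> also contains time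
      0; the difference is a null set.\<close>
    also have "\<dots> = emeasure prod_time (space M \<times> {0<..H})"
    proof -
      have "emeasure (restrict_space lborel {0..H}) {0<..H} = emeasure (restrict_space lborel {0..H}) {0..H}"
        using horizon by (simp add: emeasure_restrict_space[of "{0..H}" lborel] greaterThanAtMost_subseteq_atLeastAtMost_iff)
      then show ?thesis
        by (simp add: R.emeasure_pair_measure_Times sets_restrict_space_iff greaterThanAtMost_subseteq_atLeastAtMost_iff)
    qed
    finally have Q: "emeasure prod_time B + emeasure prod_time (\<Omega> - B) = emeasure prod_time (space M \<times> {0<..H})" .
    have "(\<integral>\<^sup>+ \<omega>. jumps_in y B \<omega> \<partial>M) + (\<integral>\<^sup>+ \<omega>. jumps_in y (\<Omega> - B) \<omega> \<partial>M) =
        (\<integral>\<^sup>+ \<omega>. jumps_in y B \<omega> + jumps_in y (\<Omega> - B) \<omega> \<partial>M)"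
      using compl meas by (intro nn_integral_add[symmetric]) auto
    also have "\<dots> = (\<integral>\<^sup>+ \<omega>. jumps_in y (space M \<times> {0<..H}) \<omega> \<partial>M)"
      by (intro nn_integral_cong split)
    also have "\<dots> = ennreal (measure \<nu> {y}) * emeasure prod_time (space M \<times> {0<..H})"
      using rect[of "space M" 0 H] horizon sets.top[of "F 0"] by simp
    also have "\<dots> = ennreal (measure \<nu> {y}) * emeasure prod_time B + ennreal (measure \<nu> {y}) * emeasure prod_time (\<Omega> - B)"
      unfolding Q[symmetric] by (rule distrib_left)
    finally have "(\<integral>\<^sup>+ \<omega>. jumps_in y B \<omega> \<partial>M) + (\<integral>\<^sup>+ \<omega>. jumps_in y (\<Omega> - B) \<omega> \<partial>M) =
        (\<integral>\<^sup>+ \<omega>. jumps_in y B \<omega> \<partial>M) + ennreal (measure \<nu> {y}) * emeasure prod_time (\<Omega> - B)"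
      using compl by simp
    moreover have "(\<integral>\<^sup>+ \<omega>. jumps_in y B \<omega> \<partial>M) \<noteq> \<top>"
    proof -
      have "(\<integral>\<^sup>+ \<omega>. jumps_in y B \<omega> \<partial>M) \<le> (\<integral>\<^sup>+ \<omega>. ennreal (jump_count y 0 H \<omega>) \<partial>M)"
        by (intro nn_integral_mono full_fin)
      also have "\<dots> < \<infinity>"
        using nn_integral_jump_count[of 0 H y "space M"] horizon y sets.top[of "F 0"]
        by (simp cong: nn_integral_cong)
      finally show ?thesis by simp
    qed
    ultimately show ?case
      using meas by (simp add: ennreal_add_left_cancel)
  next
    case (union B)
    have eq: "jumps_in y (\<Union>i. B i) \<omega> = (\<Sum>i. jumps_in y (B i) \<omega>)" for \<omega>
    proof -
      have "{u\<in>{0<..H}. jump u \<omega> = y \<and> (\<omega>, u) \<in> (\<Union>i. B i)} =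
          (\<Union>i. {u\<in>{0<..H}. jump u \<omega> = y \<and> (\<omega>, u) \<in> B i})" by auto
      then show ?thesis
        unfolding jumps_in_def using union(1)
        by (simp only:, intro suminf_emeasure[symmetric]) (auto simp: disjoint_family_on_def)
    qed
    have meas: "jumps_in y (B i) \<in> borel_measurable M" for i
      using union by blast
    then have "jumps_in y (\<Union>i. B i) \<in> borel_measurable M"
      unfolding eq[abs_def] by measurable
    moreover have "(\<integral>\<^sup>+ \<omega>. jumps_in y (\<Union>i. B i) \<omega> \<partial>M) = (\<Sum>i. ennreal (measure \<nu> {y}) * emeasure prod_time (B i))"
      unfolding eq using union meas by (subst nn_integral_suminf) auto
    moreover have "(\<Sum>i. emeasure prod_time (B i)) = emeasure prod_time (\<Union>i. B i)"
      using union(1,2) in_Prod by (intro suminf_emeasure) auto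
    ultimately show ?case by simp
  qed
qed

text \<open>The expected number of jumps in \<open>A\<close> is \<nu>{y} times the measure of
  \<open>A\<close>. If it is 0 and \<nu>{y} is positive, then \<open>A\<close> is null, and Fubini's
  theorem passes to its time sections. What is known at the jump times is thus carried over to
  almost every time.\<close>

lemma predictable_null_of_no_jumps:
  assumes y: "y \<noteq> 0" "measure \<nu> {y} > 0" and A: "A \<in> sets Pred"
    and no: "AE \<omega> in M. \<forall>u\<in>{0<..H}. jump u \<omega> = y \<longrightarrow> (\<omega>, u) \<notin> A"
  shows "AE \<omega> in M. AE s in lborel. s \<in> {0..H} \<longrightarrow> (\<omega>, s) \<notin> A"
proof -
  interpret R: finite_measure "restrict_space lborel {0..H}" by (rule finite_measure_time)
  interpret P: pair_sigma_finite M "restrict_space lborel {0..H}" ..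
  have "AE \<omega> in M. jumps_in y A \<omega> = 0"
    using no
  proof eventually_elim
    case (elim \<omega>)
    then have e: "{u\<in>{0<..H}. jump u \<omega> = y \<and> (\<omega>, u) \<in> A} = {}" by auto
    show ?case unfolding jumps_in_def e by simp
  qed
  then have "(\<integral>\<^sup>+ \<omega>. jumps_in y A \<omega> \<partial>M) = 0"
    by (subst nn_integral_cong_AE[of _ "\<lambda>_. 0"]) auto
  then have "emeasure prod_time A = 0"
    using compensation[OF y(1) A] y(2) by auto
  then have "AE z in prod_time. z \<notin> A"
    using A sets_Pred_subset by (intro AE_not_in null_setsI) auto
  then have "AE \<omega> in M. AE s in restrict_space lborel {0..H}. (\<omega>, s) \<notin> A"
    by (rule P.AE_pair)
  then show ?thesis
    by (simp add: AE_restrict_space_iff)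
qed

text \<open>The closed sets \<open>K n\<close> exhaust the complement of the support apart from 0.
  Each keeps a positive distance from 0 and has \<nu>-measure 0, so the expected number of jumps
  into it is 0.\<close>

lemma AE_jumps_in_support:
  "AE \<omega> in M. \<forall>u\<in>{0..H}. jump u \<omega> \<noteq> 0 \<longrightarrow> jump u \<omega> \<in> measure_support \<nu>"
proof -
  \<comment> \<open>Adding 0 keeps every \<open>K n\<close> away from 0, as the intensity assumption
    requires.\<close>
  define S where "S = insert 0 (measure_support \<nu>)"
  have S: "closed S" "S \<noteq> {}" "0 \<in> S" using closed_measure_support by (auto simp: S_def)
  define K where "K n = {y. 1 / real (Suc n) \<le> infdist y S}" for n
  have K: "closed (K n)" "0 \<notin> K n" for n
    unfolding K_def using S by (auto intro!: closed_Collect_le continuous_intros)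
  have K_large: "1 / real (Suc n) \<le> \<bar>y\<bar>" if "y \<in> K n" for n y
    using that infdist_le[OF S(3), of y] by (simp add: K_def)
  have "AE \<omega> in M. \<omega> \<notin> jump_event (K n) 0 H" for n
  proof -
    have ev: "jump_event (K n) 0 H \<in> events"
      using horizon K by (intro jump_event_events) auto
    have "emeasure M (jump_event (K n) 0 H) = (\<integral>\<^sup>+ \<omega>. indicator (jump_event (K n) 0 H) \<omega> \<partial>M)"
      using ev by simp
    also have "\<dots> \<le> (\<integral>\<^sup>+ \<omega>. of_nat (N H (K n) \<omega>) \<partial>M)"
    proof (intro nn_integral_mono)
      fix \<omega> assume \<omega>: "\<omega> \<in> space M"
      \<comment> \<open>\<open>card\<close> of an infinite set is 0, so it takes finiteness for a
        jump to force \<open>N\<close> to be at least 1.\<close>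
      have fin: "finite {s\<in>{0..H}. jump s \<omega> \<in> K n}"
        by (rule finite_subset[OF _ finite_jumps[OF \<omega>, of "1 / real (Suc n)"]]) (use K_large in auto)
      show "indicator (jump_event (K n) 0 H) \<omega> \<le> (of_nat (N H (K n) \<omega>) :: ennreal)"
      proof (cases "\<omega> \<in> jump_event (K n) 0 H")
        case True
        then have "{s\<in>{0..H}. jump s \<omega> \<in> K n} \<noteq> {}" unfolding jump_event_def by force
        then have "1 \<le> N H (K n) \<omega>" unfolding N_def using fin by (simp add: Suc_le_eq card_gt_0_iff)
        then have "(of_nat 1 :: ennreal) \<le> of_nat (N H (K n) \<omega>)" by (rule of_nat_mono)
        then show ?thesis using True by simp
      qed simp
    qed
    also have "\<dots> = ennreal H * emeasure \<nu> (K n)"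
      using horizon K by (intro levy_measure_intensity) auto
    also have "emeasure \<nu> (K n) = 0"
    proof -
      have "K n \<subseteq> - measure_support \<nu>"
      proof
        fix y assume "y \<in> K n"
        then have "infdist y S \<noteq> 0" by (auto simp: K_def)
        then show "y \<in> - measure_support \<nu>"
          using in_closed_iff_infdist_zero[OF S(1,2), of y] by (auto simp: S_def)
      qed
      then show ?thesis
        using measure_support_compl_null[OF levy_measure_sets] K levy_measure_sets
        by (metis borel_closed null_setsD1 null_sets_subset)
    qed
    finally have "emeasure M (jump_event (K n) 0 H) = 0" by simp
    then show ?thesis using ev by (intro AE_not_in null_setsI)
  qed
  then have "AE \<omega> in M. \<forall>n. \<omega> \<notin> jump_event (K n) 0 H"
    by (simp add: AE_all_countable)
  then show ?thesis
  proof (rule AE_mp, intro AE_I2 impI ballI)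
    fix \<omega> u assume \<omega>: "\<omega> \<in> space M" and no: "\<forall>n. \<omega> \<notin> jump_event (K n) 0 H"
      and u: "u \<in> {0..H}" "jump u \<omega> \<noteq> 0"
    show "jump u \<omega> \<in> measure_support \<nu>"
    proof (rule ccontr)
      assume "jump u \<omega> \<notin> measure_support \<nu>"
      then have "jump u \<omega> \<notin> S" using u by (simp add: S_def)
      then have "0 < infdist (jump u \<omega>) S"
        using in_closed_iff_infdist_zero[OF S(1,2)] infdist_nonneg[of "jump u \<omega>" S] by force
      then obtain n where "1 / real (Suc n) < infdist (jump u \<omega>) S"
        using nat_approx_posE by blast
      moreover have "u \<noteq> 0" using u(2) by (intro notI) simp
      ultimately have "\<omega> \<in> jump_event (K n) 0 H"
        using u \<omega> unfolding jump_event_def K_def by (auto intro!: bexI[of _ u])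
      then show False using no by blast
    qed
  qed
qed

end

section \<open>Ito isometry and bounds in probability for elementary integrands\<close>

section \<open>Elementary Wiener integrals\<close>

lemma finite_enumerate_real:
  fixes T :: "real set"
  assumes "finite T" "T \<noteq> {}"
  obtains \<tau> :: "nat \<Rightarrow> real" and m where "\<tau> ` {..m} = T" "strict_mono_on {..m} \<tau>"
proof -
  define ts where "ts = sorted_list_of_set T"
  have ts: "set ts = T" "sorted_wrt (<) ts" "ts \<noteq> []"
    using assms by (auto simp: ts_def)
  define m where "m = length ts - 1"
  have len: "length ts = Suc m" using ts(3) by (simp add: m_def)
  show ?thesis
  proof (rule that[of "\<lambda>k. ts ! k" m])
    show "(!) ts ` {..m} = T"
      using ts(1) len by (auto simp: set_conv_nth less_Suc_eq_le image_iff)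
    show "strict_mono_on {..m} ((!) ts)"
      using ts(2) len by (auto simp: sorted_wrt_iff_nth_less intro!: strict_mono_onI)
  qed
qed

lemma chain_mono:
  fixes t :: "nat \<Rightarrow> real"
  assumes "\<And>k. k < n \<Longrightarrow> t k \<le> t (Suc k)" "i \<le> k" "k \<le> n"
  shows "t i \<le> t k"
  using assms(2,3)
proof (induction k rule: dec_induct)
  case (step m)
  then show ?case using assms(1)[of m] by simp
qed simp

context levy_noise
begin

lemma W_measurable_F: "t \<in> {0..H} \<Longrightarrow> t \<le> s \<Longrightarrow> W t \<in> borel_measurable (F s)"
  using wiener sets_F_mono[of t s] unfolding wiener_process_def
  by (auto simp: measurable_def)

lemma measurable_F_M: "f \<in> borel_measurable (F s) \<Longrightarrow> f \<in> borel_measurable M"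
  using F_subalgebra measurable_from_subalg by blast

lemma wiener_increment:
  assumes st: "0 \<le> s" "s \<le> t" "t \<le> H"
  shows "integrable M (\<lambda>\<omega>. W t \<omega> - W s \<omega>)" "expectation (\<lambda>\<omega>. W t \<omega> - W s \<omega>) = 0"
    "integrable M (\<lambda>\<omega>. (W t \<omega> - W s \<omega>)\<^sup>2)" "expectation (\<lambda>\<omega>. (W t \<omega> - W s \<omega>)\<^sup>2) = t - s"
proof -
  have "integrable M (\<lambda>\<omega>. W t \<omega> - W s \<omega>) \<and> expectation (\<lambda>\<omega>. W t \<omega> - W s \<omega>) = 0 \<and>
    integrable M (\<lambda>\<omega>. (W t \<omega> - W s \<omega>)\<^sup>2) \<and> expectation (\<lambda>\<omega>. (W t \<omega> - W s \<omega>)\<^sup>2) = t - s"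
  proof (cases "s < t")
    case True
    define \<sigma> where "\<sigma> = sqrt (t - s)"
    have \<sigma>: "0 < \<sigma>" "\<sigma>\<^sup>2 = t - s" using True by (auto simp: \<sigma>_def)
    have D: "distributed M lborel (\<lambda>\<omega>. W t \<omega> - W s \<omega>) (normal_density 0 \<sigma>)"
      using wiener st True unfolding wiener_process_def \<sigma>_def by blast
    have "integrable M (\<lambda>\<omega>. (W t \<omega> - W s \<omega>) ^ k)" for k
      using integrable_normal_moment[OF \<sigma>(1), of 0 k]
        distributed_integrable[OF D, of "\<lambda>x. x ^ k"] by simp
    from this[of 1] this[of 2] show ?thesis
      using normal_distributed_expectation[OF \<sigma>(1) D] normal_distributed_variance[OF \<sigma>(1) D] \<sigma>(2)
      by simp
  qed (use st in simp)
  then show "integrable M (\<lambda>\<omega>. W t \<omega> - W s \<omega>)" "expectation (\<lambda>\<omega>. W t \<omega> - W s \<omega>) = 0"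
    "integrable M (\<lambda>\<omega>. (W t \<omega> - W s \<omega>)\<^sup>2)" "expectation (\<lambda>\<omega>. (W t \<omega> - W s \<omega>)\<^sup>2) = t - s"
    by auto
qed

text \<open>Partition points may coincide, while the Wiener assumption concerns
  \<open>s < t\<close>; for \<open>s = t\<close> the increment is 0 and a trivial sigma-field takes
  its place. The function \<open>g\<close> provides both the increment and its square.\<close>

lemma wiener_increment_indep:
  assumes st: "0 \<le> s" "s \<le> t" "t \<le> H" and U: "U \<in> borel_measurable (F s)"
    and g: "g \<in> borel_measurable borel"
  shows "indep_var borel U borel (\<lambda>\<omega>. g (W t \<omega> - W s \<omega>) :: real)"
proof (cases "s < t")
  case True
  define A where "A = vimage_algebra (space M) (\<lambda>\<omega>. W t \<omega> - W s \<omega>) (borel :: real measure)"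
  have "sets A = {(\<lambda>\<omega>. W t \<omega> - W s \<omega>) -` B \<inter> space M |B. B \<in> sets borel}"
    unfolding A_def by (rule sets_vimage_algebra2) auto
  then have "indep_set (sets (F s)) (sets A)"
    using wiener st True unfolding wiener_process_def by simp
  moreover have "(\<lambda>\<omega>. g (W t \<omega> - W s \<omega>)) \<in> borel_measurable A"
    unfolding A_def by (rule measurable_compose[OF measurable_vimage_algebra1 g]) auto
  ultimately show ?thesis
    using U by (intro indep_set_imp_indep_var) (auto simp: A_def)
next
  case False
  then have "indep_set (sets (F s)) {{}, space M}"
    using sets_F_events prob_space by (auto simp: indep_sets2_eq Int_absorb2 dest: sets.sets_into_space)
  then have "indep_set (sets (F s)) (sets (sigma (space M) {}))"
    by (simp add: sigma_sets_empty_eq insert_commute)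
  moreover have "(\<lambda>\<omega>. g (W t \<omega> - W s \<omega>)) = (\<lambda>_. g 0)"
    using False st by simp
  ultimately show ?thesis
    using U by (intro indep_set_imp_indep_var[where A = "F s" and B = "sigma (space M) {}"]) auto
qed

text \<open>Induction on the number of steps: the sum so far and the next coefficient are known at
  time \<open>t n\<close>, hence independent of the next increment. The cross term vanishes because
  this increment has mean 0, and its square contributes the length of the step. Measurability and
  integrability are carried along to support the induction.\<close>

lemma elementary_isometry:
  assumes t: "0 \<le> t 0" "\<And>k. k < n \<Longrightarrow> t k \<le> t (Suc k)" "t n \<le> H"
    and \<xi>: "\<And>k. k < n \<Longrightarrow> \<xi> k \<in> borel_measurable (F (t k))"
      "\<And>k. k < n \<Longrightarrow> \<exists>C. \<forall>\<omega>\<in>space M. \<bar>\<xi> k \<omega>\<bar> \<le> C"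
  shows "(\<lambda>\<omega>. \<Sum>k<n. \<xi> k \<omega> * (W (t (Suc k)) \<omega> - W (t k) \<omega>)) \<in> borel_measurable (F (t n)) \<and>
    integrable M (\<lambda>\<omega>. (\<Sum>k<n. \<xi> k \<omega> * (W (t (Suc k)) \<omega> - W (t k) \<omega>))\<^sup>2) \<and>
    integrable M (\<lambda>\<omega>. \<Sum>k<n. (\<xi> k \<omega>)\<^sup>2 * (t (Suc k) - t k)) \<and>
    expectation (\<lambda>\<omega>. (\<Sum>k<n. \<xi> k \<omega> * (W (t (Suc k)) \<omega> - W (t k) \<omega>))\<^sup>2) =
    expectation (\<lambda>\<omega>. \<Sum>k<n. (\<xi> k \<omega>)\<^sup>2 * (t (Suc k) - t k))"
  using assms
proof (induction n)
  case (Suc n)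
  define X where "X \<omega> = (\<Sum>k<n. \<xi> k \<omega> * (W (t (Suc k)) \<omega> - W (t k) \<omega>))" for \<omega>
  define Q where "Q \<omega> = (\<Sum>k<n. (\<xi> k \<omega>)\<^sup>2 * (t (Suc k) - t k))" for \<omega>
  have tn: "t n \<le> t (Suc n)" "t (Suc n) \<le> H" using Suc.prems by auto
  have t0: "0 \<le> t n"
    using chain_mono[of n t 0 n] Suc.prems(1,2) by force
  have IH: "X \<in> borel_measurable (F (t n))" "integrable M (\<lambda>\<omega>. (X \<omega>)\<^sup>2)" "integrable M Q"
    "expectation (\<lambda>\<omega>. (X \<omega>)\<^sup>2) = expectation Q"
    using Suc.IH Suc.prems tn unfolding X_def[abs_def] Q_def[abs_def] by auto
  define D where "D \<omega> = W (t (Suc n)) \<omega> - W (t n) \<omega>" for \<omega>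
  have \<xi>: "\<xi> n \<in> borel_measurable (F (t n))" using Suc.prems by simp
  obtain C where C: "\<And>\<omega>. \<omega> \<in> space M \<Longrightarrow> \<bar>\<xi> n \<omega>\<bar> \<le> C" using Suc.prems(5)[of n] by auto
  note D = wiener_increment[OF t0 tn, folded D_def]
  have X_int: "integrable M X"
    using IH(2) measurable_F_M[OF IH(1)] square_integrable_imp_integrable by blast
  have int1: "integrable M (\<lambda>\<omega>. X \<omega> * \<xi> n \<omega>)"
  proof (rule Bochner_Integration.integrable_bound[OF integrable_mult_right[OF X_int, of C]])
    show "(\<lambda>\<omega>. X \<omega> * \<xi> n \<omega>) \<in> borel_measurable M"
      by (rule borel_measurable_times[OF measurable_F_M[OF IH(1)] measurable_F_M[OF \<xi>]])
    show "AE \<omega> in M. norm (X \<omega> * \<xi> n \<omega>) \<le> norm (C * X \<omega>)"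
    proof (intro AE_I2)
      fix \<omega> assume "\<omega> \<in> space M"
      then have "\<bar>\<xi> n \<omega>\<bar> \<le> \<bar>C\<bar>" using C[of \<omega>] by linarith
      then have "\<bar>X \<omega>\<bar> * \<bar>\<xi> n \<omega>\<bar> \<le> \<bar>X \<omega>\<bar> * \<bar>C\<bar>"
        by (rule mult_left_mono) simp
      then show "norm (X \<omega> * \<xi> n \<omega>) \<le> norm (C * X \<omega>)"
        by (simp add: abs_mult mult.commute)
    qed
  qed
  have int2: "integrable M (\<lambda>\<omega>. (\<xi> n \<omega>)\<^sup>2)"
  proof (rule integrable_const_bound[of _ "C\<^sup>2"])
    show "AE \<omega> in M. norm ((\<xi> n \<omega>)\<^sup>2) \<le> C\<^sup>2"
    proof (intro AE_I2)
      fix \<omega> assume "\<omega> \<in> space M"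
      then show "norm ((\<xi> n \<omega>)\<^sup>2) \<le> C\<^sup>2"
        using power_mono[OF C[of \<omega>] abs_ge_zero, of 2] by simp
    qed
  qed (use measurable_F_M[OF \<xi>] in simp)
  have ind1: "indep_var borel (\<lambda>\<omega>. X \<omega> * \<xi> n \<omega>) borel D"
    unfolding D_def using IH(1) \<xi>
    by (intro wiener_increment_indep[OF t0 tn, where g = "\<lambda>x. x"]) auto
  have ind2: "indep_var borel (\<lambda>\<omega>. (\<xi> n \<omega>)\<^sup>2) borel (\<lambda>\<omega>. (D \<omega>)\<^sup>2)"
    unfolding D_def using \<xi>
    by (intro wiener_increment_indep[OF t0 tn, where g = "\<lambda>x. x\<^sup>2"]) auto
  have i1: "integrable M (\<lambda>\<omega>. X \<omega> * \<xi> n \<omega> * D \<omega>)" "expectation (\<lambda>\<omega>. X \<omega> * \<xi> n \<omega> * D \<omega>) = 0"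
    using indep_var_integrable[OF ind1 int1 D(1)] indep_var_lebesgue_integral[OF ind1 int1 D(1)] D(2) by auto
  have i2: "integrable M (\<lambda>\<omega>. (\<xi> n \<omega>)\<^sup>2 * (D \<omega>)\<^sup>2)"
    "expectation (\<lambda>\<omega>. (\<xi> n \<omega>)\<^sup>2 * (D \<omega>)\<^sup>2) = expectation (\<lambda>\<omega>. (\<xi> n \<omega>)\<^sup>2 * (t (Suc n) - t n))"
    using indep_var_integrable[OF ind2 int2 D(3)] indep_var_lebesgue_integral[OF ind2 int2 D(3)] D(4) int2 by auto
  have sq: "(\<Sum>k<Suc n. \<xi> k \<omega> * (W (t (Suc k)) \<omega> - W (t k) \<omega>))\<^sup>2 =
      (X \<omega>)\<^sup>2 + 2 * (X \<omega> * \<xi> n \<omega> * D \<omega>) + (\<xi> n \<omega>)\<^sup>2 * (D \<omega>)\<^sup>2" for \<omega>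
    by (simp add: X_def D_def power2_eq_square algebra_simps)
  have qs: "(\<Sum>k<Suc n. (\<xi> k \<omega>)\<^sup>2 * (t (Suc k) - t k)) = Q \<omega> + (\<xi> n \<omega>)\<^sup>2 * (t (Suc n) - t n)" for \<omega>
    by (simp add: Q_def)
  have mono: "f \<in> borel_measurable (F (t (Suc n)))" if "f \<in> borel_measurable (F (t n))" for f :: "'a \<Rightarrow> real"
    using that sets_F_mono[OF tn(1)] by (auto simp: measurable_def)
  have "(\<lambda>\<omega>. X \<omega> + \<xi> n \<omega> * D \<omega>) \<in> borel_measurable (F (t (Suc n)))"
    unfolding D_def using tn t0 W_measurable_F[of "t (Suc n)" "t (Suc n)"] W_measurable_F[of "t n" "t (Suc n)"]
      mono[OF IH(1)] mono[OF \<xi>]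
    by (intro borel_measurable_add borel_measurable_times borel_measurable_diff) auto
  moreover have "integrable M (\<lambda>\<omega>. (\<xi> n \<omega>)\<^sup>2 * (t (Suc n) - t n))" using int2 by simp
  ultimately show ?case
    unfolding sq qs using IH i1 i2 by (simp add: X_def D_def)
qed simp

text \<open>Truncating the integrand at the step where \<open>\<integral> k\<^sup>2\<close> would exceed \<open>\<eta>\<^sup>2\<close> keeps it elementary,
  because that integral up to \<open>t\<^sub>k\<^sub>+\<^sub>1\<close> is known at time \<open>t\<^sub>k\<close>.\<close>
lemma elementary_integral_bound:
  assumes t: "0 \<le> t 0" "\<And>k. k < n \<Longrightarrow> t k \<le> t (Suc k)" "t n \<le> H"
    and \<xi>: "\<And>k. k < n \<Longrightarrow> \<xi> k \<in> borel_measurable (F (t k))"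
      "\<And>k. k < n \<Longrightarrow> \<exists>C. \<forall>\<omega>\<in>space M. \<bar>\<xi> k \<omega>\<bar> \<le> C"
    and \<eta>: "0 < \<eta>"
  shows "expectation (\<lambda>\<omega>. min \<bar>\<Sum>k<n. \<xi> k \<omega> * (W (t (Suc k)) \<omega> - W (t k) \<omega>)\<bar> 1) \<le>
    prob {\<omega>\<in>space M. (\<Sum>k<n. (\<xi> k \<omega>)\<^sup>2 * (t (Suc k) - t k)) > \<eta>\<^sup>2} + 2 * \<eta>"
proof -
  define q where "q k \<omega> = (\<Sum>i<k. (\<xi> i \<omega>)\<^sup>2 * (t (Suc i) - t i))" for k \<omega>
  define \<zeta> where "\<zeta> k \<omega> = (if q (Suc k) \<omega> \<le> \<eta>\<^sup>2 then \<xi> k \<omega> else 0)" for k \<omega>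
  have t_mono: "t i \<le> t k" if "i \<le> k" "k \<le> n" for i k
    using chain_mono[of n t i k] t(2) that by blast
  have meas_q: "q (Suc k) \<in> borel_measurable (F (t k))" if "k < n" for k
    unfolding q_def
  proof (intro borel_measurable_sum borel_measurable_times borel_measurable_const borel_measurable_power)
    fix i assume "i \<in> {..<Suc k}"
    then show "\<xi> i \<in> borel_measurable (F (t k))"
      using \<xi>(1)[of i] sets_F_mono[OF t_mono[of i k]] that by (auto simp: measurable_def)
  qed
  have meas_\<zeta>: "\<zeta> k \<in> borel_measurable (F (t k))" if "k < n" for k
    unfolding \<zeta>_def using meas_q[OF that] \<xi>(1)[OF that] by measurable
  have bd_\<zeta>: "\<exists>C. \<forall>\<omega>\<in>space M. \<bar>\<zeta> k \<omega>\<bar> \<le> C" if k: "k < n" for k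
  proof -
    obtain C where "\<forall>\<omega>\<in>space M. \<bar>\<xi> k \<omega>\<bar> \<le> C" using \<xi>(2)[OF k] by blast
    then have "\<forall>\<omega>\<in>space M. \<bar>\<zeta> k \<omega>\<bar> \<le> \<bar>C\<bar>" unfolding \<zeta>_def by force
    then show ?thesis by blast
  qed
  have q_mono: "q i \<omega> \<le> q j \<omega>" if "i \<le> j" "j \<le> n" for i j \<omega>
    unfolding q_def using that t(2) by (intro sum_mono2) auto
  \<comment> \<open>Once \<open>q\<close> has passed the threshold it stays above it, so no later
    coefficient survives; up to then the truncated and the original sums agree.\<close>
  have trunc: "(\<Sum>k<m. (\<zeta> k \<omega>)\<^sup>2 * (t (Suc k) - t k)) \<le> min (q m \<omega>) (\<eta>\<^sup>2)" if "m \<le> n" for m \<omega>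
    using that
  proof (induction m)
    case 0
    then show ?case using \<eta> by (simp add: q_def)
  next
    case (Suc m)
    then have IH: "(\<Sum>k<m. (\<zeta> k \<omega>)\<^sup>2 * (t (Suc k) - t k)) \<le> min (q m \<omega>) (\<eta>\<^sup>2)" by simp
    show ?case
    proof (cases "q (Suc m) \<omega> \<le> \<eta>\<^sup>2")
      case True
      then show ?thesis using IH by (simp add: \<zeta>_def q_def)
    next
      case False
      then show ?thesis using IH q_mono[of m "Suc m" \<omega>] Suc.prems by (simp add: \<zeta>_def)
    qed
  qed
  define X Y where "X \<omega> = (\<Sum>k<n. \<xi> k \<omega> * (W (t (Suc k)) \<omega> - W (t k) \<omega>))"
    and "Y \<omega> = (\<Sum>k<n. \<zeta> k \<omega> * (W (t (Suc k)) \<omega> - W (t k) \<omega>))" for \<omega>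
  have X: "X \<in> borel_measurable M"
    using measurable_F_M elementary_isometry[OF t \<xi>] unfolding X_def[abs_def] by blast
  have Y: "integrable M (\<lambda>\<omega>. (Y \<omega>)\<^sup>2)"
    "expectation (\<lambda>\<omega>. (Y \<omega>)\<^sup>2) = expectation (\<lambda>\<omega>. \<Sum>k<n. (\<zeta> k \<omega>)\<^sup>2 * (t (Suc k) - t k))"
    "integrable M (\<lambda>\<omega>. \<Sum>k<n. (\<zeta> k \<omega>)\<^sup>2 * (t (Suc k) - t k))"
    using elementary_isometry[OF t meas_\<zeta> bd_\<zeta>] unfolding Y_def by blast+
  have "expectation (\<lambda>\<omega>. \<Sum>k<n. (\<zeta> k \<omega>)\<^sup>2 * (t (Suc k) - t k)) \<le> expectation (\<lambda>_. \<eta>\<^sup>2)"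
    using trunc[of n] by (intro integral_mono Y) auto
  then have Y2: "expectation (\<lambda>\<omega>. (Y \<omega>)\<^sup>2) \<le> \<eta>\<^sup>2"
    unfolding Y(2) by (simp add: prob_space)
  define B where "B = {\<omega>\<in>space M. q n \<omega> > \<eta>\<^sup>2}"
  have qn: "q n \<in> borel_measurable M"
    using elementary_isometry[OF t \<xi>] unfolding q_def[abs_def] by blast
  then have B: "B \<in> events" unfolding B_def by measurable
  \<comment> \<open>Off \<open>B\<close> nothing is truncated, and
    \<open>r \<le> \<eta> + r^2 / \<eta>\<close> holds for \<open>r \<ge> 0\<close>. As the second
    moment of \<open>Y\<close> is at most \<open>\<eta>^2\<close>, the last two terms contribute the
    \<open>2 * \<eta>\<close>.\<close>
  have pw: "min \<bar>X \<omega>\<bar> 1 \<le> indicator B \<omega> + \<eta> + (Y \<omega>)\<^sup>2 / \<eta>" if \<omega>: "\<omega> \<in> space M" for \<omega>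
  proof (cases "\<omega> \<in> B")
    case True
    have "0 \<le> \<eta> + (Y \<omega>)\<^sup>2 / \<eta>" using \<eta> by simp
    then show ?thesis using True by simp
  next
    case False
    then have "\<zeta> k \<omega> = \<xi> k \<omega>" if "k < n" for k
      using q_mono[of "Suc k" n \<omega>] that \<omega> by (auto simp: B_def \<zeta>_def)
    then have "X \<omega> = Y \<omega>" by (simp add: X_def Y_def)
    moreover have "\<bar>Y \<omega>\<bar> \<le> \<eta> + (Y \<omega>)\<^sup>2 / \<eta>"
    proof (cases "\<bar>Y \<omega>\<bar> \<le> \<eta>")
      case True
      moreover have "0 \<le> (Y \<omega>)\<^sup>2 / \<eta>" using \<eta> by simp
      ultimately show ?thesis by linarith
    next
      case False
      then have "\<eta> * \<bar>Y \<omega>\<bar> \<le> \<bar>Y \<omega>\<bar> * \<bar>Y \<omega>\<bar>" by (intro mult_right_mono) auto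
      then have "\<bar>Y \<omega>\<bar> \<le> (Y \<omega>)\<^sup>2 / \<eta>" using \<eta> by (simp add: field_simps power2_eq_square)
      then show ?thesis using \<eta> by simp
    qed
    ultimately show ?thesis using False by simp
  qed
  have "expectation (\<lambda>\<omega>. min \<bar>X \<omega>\<bar> 1) \<le> expectation (\<lambda>\<omega>. indicator B \<omega> + \<eta> + (Y \<omega>)\<^sup>2 / \<eta>)"
  proof (rule integral_mono)
    show "integrable M (\<lambda>\<omega>. min \<bar>X \<omega>\<bar> 1)"
      using X by (intro integrable_const_bound[of _ 1]) auto
    show "integrable M (\<lambda>\<omega>. indicator B \<omega> + \<eta> + (Y \<omega>)\<^sup>2 / \<eta>)"
      using B Y by (auto simp: less_top[symmetric])
  qed (rule pw)
  also have "\<dots> = prob B + \<eta> + expectation (\<lambda>\<omega>. (Y \<omega>)\<^sup>2) / \<eta>"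
    using B Y by (simp add: less_top[symmetric] prob_space)
  also have "\<dots> \<le> prob B + 2 * \<eta>"
    using Y2 \<eta> by (simp add: divide_le_eq power2_eq_square)
  finally show ?thesis
    unfolding X_def B_def q_def .
qed

lemma elementary_mono:
  assumes "elementary n t \<xi>" "i \<le> k" "k \<le> n"
  shows "t i \<le> t k"
  using chain_mono[of n t i k] assms unfolding elementary_def by blast

lemma elementary_range:
  assumes "elementary n t \<xi>" "k \<le> n"
  shows "t k \<in> {0..H}"
  using elementary_mono[OF assms(1), of 0 k] elementary_mono[OF assms(1), of k n] assms
  unfolding elementary_def by auto

text \<open>No breakpoint of \<open>t\<close> lies strictly inside a cell of the finer grid, so the
  process is constant on each cell and its value there is already known at the left endpoint. It is
  read off at the right endpoint because cells are open on the left.\<close>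

lemma elementary_process_refined:
  assumes el: "elementary n t \<xi>"
    and \<tau>: "t ` {..n} \<subseteq> \<tau> ` {..m}" "strict_mono_on {..m} \<tau>"
    and k: "k < m"
  shows "elementary_process n t \<xi> (\<tau> (Suc k)) \<in> borel_measurable (F (\<tau> k))"
    and "\<exists>C. \<forall>\<omega>\<in>space M. \<bar>elementary_process n t \<xi> (\<tau> (Suc k)) \<omega>\<bar> \<le> C"
    and "s \<in> {\<tau> k<..\<tau> (Suc k)} \<Longrightarrow> elementary_process n t \<xi> s = elementary_process n t \<xi> (\<tau> (Suc k))"
proof -
  have \<tau>_le: "\<tau> i \<le> \<tau> j \<longleftrightarrow> i \<le> j" if "i \<le> m" "j \<le> m" for i j
    using strict_mono_on_less_eq[OF \<tau>(2)] that by simp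
  have gap: "t j \<le> \<tau> k \<or> \<tau> (Suc k) \<le> t j" if j: "j \<le> n" for j
  proof -
    obtain i where "i \<le> m" "t j = \<tau> i" using \<tau>(1) j by (auto simp: image_subset_iff)
    then show ?thesis using \<tau>_le k by (cases "i \<le> k") auto
  qed
  have meas: "(\<lambda>\<omega>. \<xi> j \<omega> * indicator {t j<..t (Suc j)} (\<tau> (Suc k))) \<in> borel_measurable (F (\<tau> k))"
    if j: "j < n" for j
  proof (cases "t j < \<tau> (Suc k)")
    case True
    then have "t j \<le> \<tau> k" using gap[of j] j by auto
    then have "\<xi> j \<in> borel_measurable (F (\<tau> k))"
      using el j sets_F_mono[of "t j" "\<tau> k"] unfolding elementary_def by (auto simp: measurable_def)
    then show ?thesis by simp
  qed simp
  show "elementary_process n t \<xi> (\<tau> (Suc k)) \<in> borel_measurable (F (\<tau> k))"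
    unfolding elementary_process_def[abs_def] by (intro borel_measurable_sum meas) simp
  have "\<forall>j<n. \<exists>C. \<forall>\<omega>\<in>space M. \<bar>\<xi> j \<omega>\<bar> \<le> C" using el by (auto simp: elementary_def)
  then obtain C where C: "\<And>j \<omega>. j < n \<Longrightarrow> \<omega> \<in> space M \<Longrightarrow> \<bar>\<xi> j \<omega>\<bar> \<le> C j" by metis
  have "\<bar>elementary_process n t \<xi> s \<omega>\<bar> \<le> (\<Sum>j<n. C j)" if "\<omega> \<in> space M" for s \<omega>
  proof -
    have "\<bar>elementary_process n t \<xi> s \<omega>\<bar> \<le> (\<Sum>j<n. \<bar>\<xi> j \<omega> * indicator {t j<..t (Suc j)} s\<bar>)"
      unfolding elementary_process_def by (rule sum_abs)
    also have "\<dots> \<le> (\<Sum>j<n. C j)"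
    proof (intro sum_mono)
      fix j assume "j \<in> {..<n}"
      then show "\<bar>\<xi> j \<omega> * indicator {t j<..t (Suc j)} s\<bar> \<le> C j"
        using C[of j \<omega>] that by (auto simp: indicator_def)
    qed
    finally show ?thesis .
  qed
  then show "\<exists>C. \<forall>\<omega>\<in>space M. \<bar>elementary_process n t \<xi> (\<tau> (Suc k)) \<omega>\<bar> \<le> C" by blast
  assume s: "s \<in> {\<tau> k<..\<tau> (Suc k)}"
  have "indicator {t j<..t (Suc j)} s = (indicator {t j<..t (Suc j)} (\<tau> (Suc k)) :: real)" if "j < n" for j
    using gap[of j] gap[of "Suc j"] s that by (auto simp: indicator_def)
  then show "elementary_process n t \<xi> s = elementary_process n t \<xi> (\<tau> (Suc k))"
    unfolding elementary_process_def fun_eq_iff by (auto intro!: sum.cong)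
qed

text \<open>Each increment of \<open>W\<close> over an original step telescopes into increments over
  the cells of the finer grid.\<close>

lemma elementary_integral_refined:
  assumes el: "elementary n t \<xi>"
    and \<tau>: "t ` {..n} \<subseteq> \<tau> ` {..m}" "strict_mono_on {..m} \<tau>"
  shows "elementary_integral n t \<xi> H \<omega> =
    (\<Sum>k<m. elementary_process n t \<xi> (\<tau> (Suc k)) \<omega> * (W (\<tau> (Suc k)) \<omega> - W (\<tau> k) \<omega>))"
proof -
  have \<tau>_le: "\<tau> i \<le> \<tau> j \<longleftrightarrow> i \<le> j" if "i \<le> m" "j \<le> m" for i j
    using strict_mono_on_less_eq[OF \<tau>(2)] that by simp
  have tele: "(\<Sum>k<m. indicator {t j<..t (Suc j)} (\<tau> (Suc k)) * (W (\<tau> (Suc k)) \<omega> - W (\<tau> k) \<omega>)) =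
      W (t (Suc j)) \<omega> - W (t j) \<omega>" if j: "j < n" for j
  proof -
    obtain p q where pq: "p \<le> m" "q \<le> m" "t j = \<tau> p" "t (Suc j) = \<tau> q"
    proof -
      have "t j \<in> \<tau> ` {..m}" "t (Suc j) \<in> \<tau> ` {..m}" using \<tau>(1) j by auto
      then show ?thesis using that by blast
    qed
    have "p \<le> q" using elementary_mono[OF el, of j "Suc j"] j \<tau>_le[of p q] pq by simp
    have "indicator {t j<..t (Suc j)} (\<tau> (Suc k)) = (if k \<in> {p..<q} then 1 else 0 :: real)" if "k < m" for k
    proof -
      have "\<tau> p < \<tau> (Suc k) \<longleftrightarrow> p \<le> k" using \<tau>_le[of "Suc k" p] that pq(1) by linarith
      moreover have "\<tau> (Suc k) \<le> \<tau> q \<longleftrightarrow> k < q" using \<tau>_le[of "Suc k" q] that pq(2) by linarith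
      ultimately show ?thesis by (simp add: indicator_def pq(3,4))
    qed
    then have "(\<Sum>k<m. indicator {t j<..t (Suc j)} (\<tau> (Suc k)) * (W (\<tau> (Suc k)) \<omega> - W (\<tau> k) \<omega>)) =
        (\<Sum>k<m. if k \<in> {p..<q} then W (\<tau> (Suc k)) \<omega> - W (\<tau> k) \<omega> else 0)"
      by (intro sum.cong) auto
    also have "\<dots> = (\<Sum>k\<in>{p..<q}. W (\<tau> (Suc k)) \<omega> - W (\<tau> k) \<omega>)"
      using pq(2) by (intro sum.mono_neutral_cong_right) auto
    also have "\<dots> = W (\<tau> q) \<omega> - W (\<tau> p) \<omega>"
      using \<open>p \<le> q\<close> by (rule sum_Suc_diff')
    finally show ?thesis using pq by simp
  qed
  have "(\<Sum>k<m. elementary_process n t \<xi> (\<tau> (Suc k)) \<omega> * (W (\<tau> (Suc k)) \<omega> - W (\<tau> k) \<omega>)) =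
      (\<Sum>j<n. \<Sum>k<m. \<xi> j \<omega> * (indicator {t j<..t (Suc j)} (\<tau> (Suc k)) * (W (\<tau> (Suc k)) \<omega> - W (\<tau> k) \<omega>)))"
    unfolding elementary_process_def sum_distrib_right by (subst sum.swap) (simp add: mult.assoc)
  also have "\<dots> = (\<Sum>j<n. \<xi> j \<omega> * (W (t (Suc j)) \<omega> - W (t j) \<omega>))"
    unfolding sum_distrib_left[symmetric] using tele by (intro sum.cong) auto
  also have "\<dots> = elementary_integral n t \<xi> H \<omega>"
    unfolding elementary_integral_def
    using elementary_range[OF el] by (intro sum.cong refl) (simp add: min_absorb1)
  finally show ?thesis by simp
qed

text \<open>On a common refinement the difference is a single elementary integral. The finite sum
  \<open>q\<close> of squared coefficients times cell lengths stands for the squared distance of the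
  integrands: it is measurable in \<omega> and bounded by that distance on every path.\<close>

lemma elementary_difference_bound:
  assumes el: "elementary n t \<xi>" "elementary n' t' \<xi>'" and \<eta>: "0 < \<eta>"
  obtains q where "q \<in> borel_measurable M"
    "expectation (\<lambda>\<omega>. min \<bar>elementary_integral n t \<xi> H \<omega> - elementary_integral n' t' \<xi>' H \<omega>\<bar> 1) \<le>
      prob {\<omega>\<in>space M. q \<omega> > \<eta>\<^sup>2} + 2 * \<eta>"
    "\<And>\<omega>. ennreal (q \<omega>) \<le> (\<integral>\<^sup>+ s\<in>{0..H}. ennreal (\<bar>elementary_process n t \<xi> s \<omega> - elementary_process n' t' \<xi>' s \<omega>\<bar>\<^sup>2) \<partial>lborel)"
proof -
  define T where "T = t ` {..n} \<union> t' ` {..n'}"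
  have T: "finite T" "T \<noteq> {}" by (auto simp: T_def)
  obtain \<tau> :: "nat \<Rightarrow> real" and m where \<tau>: "\<tau> ` {..m} = T" "strict_mono_on {..m} \<tau>"
    by (fact finite_enumerate_real[OF T])
  have \<tau>_less: "\<tau> i < \<tau> j" if "i < j" "j \<le> m" for i j
    using strict_mono_onD[OF \<tau>(2)] that by simp
  have range: "\<tau> k \<in> {0..H}" if "k \<le> m" for k
  proof -
    have "\<tau> k \<in> T" using \<tau>(1) that by blast
    then show ?thesis using elementary_range[OF el(1)] elementary_range[OF el(2)] by (auto simp: T_def)
  qed
  have sub: "t ` {..n} \<subseteq> \<tau> ` {..m}" "t' ` {..n'} \<subseteq> \<tau> ` {..m}" by (auto simp: \<tau>(1) T_def)
  note r = elementary_process_refined[OF el(1) sub(1) \<tau>(2)] and r' = elementary_process_refined[OF el(2) sub(2) \<tau>(2)]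
  define \<zeta> where "\<zeta> k \<omega> = elementary_process n t \<xi> (\<tau> (Suc k)) \<omega> - elementary_process n' t' \<xi>' (\<tau> (Suc k)) \<omega>" for k \<omega>
  have \<zeta>1: "\<zeta> k \<in> borel_measurable (F (\<tau> k))" if "k < m" for k
    unfolding \<zeta>_def[abs_def] using r(1)[of k] r'(1)[of k] that by (intro borel_measurable_diff) auto
  have \<zeta>2: "\<exists>C. \<forall>\<omega>\<in>space M. \<bar>\<zeta> k \<omega>\<bar> \<le> C" if k: "k < m" for k
  proof -
    obtain C C' where C: "\<forall>\<omega>\<in>space M. \<bar>elementary_process n t \<xi> (\<tau> (Suc k)) \<omega>\<bar> \<le> C"
        "\<forall>\<omega>\<in>space M. \<bar>elementary_process n' t' \<xi>' (\<tau> (Suc k)) \<omega>\<bar> \<le> C'"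
      using r(2)[OF k] r'(2)[OF k] by blast
    have "\<forall>\<omega>\<in>space M. \<bar>\<zeta> k \<omega>\<bar> \<le> C + C'"
      unfolding \<zeta>_def using C by (auto intro!: order_trans[OF abs_triangle_ineq4] add_mono)
    then show ?thesis by blast
  qed
  define q where "q \<omega> = (\<Sum>k<m. (\<zeta> k \<omega>)\<^sup>2 * (\<tau> (Suc k) - \<tau> k))" for \<omega>
  have \<tau>_props: "0 \<le> \<tau> 0" "\<And>k. k < m \<Longrightarrow> \<tau> k \<le> \<tau> (Suc k)" "\<tau> m \<le> H"
    using range[of 0] range[of m] \<tau>_less by (auto intro: less_imp_le)
  show ?thesis
  proof (rule that[of q])
    show "q \<in> borel_measurable M"
      using elementary_isometry[OF \<tau>_props \<zeta>1 \<zeta>2] unfolding q_def[abs_def] by blast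
    have "elementary_integral n t \<xi> H \<omega> - elementary_integral n' t' \<xi>' H \<omega> =
        (\<Sum>k<m. \<zeta> k \<omega> * (W (\<tau> (Suc k)) \<omega> - W (\<tau> k) \<omega>))" for \<omega>
      unfolding \<zeta>_def elementary_integral_refined[OF el(1) sub(1) \<tau>(2)] elementary_integral_refined[OF el(2) sub(2) \<tau>(2)]
      by (simp add: left_diff_distrib sum_subtractf)
    then show "expectation (\<lambda>\<omega>. min \<bar>elementary_integral n t \<xi> H \<omega> - elementary_integral n' t' \<xi>' H \<omega>\<bar> 1) \<le>
      prob {\<omega>\<in>space M. q \<omega> > \<eta>\<^sup>2} + 2 * \<eta>"
      using elementary_integral_bound[OF \<tau>_props \<zeta>1 \<zeta>2 \<eta>] by (simp add: q_def)
    fix \<omega>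
    let ?K = "\<lambda>s. elementary_process n t \<xi> s \<omega> - elementary_process n' t' \<xi>' s \<omega>"
    have "ennreal (q \<omega>) = (\<Sum>k<m. ennreal ((\<zeta> k \<omega>)\<^sup>2 * (\<tau> (Suc k) - \<tau> k)))"
      unfolding q_def using \<tau>_props by (intro sum_ennreal[symmetric]) auto
    also have "\<dots> = (\<Sum>k<m. \<integral>\<^sup>+ s. ennreal ((\<zeta> k \<omega>)\<^sup>2) * indicator {\<tau> k<..\<tau> (Suc k)} s \<partial>lborel)"
      using \<tau>_props by (intro sum.cong refl) (simp add: nn_integral_cmult_indicator ennreal_mult)
    also have "\<dots> = (\<integral>\<^sup>+ s. (\<Sum>k<m. ennreal ((\<zeta> k \<omega>)\<^sup>2) * indicator {\<tau> k<..\<tau> (Suc k)} s) \<partial>lborel)"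
      by (intro nn_integral_sum[symmetric]) auto
    also have "\<dots> \<le> (\<integral>\<^sup>+ s\<in>{0..H}. ennreal (\<bar>?K s\<bar>\<^sup>2) \<partial>lborel)"
    proof (intro nn_integral_mono)
      fix s
      show "(\<Sum>k<m. ennreal ((\<zeta> k \<omega>)\<^sup>2) * indicator {\<tau> k<..\<tau> (Suc k)} s) \<le>
        ennreal (\<bar>?K s\<bar>\<^sup>2) * indicator {0..H} s"
      proof (cases "\<exists>k<m. s \<in> {\<tau> k<..\<tau> (Suc k)}")
        case True
        then obtain k where k: "k < m" "s \<in> {\<tau> k<..\<tau> (Suc k)}" by blast
        \<comment> \<open>The cells are disjoint, so only the one containing \<open>s\<close>
          contributes.\<close>
        have "s \<notin> {\<tau> j<..\<tau> (Suc j)}" if "j < m" "j \<noteq> k" for j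
        proof (cases "j < k")
          case True
          then have "\<tau> (Suc j) \<le> \<tau> k" using \<tau>_less[of "Suc j" k] k by (cases "Suc j = k") auto
          then show ?thesis using k by auto
        next
          case False
          then have "\<tau> (Suc k) \<le> \<tau> j" using \<tau>_less[of "Suc k" j] that by (cases "Suc k = j") auto
          then show ?thesis using k by auto
        qed
        then have "(\<Sum>k<m. ennreal ((\<zeta> k \<omega>)\<^sup>2) * indicator {\<tau> k<..\<tau> (Suc k)} s) =
            (\<Sum>j<m. if j = k then ennreal ((\<zeta> k \<omega>)\<^sup>2) else 0)"
          using k by (intro sum.cong) (auto simp: indicator_def)
        also have "\<dots> = ennreal ((\<zeta> k \<omega>)\<^sup>2)" using k by simp
        also have "\<zeta> k \<omega> = ?K s" unfolding \<zeta>_def using r(3)[OF k] r'(3)[OF k] by simp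
        also have "s \<in> {0..H}" using k range[of k] range[of "Suc k"] by auto
        ultimately show ?thesis by simp
      next
        case False
        then have "(\<Sum>k<m. ennreal ((\<zeta> k \<omega>)\<^sup>2) * indicator {\<tau> k<..\<tau> (Suc k)} s) = 0"
          by (intro sum.neutral) (auto simp: indicator_def)
        then show ?thesis by simp
      qed
    qed
    finally show "ennreal (q \<omega>) \<le> (\<integral>\<^sup>+ s\<in>{0..H}. ennreal (\<bar>?K s\<bar>\<^sup>2) \<partial>lborel)" .
  qed
qed

end

section \<open>Uniqueness and continuity of the integral processes\<close>

section \<open>Wiener integrals and compensators\<close>

context levy_noise
begin

lemma space_Pred: "space Pred = space M \<times> {0..H}"
  unfolding Pred_def predictable_sigma_def predictable_rectangles_def[symmetric]
  by (rule space_measure_of[OF predictable_rectangles_subset])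

lemma time_section_measurable:
  assumes "(\<lambda>(\<omega>, s). h s \<omega>) \<in> borel_measurable Pred" "\<omega> \<in> space M"
  shows "(\<lambda>s. h s \<omega>) \<in> borel_measurable (restrict_space lborel {0..H})"
proof -
  have "(\<lambda>(\<omega>, s). h s \<omega>) \<in> borel_measurable prod_time"
    using assms(1) sets_Pred_subset by (auto simp: measurable_def space_pair_measure space_restrict_space space_Pred)
  from measurable_compose[OF measurable_Pair1'[OF assms(2)] this] show ?thesis by simp
qed

lemma elementary_process_borel [measurable]: "(\<lambda>s. elementary_process n t \<xi> s \<omega>) \<in> borel_measurable borel"
  unfolding elementary_process_def by measurable

lemma elementary_integral_measurable:
  assumes "elementary n t \<xi>"
  shows "elementary_integral n t \<xi> H \<in> borel_measurable M"
  unfolding elementary_integral_def[abs_def]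
proof (intro borel_measurable_sum borel_measurable_times borel_measurable_diff)
  fix k assume k: "k \<in> {..<n}"
  then show "\<xi> k \<in> borel_measurable M"
    using assms unfolding elementary_def by (auto intro: measurable_F_M)
  have *: "W u \<in> borel_measurable M" if "u \<in> {0..H}" for u
    using W_measurable_F[OF that order_refl] by (rule measurable_F_M)
  show "W (min (t (Suc k)) H) \<in> borel_measurable M" "W (min (t k) H) \<in> borel_measurable M"
    using elementary_range[OF assms, of k] elementary_range[OF assms, of "Suc k"] k by (auto intro!: *)
qed

text \<open>From \<open>2 a^2 + 2 b^2 - (a - b)^2 = (a + b)^2\<close> with \<open>a = f - h\<close>
  and \<open>b = g - h\<close>.\<close>

lemma nn_integral_square_triangle:
  assumes [measurable]: "f \<in> borel_measurable L" "g \<in> borel_measurable L" "h \<in> borel_measurable L"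
  shows "(\<integral>\<^sup>+ s. ennreal (\<bar>f s - g s\<bar>\<^sup>2) \<partial>L) \<le>
    2 * (\<integral>\<^sup>+ s. ennreal (\<bar>f s - h s\<bar>\<^sup>2) \<partial>L) + 2 * (\<integral>\<^sup>+ s. ennreal (\<bar>g s - h s\<bar>\<^sup>2) \<partial>L)"
proof -
  have "ennreal (\<bar>f s - g s\<bar>\<^sup>2) \<le> 2 * ennreal (\<bar>f s - h s\<bar>\<^sup>2) + 2 * ennreal (\<bar>g s - h s\<bar>\<^sup>2)" for s
  proof -
    have "\<bar>f s - g s\<bar>\<^sup>2 \<le> 2 * \<bar>f s - h s\<bar>\<^sup>2 + 2 * \<bar>g s - h s\<bar>\<^sup>2"
      using zero_le_power2[of "(f s - h s) + (g s - h s)"] by (simp add: power2_eq_square algebra_simps)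
    then have "ennreal (\<bar>f s - g s\<bar>\<^sup>2) \<le> ennreal (2 * \<bar>f s - h s\<bar>\<^sup>2 + 2 * \<bar>g s - h s\<bar>\<^sup>2)"
      by (rule ennreal_leI)
    also have "\<dots> = ennreal 2 * ennreal (\<bar>f s - h s\<bar>\<^sup>2) + ennreal 2 * ennreal (\<bar>g s - h s\<bar>\<^sup>2)"
      by (simp only: ennreal_plus ennreal_mult zero_le_power2 mult_nonneg_nonneg zero_le_numeral)
    finally show ?thesis by simp
  qed
  then have "(\<integral>\<^sup>+ s. ennreal (\<bar>f s - g s\<bar>\<^sup>2) \<partial>L) \<le>
      (\<integral>\<^sup>+ s. 2 * ennreal (\<bar>f s - h s\<bar>\<^sup>2) + 2 * ennreal (\<bar>g s - h s\<bar>\<^sup>2) \<partial>L)"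
    by (intro nn_integral_mono)
  also have "\<dots> = 2 * (\<integral>\<^sup>+ s. ennreal (\<bar>f s - h s\<bar>\<^sup>2) \<partial>L) + 2 * (\<integral>\<^sup>+ s. ennreal (\<bar>g s - h s\<bar>\<^sup>2) \<partial>L)"
    by (subst nn_integral_add) (auto simp: nn_integral_cmult)
  finally show ?thesis .
qed

text \<open>Two approximating sequences approach the same integrand, so the squared distance between
  them tends to 0 on almost every path, and with it the probability that the distance exceeds
  \<open>\<eta>^2\<close>. The bound in probability forces the elementary integrals at the horizon
  to share their limit. Agreement at \<open>H\<close> is what the comparison of two gains processes
  asks for.\<close>

lemma wiener_integral_unique:
  assumes I: "wiener_integral \<phi> I" and I': "wiener_integral \<phi> I'"
  shows "AE \<omega> in M. I H \<omega> = I' H \<omega>"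
proof -
  let ?R = "restrict_space lborel {0..H}"
  have set_R: "(\<integral>\<^sup>+ s\<in>{0..H}. f s \<partial>lborel) = (\<integral>\<^sup>+ s. f s \<partial>?R)" for f
    by (rule nn_integral_restrict_space[symmetric]) simp
  obtain n t \<xi> where el: "\<And>m. elementary (n m) (t m) (\<xi> m)"
    and conv: "AE \<omega> in M. (\<lambda>m. \<integral>\<^sup>+ s. ennreal (\<bar>elementary_process (n m) (t m) (\<xi> m) s \<omega> - \<phi> s \<omega>\<bar>\<^sup>2) \<partial>?R) \<longlonglongrightarrow> 0"
    and lim: "AE \<omega> in M. uniform_limit {0..H} (\<lambda>m u. elementary_integral (n m) (t m) (\<xi> m) u \<omega>) (\<lambda>u. I u \<omega>) sequentially"
    using I unfolding wiener_integral_def set_R by blast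
  obtain n' t' \<xi>' where el': "\<And>m. elementary (n' m) (t' m) (\<xi>' m)"
    and conv': "AE \<omega> in M. (\<lambda>m. \<integral>\<^sup>+ s. ennreal (\<bar>elementary_process (n' m) (t' m) (\<xi>' m) s \<omega> - \<phi> s \<omega>\<bar>\<^sup>2) \<partial>?R) \<longlonglongrightarrow> 0"
    and lim': "AE \<omega> in M. uniform_limit {0..H} (\<lambda>m u. elementary_integral (n' m) (t' m) (\<xi>' m) u \<omega>) (\<lambda>u. I' u \<omega>) sequentially"
    using I' unfolding wiener_integral_def set_R by blast
  obtain \<phi>' where \<phi>': "(\<lambda>(\<omega>, s). \<phi>' s \<omega>) \<in> borel_measurable Pred"
      "AE \<omega> in M. \<forall>s\<in>{0..H}. \<phi> s \<omega> = \<phi>' s \<omega>"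
    using I unfolding wiener_integral_def Phi_def by blast
  define D where "D m \<omega> = elementary_integral (n m) (t m) (\<xi> m) H \<omega> - elementary_integral (n' m) (t' m) (\<xi>' m) H \<omega>" for m \<omega>
  \<comment> \<open>\<open>I\<close> and \<open>I'\<close> come without measurability in \<omega>;
    \<open>J\<close> is a measurable function that equals their difference at \<open>H\<close>
    almost everywhere.\<close>
  define J where "J \<omega> = lim (\<lambda>m. D m \<omega>)" for \<omega>
  have D_meas [measurable]: "D m \<in> borel_measurable M" for m
    unfolding D_def[abs_def] using el el' by (intro borel_measurable_diff elementary_integral_measurable)
  have J_meas [measurable]: "J \<in> borel_measurable M"
    unfolding J_def[abs_def] by measurable
  have D_lim: "AE \<omega> in M. (\<lambda>m. D m \<omega>) \<longlonglongrightarrow> I H \<omega> - I' H \<omega>"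
    using lim lim'
  proof eventually_elim
    case (elim \<omega>)
    have H: "H \<in> {0..H}" using horizon by simp
    show ?case
      unfolding D_def
      by (rule tendsto_diff[OF tendsto_uniform_limitI[OF elim(1) H] tendsto_uniform_limitI[OF elim(2) H]])
  qed
  have J_eq: "AE \<omega> in M. J \<omega> = I H \<omega> - I' H \<omega>"
    using D_lim by eventually_elim (simp add: J_def limI)
  have le: "expectation (\<lambda>\<omega>. min \<bar>J \<omega>\<bar> 1) \<le> 0 + 2 * \<eta>" if \<eta>: "\<eta> > 0" for \<eta> :: real
  proof -
    have "\<exists>q. \<forall>m. q m \<in> borel_measurable M \<and>
      expectation (\<lambda>\<omega>. min \<bar>D m \<omega>\<bar> 1) \<le> prob {\<omega>\<in>space M. q m \<omega> > \<eta>\<^sup>2} + 2 * \<eta> \<and>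
      (\<forall>\<omega>. ennreal (q m \<omega>) \<le> (\<integral>\<^sup>+ s. ennreal (\<bar>elementary_process (n m) (t m) (\<xi> m) s \<omega> -
          elementary_process (n' m) (t' m) (\<xi>' m) s \<omega>\<bar>\<^sup>2) \<partial>?R))"
    proof (intro choice allI)
      fix m
      show "\<exists>q. q \<in> borel_measurable M \<and>
        expectation (\<lambda>\<omega>. min \<bar>D m \<omega>\<bar> 1) \<le> prob {\<omega>\<in>space M. q \<omega> > \<eta>\<^sup>2} + 2 * \<eta> \<and>
        (\<forall>\<omega>. ennreal (q \<omega>) \<le> (\<integral>\<^sup>+ s. ennreal (\<bar>elementary_process (n m) (t m) (\<xi> m) s \<omega> -
          elementary_process (n' m) (t' m) (\<xi>' m) s \<omega>\<bar>\<^sup>2) \<partial>?R))"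
        by (rule elementary_difference_bound[OF el[of m] el'[of m] \<eta>, unfolded set_R])
           (auto simp: D_def)
    qed
    then obtain q where q: "\<And>m. q m \<in> borel_measurable M"
      "\<And>m. expectation (\<lambda>\<omega>. min \<bar>D m \<omega>\<bar> 1) \<le> prob {\<omega>\<in>space M. q m \<omega> > \<eta>\<^sup>2} + 2 * \<eta>"
      "\<And>m \<omega>. ennreal (q m \<omega>) \<le> (\<integral>\<^sup>+ s. ennreal (\<bar>elementary_process (n m) (t m) (\<xi> m) s \<omega> -
          elementary_process (n' m) (t' m) (\<xi>' m) s \<omega>\<bar>\<^sup>2) \<partial>?R)"
      by blast
    note q(1)[measurable]
    have "AE \<omega> in M. (\<lambda>m. indicator {\<omega>\<in>space M. q m \<omega> > \<eta>\<^sup>2} \<omega> :: real) \<longlonglongrightarrow> 0"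
      using conv conv' \<phi>'(2) AE_space
    proof eventually_elim
      case (elim \<omega>)
      \<comment> \<open>\<phi> is predictable only up to indistinguishability, so measurability in
        time is taken from \<open>\<phi>'\<close>.\<close>
      have [measurable]: "(\<lambda>s. \<phi>' s \<omega>) \<in> borel_measurable ?R"
        by (rule time_section_measurable[OF \<phi>'(1) elim(4)])
      have eq: "(\<integral>\<^sup>+ s. ennreal (\<bar>k s - \<phi> s \<omega>\<bar>\<^sup>2) \<partial>?R) = (\<integral>\<^sup>+ s. ennreal (\<bar>k s - \<phi>' s \<omega>\<bar>\<^sup>2) \<partial>?R)" for k
        using elim(3) by (intro nn_integral_cong) (auto simp: space_restrict_space)
      have tri: "ennreal (q m \<omega>) \<le>
          2 * (\<integral>\<^sup>+ s. ennreal (\<bar>elementary_process (n m) (t m) (\<xi> m) s \<omega> - \<phi> s \<omega>\<bar>\<^sup>2) \<partial>?R) +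
          2 * (\<integral>\<^sup>+ s. ennreal (\<bar>elementary_process (n' m) (t' m) (\<xi>' m) s \<omega> - \<phi> s \<omega>\<bar>\<^sup>2) \<partial>?R)" for m
        unfolding eq
        by (rule order_trans[OF q(3) nn_integral_square_triangle])
           (auto intro!: measurable_restrict_space1)
      \<comment> \<open>Two integrals below \<open>c\<close>, each entering with factor 2, add up to
        at most \<open>\<eta>^2\<close>.\<close>
      define c where "c = ennreal (\<eta>\<^sup>2 / 4)"
      have c: "0 < c" using \<eta> by (simp add: c_def)
      have "\<forall>\<^sub>F m in sequentially. indicator {\<omega>\<in>space M. q m \<omega> > \<eta>\<^sup>2} \<omega> = (0 :: real)"
        using order_tendstoD(2)[OF elim(1) c] order_tendstoD(2)[OF elim(2) c]
      proof eventually_elim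
        case (elim m)
        have "ennreal (q m \<omega>) \<le> 2 * c + 2 * c"
          by (rule order_trans[OF tri]) (use elim in \<open>auto intro!: add_mono mult_left_mono\<close>)
        also have "\<dots> = ennreal (\<eta>\<^sup>2)"
          by (simp add: c_def numeral_mult_ennreal ennreal_plus[symmetric] del: ennreal_plus)
        finally have "q m \<omega> \<le> \<eta>\<^sup>2" by (simp add: ennreal_le_iff)
        then show ?case by (simp add: indicator_def)
      qed
      then show ?case by (rule tendsto_eventually)
    qed
    then have "(\<lambda>m. expectation (indicator {\<omega>\<in>space M. q m \<omega> > \<eta>\<^sup>2})) \<longlonglongrightarrow> expectation (\<lambda>_. 0 :: real)"
      by (intro integral_dominated_convergence[where w = "\<lambda>_. 1"]) (auto simp: indicator_def)
    then have p0: "(\<lambda>m. prob {\<omega>\<in>space M. q m \<omega> > \<eta>\<^sup>2} + 2 * \<eta>) \<longlonglongrightarrow> 0 + 2 * \<eta>"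
      by (intro tendsto_add) auto
    have "(\<lambda>m. expectation (\<lambda>\<omega>. min \<bar>D m \<omega>\<bar> 1)) \<longlonglongrightarrow> expectation (\<lambda>\<omega>. min \<bar>J \<omega>\<bar> 1)"
    proof (intro integral_dominated_convergence[where w = "\<lambda>_. 1"])
      show "AE \<omega> in M. (\<lambda>m. min \<bar>D m \<omega>\<bar> 1) \<longlonglongrightarrow> min \<bar>J \<omega>\<bar> 1"
        using D_lim J_eq by eventually_elim (auto intro!: tendsto_intros)
    qed auto
    then show ?thesis
      by (rule LIMSEQ_le[OF _ p0]) (use q(2) in auto)
  qed
  have "expectation (\<lambda>\<omega>. min \<bar>J \<omega>\<bar> 1) \<le> 0 + e" if "e > 0" for e
    using le[of "e / 2"] that by simp
  then have "expectation (\<lambda>\<omega>. min \<bar>J \<omega>\<bar> 1) \<le> 0"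
    by (rule field_le_epsilon)
  moreover have nn: "0 \<le> expectation (\<lambda>\<omega>. min \<bar>J \<omega>\<bar> 1)"
    by (intro integral_nonneg_AE) auto
  ultimately have "expectation (\<lambda>\<omega>. min \<bar>J \<omega>\<bar> 1) = 0" by simp
  moreover have "integrable M (\<lambda>\<omega>. min \<bar>J \<omega>\<bar> 1)"
    by (intro integrable_const_bound[of _ 1]) auto
  ultimately have "AE \<omega> in M. min \<bar>J \<omega>\<bar> 1 = 0"
    by (subst (asm) integral_nonneg_eq_0_iff_AE) auto
  then show ?thesis
    using J_eq by eventually_elim (auto simp: min_def split: if_splits)
qed

text \<open>Elementary integrals inherit continuity from \<open>W\<close>, and the convergence in
  the definition is uniform on \<open>[0, H]\<close>.\<close>

lemma wiener_integral_continuous: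
  assumes I: "wiener_integral \<phi> I"
  shows "AE \<omega> in M. continuous_on {0..H} (\<lambda>u. I u \<omega>)"
proof -
  obtain n t \<xi> where el: "\<And>m. elementary (n m) (t m) (\<xi> m)"
    and lim: "AE \<omega> in M. uniform_limit {0..H} (\<lambda>m u. elementary_integral (n m) (t m) (\<xi> m) u \<omega>) (\<lambda>u. I u \<omega>) sequentially"
    using I unfolding wiener_integral_def by blast
  have "AE \<omega> in M. continuous_on {0..H} (\<lambda>t. W t \<omega>)"
    using wiener unfolding wiener_process_def by auto
  with lim show ?thesis
  proof eventually_elim
    case (elim \<omega>)
    have cont: "continuous_on {0..H} (\<lambda>u. W (min c u) \<omega>)" if "c \<in> {0..H}" for c
      by (rule continuous_on_compose2[OF elim(2)]) (use that in \<open>auto intro!: continuous_intros\<close>)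
    have "continuous_on {0..H} (\<lambda>u. elementary_integral (n m) (t m) (\<xi> m) u \<omega>)" for m
      unfolding elementary_integral_def
    proof (intro continuous_on_sum continuous_on_mult continuous_on_diff continuous_on_const cont)
      fix k assume "k \<in> {..<n m}"
      then show "t m (Suc k) \<in> {0..H}" "t m k \<in> {0..H}"
        using elementary_range[OF el[of m], of k] elementary_range[OF el[of m], of "Suc k"] by auto
    qed
    then show ?case
      using elim(1) by (intro uniform_limit_theorem[where F = sequentially]) auto
  qed
qed

text \<open>Since \<nu> is finite and \<open>r \<le> 1 + min (r^2) r\<close>, membership in
  \<open>Psi12\<close> makes the inner integral integrable in time, and an indefinite integral is
  continuous.\<close>

lemma compensator_continuous:
  assumes "\<psi> \<in> Psi12"
  shows "AE \<omega> in M. continuous_on {0..H} (\<lambda>t. LINT s:{0..t}|lborel. (LINT x|\<nu>. \<psi> s x \<omega>))"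
proof -
  let ?R = "restrict_space lborel {0..H}"
  interpret \<nu>: finite_measure \<nu> by (rule levy_measure_finite)
  interpret R: finite_measure ?R by (rule finite_measure_time)
  obtain \<psi>' where \<psi>': "(\<lambda>((\<omega>, s), x). \<psi>' s x \<omega>) \<in> borel_measurable (Pred \<Otimes>\<^sub>M borel)"
      "AE \<omega> in M. \<forall>s\<in>{0..H}. \<forall>x. \<psi> s x \<omega> = \<psi>' s x \<omega>"
    and fin: "AE \<omega> in M. (\<integral>\<^sup>+ s\<in>{0..H}. (\<integral>\<^sup>+ x. ennreal (min (\<bar>\<psi> s x \<omega>\<bar>\<^sup>2) \<bar>\<psi> s x \<omega>\<bar>) \<partial>\<nu>) \<partial>lborel) < \<infinity>"
    using assms unfolding Psi12_def by blast
  show ?thesis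
    using \<psi>'(2) fin AE_space
  proof eventually_elim
    case (elim \<omega>)
    have "(\<lambda>z. ((\<omega>, fst z), snd z)) \<in> measurable (?R \<Otimes>\<^sub>M \<nu>) (Pred \<Otimes>\<^sub>M borel)"
    proof (intro measurable_Pair)
      have id: "(\<lambda>x. x) \<in> measurable \<nu> borel" using levy_measure_sets by (simp add: measurable_ident_sets)
      show "snd \<in> measurable (?R \<Otimes>\<^sub>M \<nu>) borel"
        by (rule measurable_compose[OF measurable_snd id])
      have "(\<lambda>s. (\<omega>, s)) \<in> measurable ?R Pred"
      proof -
        have "(\<lambda>s. (\<omega>, s)) \<in> measurable ?R prod_time" using elim(3) by (rule measurable_Pair1')
        then show ?thesis
          using sets_Pred_subset by (auto simp: measurable_def space_pair_measure space_restrict_space space_Pred)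
      qed
      then show "(\<lambda>z. (\<omega>, fst z)) \<in> measurable (?R \<Otimes>\<^sub>M \<nu>) Pred"
        by (rule measurable_compose[OF measurable_fst])
    qed
    from measurable_compose[OF this \<psi>'(1)]
    have m: "(\<lambda>(s, x). \<psi>' s x \<omega>) \<in> borel_measurable (?R \<Otimes>\<^sub>M \<nu>)"
      by (simp add: split_beta')
    have h_meas: "(\<lambda>s. LINT x|\<nu>. \<psi>' s x \<omega>) \<in> borel_measurable ?R"
      using \<nu>.borel_measurable_lebesgue_integral[of "\<lambda>s x. \<psi>' s x \<omega>" ?R] m by simp
    have min_meas: "(\<lambda>(s, x). ennreal (min (\<bar>\<psi>' s x \<omega>\<bar>\<^sup>2) \<bar>\<psi>' s x \<omega>\<bar>)) \<in> borel_measurable (?R \<Otimes>\<^sub>M \<nu>)"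
      using m by (simp add: split_beta')
    have x_meas: "(\<lambda>x. \<psi>' s x \<omega>) \<in> borel_measurable \<nu>" if "s \<in> space ?R" for s
      using measurable_compose[OF measurable_Pair1'[OF that] m] by simp
    have bound: "ennreal \<bar>LINT x|\<nu>. \<psi>' s x \<omega>\<bar> \<le>
        emeasure \<nu> (space \<nu>) + (\<integral>\<^sup>+ x. ennreal (min (\<bar>\<psi>' s x \<omega>\<bar>\<^sup>2) \<bar>\<psi>' s x \<omega>\<bar>) \<partial>\<nu>)" if s: "s \<in> space ?R" for s
    \<comment> \<open>Where the section is not integrable, its Bochner integral is 0 and the bound
      is trivial.\<close>
    proof (cases "integrable \<nu> (\<lambda>x. \<psi>' s x \<omega>)")
      case True
      have "ennreal \<bar>LINT x|\<nu>. \<psi>' s x \<omega>\<bar> \<le> (\<integral>\<^sup>+ x. ennreal \<bar>\<psi>' s x \<omega>\<bar> \<partial>\<nu>)"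
        using integral_norm_bound_ennreal[OF True] by simp
      also have "\<dots> \<le> (\<integral>\<^sup>+ x. 1 + ennreal (min (\<bar>\<psi>' s x \<omega>\<bar>\<^sup>2) \<bar>\<psi>' s x \<omega>\<bar>) \<partial>\<nu>)"
      proof (intro nn_integral_mono)
        fix x
        define r where "r = \<bar>\<psi>' s x \<omega>\<bar>"
        have r0: "0 \<le> r" by (simp add: r_def)
        have "r \<le> 1 + min (r\<^sup>2) r"
        proof (cases "r \<le> 1")
          case True
          moreover have "0 \<le> min (r\<^sup>2) r" using r0 by simp
          ultimately show ?thesis by linarith
        next
          case False
          then have "r * 1 \<le> r * r" by (intro mult_left_mono) auto
          then show ?thesis by (simp add: power2_eq_square min_def)
        qed
        then have "ennreal r \<le> ennreal (1 + min (r\<^sup>2) r)" by (rule ennreal_leI)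
        also have "\<dots> = 1 + ennreal (min (r\<^sup>2) r)" using r0 by (subst ennreal_plus) auto
        finally show "ennreal \<bar>\<psi>' s x \<omega>\<bar> \<le> 1 + ennreal (min (\<bar>\<psi>' s x \<omega>\<bar>\<^sup>2) \<bar>\<psi>' s x \<omega>\<bar>)"
          by (simp add: r_def)
      qed
      also have "\<dots> = emeasure \<nu> (space \<nu>) + (\<integral>\<^sup>+ x. ennreal (min (\<bar>\<psi>' s x \<omega>\<bar>\<^sup>2) \<bar>\<psi>' s x \<omega>\<bar>) \<partial>\<nu>)"
        using x_meas[OF s] by (subst nn_integral_add) auto
      finally show ?thesis .
    qed (simp add: not_integrable_integral_eq)
    have "(\<integral>\<^sup>+ s. ennreal \<bar>LINT x|\<nu>. \<psi>' s x \<omega>\<bar> \<partial>?R) \<le>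
        (\<integral>\<^sup>+ s. emeasure \<nu> (space \<nu>) + (\<integral>\<^sup>+ x. ennreal (min (\<bar>\<psi>' s x \<omega>\<bar>\<^sup>2) \<bar>\<psi>' s x \<omega>\<bar>) \<partial>\<nu>) \<partial>?R)"
      by (intro nn_integral_mono bound)
    also have "\<dots> = emeasure \<nu> (space \<nu>) * emeasure ?R (space ?R) +
        (\<integral>\<^sup>+ s. (\<integral>\<^sup>+ x. ennreal (min (\<bar>\<psi>' s x \<omega>\<bar>\<^sup>2) \<bar>\<psi>' s x \<omega>\<bar>) \<partial>\<nu>) \<partial>?R)"
      using \<nu>.borel_measurable_nn_integral[OF min_meas] by (subst nn_integral_add) auto
    also have "(\<integral>\<^sup>+ s. (\<integral>\<^sup>+ x. ennreal (min (\<bar>\<psi>' s x \<omega>\<bar>\<^sup>2) \<bar>\<psi>' s x \<omega>\<bar>) \<partial>\<nu>) \<partial>?R) =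
        (\<integral>\<^sup>+ s\<in>{0..H}. (\<integral>\<^sup>+ x. ennreal (min (\<bar>\<psi> s x \<omega>\<bar>\<^sup>2) \<bar>\<psi> s x \<omega>\<bar>) \<partial>\<nu>) \<partial>lborel)"
      using elim(1) by (subst nn_integral_restrict_space) (auto intro!: nn_integral_cong simp: indicator_def)
    also have "emeasure \<nu> (space \<nu>) * emeasure ?R (space ?R) + \<dots> < \<infinity>"
    proof -
      have "emeasure \<nu> (space \<nu>) < \<top>" "emeasure ?R (space ?R) < \<top>"
        using \<nu>.emeasure_finite R.emeasure_finite unfolding less_top by blast+
      then show ?thesis
        using elim(2) unfolding infinity_ennreal_def ennreal_add_less_top ennreal_mult_less_top by blast
    qed
    finally have "integrable ?R (\<lambda>s. LINT x|\<nu>. \<psi>' s x \<omega>)"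
      using h_meas by (intro integrableI_bounded) auto
    then have "set_integrable lborel {0..H} (\<lambda>s. LINT x|\<nu>. \<psi>' s x \<omega>)"
      by (simp add: set_integrable_def integrable_restrict_space)
    moreover have "(\<lambda>s. LINT x|\<nu>. \<psi>' s x \<omega>) s = (\<lambda>s. LINT x|\<nu>. \<psi> s x \<omega>) s" if "s \<in> {0..H}" for s
      using elim(1) that by simp
    ultimately have si: "set_integrable lborel {0..H} (\<lambda>s. LINT x|\<nu>. \<psi> s x \<omega>)"
      by (subst set_integrable_cong[OF refl]) auto
    have eq: "(LINT s:{0..t}|lborel. (LINT x|\<nu>. \<psi> s x \<omega>)) = integral {0..t} (\<lambda>s. LINT x|\<nu>. \<psi> s x \<omega>)" if "t \<in> {0..H}" for t
      by (rule set_borel_integral_eq_integral(2)[OF set_integrable_subset[OF si]]) (use that in auto)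
    have "continuous_on {0..H} (\<lambda>t. integral {0..t} (\<lambda>s. LINT x|\<nu>. \<psi> s x \<omega>))"
      by (rule indefinite_integral_continuous_1[OF set_borel_integral_eq_integral(1)[OF si]])
    then show ?case
      using eq by (subst continuous_on_cong[OF refl]) auto
  qed
qed

end

section \<open>The claim that cannot be replicated, and its conditional expectations\<close>

section \<open>A square integrable sum of jumps and its martingale\<close>

text \<open>The jump sizes \<open>y k\<close> get weight \<open>k\<close>; their intensities decay so fast that the weighted sum
  of the jumps is square integrable.\<close>
locale sparse_jump_sizes = levy_noise M H Z \<nu> W a b
  for M :: "'a measure" and H Z \<nu> W a b +
  fixes y :: "nat \<Rightarrow> real"
  assumes inj_y: "inj y"
    and y_nonzero: "\<And>k. y k \<noteq> 0"
    and intensity_pos: "\<And>k. 0 < measure \<nu> {y k}"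
    and intensity_small: "\<And>k. H * measure \<nu> {y k} + (H * measure \<nu> {y k})\<^sup>2 \<le> 1 / (8 ^ k * (real k + 1)\<^sup>2)"
    and support_gap: "\<exists>d>0. \<forall>z\<in>measure_support \<nu>. d \<le> \<bar>z\<bar>"
begin

text \<open>What the claim pays per jump, as a function of the jump size; it is the value that the
  jump integrand of a replicating strategy will be forced to take.\<close>

definition weight :: "real \<Rightarrow> real" where
  "weight z = (if z \<in> range y then real (inv y z) else 0)"

lemma weight_y [simp]: "weight (y k) = real k"
  by (simp add: weight_def inv_f_f[OF inj_y])

definition jump_times :: "'a \<Rightarrow> real set" where
  "jump_times \<omega> = {u\<in>{0<..H}. jump u \<omega> \<noteq> 0}"

text \<open>Almost surely all jump sizes lie in the support, which keeps a distance from 0, so every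
  jump is a large one.\<close>

lemma AE_finite_jump_times: "AE \<omega> in M. finite (jump_times \<omega>)"
proof -
  obtain d where d: "d > 0" "\<And>z. z \<in> measure_support \<nu> \<Longrightarrow> d \<le> \<bar>z\<bar>"
    using support_gap by blast
  show ?thesis
    using AE_jumps_in_support AE_space
  proof eventually_elim
    case (elim \<omega>)
    have "jump_times \<omega> \<subseteq> {u\<in>{0..H}. d \<le> \<bar>jump u \<omega>\<bar>}"
      using elim(1) d(2) by (auto simp: jump_times_def)
    then show ?case
      using finite_jumps[OF elim(2) d(1)] finite_subset by blast
  qed
qed

text \<open>A series over jump sizes, not a sum over jump times: measurability and expectations
  follow term by term from the counts. It converges wherever the path has finitely many jumps, that
  is, almost surely.\<close>

definition jump_sum :: "real \<Rightarrow> real \<Rightarrow> 'a \<Rightarrow> real" where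
  "jump_sum s t \<omega> = (\<Sum>k. real k * jump_count (y k) s t \<omega>)"

text \<open>A finite sum over jump times is interchanged with a series over sizes; by injectivity of
  \<open>y\<close> each jump time contributes to at most one \<open>k\<close>.\<close>

lemma jump_sum_sums:
  assumes fin: "finite (jump_times \<omega>)" and st: "0 \<le> s" "t \<le> H"
  shows "(\<lambda>k. real k * jump_count (y k) s t \<omega>) sums
    (\<Sum>u | u \<in> jump_times \<omega> \<and> s < u \<and> u \<le> t. weight (jump u \<omega>))"
proof -
  define J where "J = {u. u \<in> jump_times \<omega> \<and> s < u \<and> u \<le> t}"
  have J: "finite J" using fin by (simp add: J_def)
  have "(\<lambda>k. if jump u \<omega> = y k then real k else 0) sums weight (jump u \<omega>)" for u
  proof (cases "jump u \<omega> \<in> range y")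
    case True
    then obtain k0 where k0: "jump u \<omega> = y k0" by blast
    then have "(\<lambda>k. if jump u \<omega> = y k then real k else 0) = (\<lambda>k. if k = k0 then real k else 0)"
      using inj_eq[OF inj_y] by auto
    then show ?thesis
      using sums_single[of k0 "\<lambda>k. real k"] k0 by simp
  next
    case False
    then have "jump u \<omega> \<noteq> y k" for k by auto
    then show ?thesis using False by (simp add: weight_def)
  qed
  then have "(\<lambda>k. \<Sum>u\<in>J. if jump u \<omega> = y k then real k else 0) sums (\<Sum>u\<in>J. weight (jump u \<omega>))"
    by (intro sums_sum)
  moreover have "(\<Sum>u\<in>J. if jump u \<omega> = y k then real k else 0) = real k * jump_count (y k) s t \<omega>" for k
  proof -
    have "{u\<in>{s<..t}. jump u \<omega> = y k} = J \<inter> {u. jump u \<omega> = y k}"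
      using st y_nonzero[of k] by (auto simp: J_def jump_times_def)
    then show ?thesis
      using J by (simp add: sum.If_cases jump_count_def)
  qed
  ultimately show ?thesis by (simp add: J_def)
qed

lemma jump_sum_eq:
  assumes "finite (jump_times \<omega>)" "0 \<le> s" "t \<le> H"
  shows "jump_sum s t \<omega> = (\<Sum>u | u \<in> jump_times \<omega> \<and> s < u \<and> u \<le> t. weight (jump u \<omega>))"
  unfolding jump_sum_def using sums_unique[OF jump_sum_sums[OF assms]] by simp

lemma jump_sum_nonneg:
  assumes "finite (jump_times \<omega>)" "0 \<le> s" "t \<le> H"
  shows "0 \<le> jump_sum s t \<omega>"
  unfolding jump_sum_eq[OF assms] by (intro sum_nonneg) (simp add: weight_def)

lemma jump_sum_measurable_F:
  assumes "0 \<le> s" "s \<le> t" "t \<le> H" "t \<le> r"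
  shows "jump_sum s t \<in> borel_measurable (F r)"
  unfolding jump_sum_def[abs_def]
  using jump_count_F[OF assms(1-3) y_nonzero assms(4)] by measurable

lemma jump_sum_measurable:
  assumes "0 \<le> s" "s \<le> t" "t \<le> H"
  shows "jump_sum s t \<in> borel_measurable M"
  using jump_sum_measurable_F[OF assms order_refl] by (rule measurable_F_M)

text \<open>The mean rate at which weighted jumps accumulate, hence the slope of their
  compensator.\<close>

definition drift :: real where
  "drift = (\<Sum>k. real k * measure \<nu> {y k})"

lemma summable_drift: "summable (\<lambda>k. real k * measure \<nu> {y k})"
proof (rule summable_comparison_test')
  show "summable (\<lambda>k. (1 / 2) ^ k / H)"
    by (intro summable_divide summable_geometric) simp
  fix k :: nat
  have "H * measure \<nu> {y k} \<le> 1 / (8 ^ k * (real k + 1)\<^sup>2)"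
    using intensity_small[of k] by (smt (verit) zero_le_power2)
  then have "real k * (H * measure \<nu> {y k}) \<le> real k * (1 / (8 ^ k * (real k + 1)\<^sup>2))"
    by (rule mult_left_mono) simp
  also have "\<dots> = (real k / (real k + 1)\<^sup>2) * (1 / 8) ^ k"
    by (simp add: power_one_over)
  also have "\<dots> \<le> 1 * (1 / 2) ^ k"
  proof (rule mult_mono)
    have "real k \<le> (real k + 1)\<^sup>2" by (simp add: power2_eq_square algebra_simps)
    then show "real k / (real k + 1)\<^sup>2 \<le> 1" by (simp add: divide_le_eq)
  qed (auto intro: power_mono)
  finally show "norm (real k * measure \<nu> {y k}) \<le> (1 / 2) ^ k / H"
    using horizon by (simp add: field_simps)
qed

lemma drift_nonneg: "0 \<le> drift"
  unfolding drift_def by (intro suminf_nonneg summable_drift) simp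

text \<open>Monotone convergence over the sizes, applied to the formula for single counts. As
  \<open>A\<close> ranges over \<open>F s\<close>, this says that \<open>jump_sum s t\<close> has
  conditional mean \<open>(t - s) * drift\<close> at time \<open>s\<close>.\<close>

lemma nn_integral_jump_sum:
  assumes st: "0 \<le> s" "s \<le> t" "t \<le> H" and A: "A \<in> sets (F s)"
  shows "(\<integral>\<^sup>+ \<omega>. ennreal (indicator A \<omega> * jump_sum s t \<omega>) \<partial>M) = ennreal (prob A * ((t - s) * drift))"
proof -
  have Ae: "A \<in> events" using A sets_F_events by auto
  have "(\<integral>\<^sup>+ \<omega>. ennreal (indicator A \<omega> * jump_sum s t \<omega>) \<partial>M) =
      (\<integral>\<^sup>+ \<omega>. (\<Sum>k. ennreal (real k) * ennreal (indicator A \<omega> * jump_count (y k) s t \<omega>)) \<partial>M)"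
  proof (rule nn_integral_cong_AE)
    show "AE \<omega> in M. ennreal (indicator A \<omega> * jump_sum s t \<omega>) =
        (\<Sum>k. ennreal (real k) * ennreal (indicator A \<omega> * jump_count (y k) s t \<omega>))"
      using AE_finite_jump_times
    proof eventually_elim
      case (elim \<omega>)
      have sm: "summable (\<lambda>k. real k * jump_count (y k) s t \<omega>)"
        using jump_sum_sums[OF elim st(1,3)] by (rule sums_summable)
      have "(\<Sum>k. ennreal (real k) * ennreal (indicator A \<omega> * jump_count (y k) s t \<omega>)) =
          (\<Sum>k. ennreal (indicator A \<omega> * (real k * jump_count (y k) s t \<omega>)))"
        by (simp add: ennreal_mult[symmetric] mult_ac)
      also have "\<dots> = ennreal (\<Sum>k. indicator A \<omega> * (real k * jump_count (y k) s t \<omega>))"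
        using sm by (intro suminf_ennreal2 summable_mult) auto
      also have "(\<Sum>k. indicator A \<omega> * (real k * jump_count (y k) s t \<omega>)) = indicator A \<omega> * jump_sum s t \<omega>"
        unfolding jump_sum_def by (rule suminf_mult[OF sm])
      finally show ?case by simp
    qed
  qed
  also have "\<dots> = (\<Sum>k. ennreal (real k) * ennreal (prob A * ((t - s) * measure \<nu> {y k})))"
    using Ae jump_count_measurable[OF st y_nonzero] nn_integral_jump_count[OF st y_nonzero A]
    by (subst nn_integral_suminf) (auto simp: nn_integral_cmult)
  also have "\<dots> = (\<Sum>k. ennreal (prob A * (t - s) * (real k * measure \<nu> {y k})))"
    using st by (simp add: ennreal_mult[symmetric] mult_ac)
  also have "\<dots> = ennreal (\<Sum>k. prob A * (t - s) * (real k * measure \<nu> {y k}))"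
    using st by (intro suminf_ennreal2 summable_mult summable_drift) auto
  also have "(\<Sum>k. prob A * (t - s) * (real k * measure \<nu> {y k})) = prob A * (t - s) * drift"
    unfolding drift_def by (rule suminf_mult[OF summable_drift])
  finally show ?thesis by (simp add: mult.assoc)
qed

lemma integral_jump_sum:
  assumes st: "0 \<le> s" "s \<le> t" "t \<le> H"
  shows "integrable M (jump_sum s t)"
    and "A \<in> sets (F s) \<Longrightarrow> (\<integral>\<omega>. indicator A \<omega> * jump_sum s t \<omega> \<partial>M) = prob A * ((t - s) * drift)"
proof -
  have nn: "AE \<omega> in M. 0 \<le> indicator A \<omega> * jump_sum s t \<omega>" for A
    using AE_finite_jump_times by eventually_elim (use jump_sum_nonneg st in simp)
  note meas = jump_sum_measurable[OF st]
  show "integrable M (jump_sum s t)"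
  proof (rule integrableI_nonneg[OF meas])
    show "AE \<omega> in M. 0 \<le> jump_sum s t \<omega>"
      using AE_finite_jump_times by eventually_elim (use jump_sum_nonneg st in simp)
    have "(\<integral>\<^sup>+ \<omega>. ennreal (jump_sum s t \<omega>) \<partial>M) = (\<integral>\<^sup>+ \<omega>. ennreal (indicator (space M) \<omega> * jump_sum s t \<omega>) \<partial>M)"
      by (intro nn_integral_cong) simp
    also have "\<dots> < \<infinity>"
      using sets.top[of "F s"] by (subst nn_integral_jump_sum[OF st]) auto
    finally show "(\<integral>\<^sup>+ \<omega>. ennreal (jump_sum s t \<omega>) \<partial>M) < \<infinity>" .
  qed
  assume A: "A \<in> sets (F s)"
  then have Ae: "A \<in> events" using sets_F_events by auto
  show "(\<integral>\<omega>. indicator A \<omega> * jump_sum s t \<omega> \<partial>M) = prob A * ((t - s) * drift)"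
    using Ae meas nn nn_integral_jump_sum[OF st A] st drift_nonneg
    by (subst integral_eq_nn_integral) auto
qed

text \<open>Cauchy-Schwarz with weights \<open>2^k\<close> bounds the squared sum by the sum of
  \<open>4^(-k)\<close> times the sum of \<open>4^k * k^2\<close> times the squared counts. The
  intensities are prescribed to match: \<open>8^k\<close> absorbs \<open>4^k\<close> and leaves
  \<open>2^(-k)\<close>, and \<open>(k + 1)^2\<close> absorbs \<open>k^2\<close>. Fatou's lemma
  removes the cutoff \<open>m\<close>.\<close>

lemma square_integrable_jump_sum: "integrable M (\<lambda>\<omega>. (jump_sum 0 H \<omega>)\<^sup>2)"
proof -
  define X where "X m \<omega> = (\<Sum>k<m. real k * jump_count (y k) 0 H \<omega>)" for m \<omega>
  have meas: "jump_count (y k) 0 H \<in> borel_measurable M" for k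
    using horizon y_nonzero by (intro jump_count_measurable) auto
  have pow2: "(c ^ k)\<^sup>2 = (c\<^sup>2) ^ k" for c :: real and k :: nat
    by (simp only: power_mult[symmetric] mult.commute)
  have summand: "(\<integral>\<^sup>+ \<omega>. ennreal ((2 ^ k * (real k * jump_count (y k) 0 H \<omega>))\<^sup>2) \<partial>M) \<le> ennreal ((1 / 2) ^ k)" for k
  proof -
    have "(\<integral>\<^sup>+ \<omega>. ennreal ((2 ^ k * (real k * jump_count (y k) 0 H \<omega>))\<^sup>2) \<partial>M) =
        ennreal (4 ^ k * (real k)\<^sup>2) * (\<integral>\<^sup>+ \<omega>. ennreal ((jump_count (y k) 0 H \<omega>)\<^sup>2) \<partial>M)"
    proof -
      have "(2 ^ k * (real k * n))\<^sup>2 = (4 ^ k * (real k)\<^sup>2) * n\<^sup>2" for n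
        by (simp only: power_mult_distrib pow2[of 2]) simp
      then show ?thesis
        using meas[of k] by (simp add: ennreal_mult nn_integral_cmult del: ennreal_mult_eq_top_iff)
    qed
    also have "\<dots> \<le> ennreal (4 ^ k * (real k)\<^sup>2) * ennreal (1 / (8 ^ k * (real k + 1)\<^sup>2))"
      by (intro mult_left_mono order_trans[OF second_moment_jump_count[OF y_nonzero] ennreal_leI[OF intensity_small]]) auto
    also have "\<dots> = ennreal (((real k)\<^sup>2 / (real k + 1)\<^sup>2) * (1 / 2) ^ k)"
    proof -
      have "(8 :: real) ^ k = 4 ^ k * 2 ^ k" by (simp add: power_mult_distrib[symmetric])
      then show ?thesis
        by (subst ennreal_mult[symmetric]) (auto simp: power_one_over divide_simps)
    qed
    also have "\<dots> \<le> ennreal (1 * (1 / 2) ^ k)"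
      by (intro ennreal_leI mult_right_mono) (auto simp: divide_le_eq intro!: power_mono)
    finally show ?thesis by simp
  qed
  \<comment> \<open>Serves the ratio 1/4 from Cauchy-Schwarz and the ratio 1/2 from the second
    moments; together they give the bound 4.\<close>
  have geo: "(\<Sum>k<m. c ^ k) \<le> 2" if "0 \<le> c" "c \<le> 1 / 2" for c :: real and m
  proof -
    have "(\<Sum>k<m. c ^ k) \<le> (\<Sum>k. c ^ k)"
      using that by (intro sum_le_suminf summable_geometric) auto
    also have "\<dots> = 1 / (1 - c)" using that by (intro suminf_geometric) auto
    also have "\<dots> \<le> 2" using that by (simp add: divide_le_eq)
    finally show ?thesis .
  qed
  have sq: "(X m \<omega>)\<^sup>2 \<le> 2 * (\<Sum>k<m. (2 ^ k * (real k * jump_count (y k) 0 H \<omega>))\<^sup>2)" for m \<omega>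
  proof -
    have "X m \<omega> = (\<Sum>k<m. (1 / 2) ^ k * (2 ^ k * (real k * jump_count (y k) 0 H \<omega>)))"
      unfolding X_def by (intro sum.cong) (auto simp: power_one_over)
    then have "(X m \<omega>)\<^sup>2 \<le> (\<Sum>k<m. ((1 / 2) ^ k)\<^sup>2) * (\<Sum>k<m. (2 ^ k * (real k * jump_count (y k) 0 H \<omega>))\<^sup>2)"
      using Cauchy_Schwarz_ineq_sum[of "\<lambda>k. (1 / 2) ^ k" "\<lambda>k. 2 ^ k * (real k * jump_count (y k) 0 H \<omega>)" "{..<m}"]
      by simp
    also have "(\<Sum>k<m. ((1 / 2 :: real) ^ k)\<^sup>2) = (\<Sum>k<m. (1 / 4) ^ k)"
      by (simp only: pow2) (simp add: power2_eq_square)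
    also have "(\<Sum>k<m. (1 / 4) ^ k) * (\<Sum>k<m. (2 ^ k * (real k * jump_count (y k) 0 H \<omega>))\<^sup>2) \<le>
        2 * (\<Sum>k<m. (2 ^ k * (real k * jump_count (y k) 0 H \<omega>))\<^sup>2)"
      by (intro mult_right_mono geo sum_nonneg) auto
    finally show ?thesis .
  qed
  have X_bound: "(\<integral>\<^sup>+ \<omega>. ennreal ((X m \<omega>)\<^sup>2) \<partial>M) \<le> 4" for m
  proof -
    have "(\<integral>\<^sup>+ \<omega>. ennreal ((X m \<omega>)\<^sup>2) \<partial>M) \<le>
        (\<integral>\<^sup>+ \<omega>. 2 * (\<Sum>k<m. ennreal ((2 ^ k * (real k * jump_count (y k) 0 H \<omega>))\<^sup>2)) \<partial>M)"
    proof (intro nn_integral_mono)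
      fix \<omega>
      have "ennreal ((X m \<omega>)\<^sup>2) \<le> ennreal (2 * (\<Sum>k<m. (2 ^ k * (real k * jump_count (y k) 0 H \<omega>))\<^sup>2))"
        by (rule ennreal_leI[OF sq])
      also have "\<dots> = 2 * ennreal (\<Sum>k<m. (2 ^ k * (real k * jump_count (y k) 0 H \<omega>))\<^sup>2)"
        by (rule numeral_mult_ennreal[symmetric]) (intro sum_nonneg, simp)
      also have "ennreal (\<Sum>k<m. (2 ^ k * (real k * jump_count (y k) 0 H \<omega>))\<^sup>2) =
          (\<Sum>k<m. ennreal ((2 ^ k * (real k * jump_count (y k) 0 H \<omega>))\<^sup>2))"
        by (rule sum_ennreal[symmetric]) simp
      finally show "ennreal ((X m \<omega>)\<^sup>2) \<le> 2 * (\<Sum>k<m. ennreal ((2 ^ k * (real k * jump_count (y k) 0 H \<omega>))\<^sup>2))" .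
    qed
    also have "\<dots> = 2 * (\<integral>\<^sup>+ \<omega>. (\<Sum>k<m. ennreal ((2 ^ k * (real k * jump_count (y k) 0 H \<omega>))\<^sup>2)) \<partial>M)"
      using meas by (intro nn_integral_cmult) measurable
    also have "(\<integral>\<^sup>+ \<omega>. (\<Sum>k<m. ennreal ((2 ^ k * (real k * jump_count (y k) 0 H \<omega>))\<^sup>2)) \<partial>M) =
        (\<Sum>k<m. \<integral>\<^sup>+ \<omega>. ennreal ((2 ^ k * (real k * jump_count (y k) 0 H \<omega>))\<^sup>2) \<partial>M)"
      using meas by (intro nn_integral_sum) measurable
    also have "2 * \<dots> \<le> 2 * (\<Sum>k<m. ennreal ((1 / 2) ^ k))"
      by (intro mult_left_mono sum_mono summand) auto
    also have "\<dots> = 2 * ennreal (\<Sum>k<m. (1 / 2) ^ k)"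
      by (subst sum_ennreal) auto
    also have "\<dots> \<le> 2 * ennreal 2"
      by (intro mult_left_mono ennreal_leI geo) auto
    finally show ?thesis by (simp add: numeral_mult_ennreal)
  qed
  have "(\<integral>\<^sup>+ \<omega>. ennreal ((jump_sum 0 H \<omega>)\<^sup>2) \<partial>M) = (\<integral>\<^sup>+ \<omega>. liminf (\<lambda>m. ennreal ((X m \<omega>)\<^sup>2)) \<partial>M)"
  proof (rule nn_integral_cong_AE)
    show "AE \<omega> in M. ennreal ((jump_sum 0 H \<omega>)\<^sup>2) = liminf (\<lambda>m. ennreal ((X m \<omega>)\<^sup>2))"
      using AE_finite_jump_times
    proof eventually_elim
      case (elim \<omega>)
      have "(\<lambda>k. real k * jump_count (y k) 0 H \<omega>) sums jump_sum 0 H \<omega>"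
        using jump_sum_sums[OF elim, of 0 H] jump_sum_eq[OF elim, of 0 H] by simp
      then have "(\<lambda>m. X m \<omega>) \<longlonglongrightarrow> jump_sum 0 H \<omega>"
        unfolding X_def sums_def .
      then have "(\<lambda>m. ennreal ((X m \<omega>)\<^sup>2)) \<longlonglongrightarrow> ennreal ((jump_sum 0 H \<omega>)\<^sup>2)"
        by (intro tendsto_ennrealI tendsto_power)
      then show ?case by (intro lim_imp_Liminf[symmetric]) auto
    qed
  qed
  also have "\<dots> \<le> liminf (\<lambda>m. \<integral>\<^sup>+ \<omega>. ennreal ((X m \<omega>)\<^sup>2) \<partial>M)"
    unfolding X_def using meas by (intro nn_integral_liminf) auto
  also have "\<dots> \<le> liminf (\<lambda>m. 4)"
    by (intro Liminf_mono always_eventually allI X_bound)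
  also have "\<dots> < \<infinity>" by (simp add: Liminf_const)
  finally show ?thesis
    using horizon jump_sum_measurable[of 0 H] by (intro integrableI_nonneg) auto
qed

lemma sets_F_aug: "sets (F_aug t) = sigma_sets (space M) (sets (F t) \<union> null_sets M)"
  unfolding F_aug_def null_augmentation_def
  by (rule sets_measure_of) (use sets.sets_into_space[of _ "F t"] sets.sets_into_space[of _ M] in auto)

lemma F_aug_subalgebra: "subalgebra M (F_aug t)"
proof -
  have "space (F_aug t) = space M"
    unfolding F_aug_def null_augmentation_def
    by (rule space_measure_of) (use sets.sets_into_space[of _ "F t"] sets.sets_into_space[of _ M] in auto)
  moreover have "sets (F_aug t) \<subseteq> events"
    unfolding sets_F_aug using sets_F_events by (intro sets.sigma_sets_subset) auto
  ultimately show ?thesis by (simp add: subalgebra_def)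
qed

text \<open>Sets that agree with a set of \<open>F t\<close> up to a null set form a sigma-field
  containing all generators. Integrals over augmented sets thus reduce to sets of
  \<open>F t\<close>, where independence is available.\<close>

lemma F_aug_approx:
  assumes "A \<in> sets (F_aug t)"
  obtains A' where "A' \<in> sets (F t)" "AE \<omega> in M. \<omega> \<in> A \<longleftrightarrow> \<omega> \<in> A'"
proof -
  have "A \<in> sigma_sets (space M) (sets (F t) \<union> null_sets M)"
    using assms by (simp add: sets_F_aug)
  then have "\<exists>A'\<in>sets (F t). AE \<omega> in M. \<omega> \<in> A \<longleftrightarrow> \<omega> \<in> A'"
  proof induction
    case (Basic A)
    then show ?case
    proof
      assume "A \<in> null_sets M"
      then have "AE \<omega> in M. \<omega> \<in> A \<longleftrightarrow> \<omega> \<in> {}" using AE_not_in by auto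
      then show ?case by blast
    qed auto
  next
    case Empty
    then show ?case by (intro bexI[of _ "{}"]) auto
  next
    case (Compl A)
    then obtain A' where A': "A' \<in> sets (F t)" "AE \<omega> in M. \<omega> \<in> A \<longleftrightarrow> \<omega> \<in> A'" by blast
    have "AE \<omega> in M. \<omega> \<in> space M - A \<longleftrightarrow> \<omega> \<in> space (F t) - A'"
      using A'(2) by eventually_elim auto
    then show ?case using A'(1) by blast
  next
    case (Union A)
    then have "\<exists>A'. \<forall>i. A' i \<in> sets (F t) \<and> (AE \<omega> in M. \<omega> \<in> A i \<longleftrightarrow> \<omega> \<in> A' i)"
      by (intro choice) blast
    then obtain A' where A': "\<And>i. A' i \<in> sets (F t)" "\<And>i. AE \<omega> in M. \<omega> \<in> A i \<longleftrightarrow> \<omega> \<in> A' i" by blast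
    have "AE \<omega> in M. \<forall>i. \<omega> \<in> A i \<longleftrightarrow> \<omega> \<in> A' i"
      using A'(2) by (simp add: AE_all_countable)
    then have "AE \<omega> in M. \<omega> \<in> (\<Union>i. A i) \<longleftrightarrow> \<omega> \<in> (\<Union>i. A' i)"
      by eventually_elim auto
    then show ?case using A'(1) by blast
  qed
  then show ?thesis using that by blast
qed

text \<open>Split the sum at \<open>t\<close>: the earlier part is known, and the later part has
  mean \<open>drift * (H - t)\<close> on every event of \<open>F t\<close>, in proportion to its
  probability. Sets of the augmented field are tested through their approximations
  \<open>A'\<close>.\<close>

lemma cond_exp_jump_sum:
  assumes t: "t \<in> {0..H}" and X: "integrable M X" "AE \<omega> in M. X \<omega> = jump_sum 0 H \<omega> - c"
  shows "AE \<omega> in M. real_cond_exp M (F_aug t) X \<omega> = jump_sum 0 t \<omega> + drift * (H - t) - c"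
proof -
  interpret sub: finite_measure_subalgebra M "F_aug t"
    by standard (rule F_aug_subalgebra)
  define g where "g \<omega> = jump_sum 0 t \<omega> + drift * (H - t) - c" for \<omega>
  have t': "0 \<le> t" "t \<le> H" using t by auto
  note Y = integral_jump_sum(1)[OF order_refl t'] and Y' = integral_jump_sum(1)[OF t' order_refl]
  have g: "integrable M g" unfolding g_def[abs_def] using Y by simp
  have split: "AE \<omega> in M. X \<omega> = jump_sum 0 t \<omega> + jump_sum t H \<omega> - c"
    using X(2) AE_finite_jump_times AE_space
  proof eventually_elim
    case (elim \<omega>)
    have "(\<lambda>k. real k * jump_count (y k) 0 t \<omega> + real k * jump_count (y k) t H \<omega>) sums (jump_sum 0 t \<omega> + jump_sum t H \<omega>)"
      using jump_sum_sums[OF elim(2), of 0 t] jump_sum_sums[OF elim(2), of t H]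
        jump_sum_eq[OF elim(2), of 0 t] jump_sum_eq[OF elim(2), of t H] t'
      by (intro sums_add) auto
    moreover have "real k * jump_count (y k) 0 t \<omega> + real k * jump_count (y k) t H \<omega> = real k * jump_count (y k) 0 H \<omega>" for k
      using jump_count_add[of 0 t H "y k" \<omega>] t' y_nonzero elim(3) by (simp add: distrib_left)
    ultimately have "jump_sum 0 H \<omega> = jump_sum 0 t \<omega> + jump_sum t H \<omega>"
      unfolding jump_sum_def[of 0 H] using sums_unique by (simp add: sums_iff)
    then show ?case using elim(1) by simp
  qed
  have "AE \<omega> in M. real_cond_exp M (F_aug t) X \<omega> = g \<omega>"
  proof (rule sub.real_cond_exp_charact[OF _ X(1) g])
    have "jump_sum 0 t \<in> borel_measurable (F t)"
      using t' by (intro jump_sum_measurable_F) auto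
    then have "g \<in> borel_measurable (F t)" unfolding g_def[abs_def] by measurable
    then show "g \<in> borel_measurable (F_aug t)"
      using F_aug_subalgebra[of t] unfolding measurable_def sets_F_aug subalgebra_def by auto
    fix A assume "A \<in> sets (F_aug t)"
    then obtain A' where A': "A' \<in> sets (F t)" "AE \<omega> in M. \<omega> \<in> A \<longleftrightarrow> \<omega> \<in> A'"
      by (rule F_aug_approx)
    have Ae: "A \<in> events" using \<open>A \<in> sets (F_aug t)\<close> F_aug_subalgebra[of t] by (auto simp: subalgebra_def)
    have Ae': "A' \<in> events" using A'(1) sets_F_events by auto
    have i1: "integrable M (\<lambda>\<omega>. indicator A' \<omega> * (jump_sum 0 t \<omega> - c))"
      using integrable_mult_indicator[OF Ae', of "\<lambda>\<omega>. jump_sum 0 t \<omega> - c"] Y by simp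
    have i2: "integrable M (\<lambda>\<omega>. indicator A' \<omega> * jump_sum t H \<omega>)"
      using integrable_mult_indicator[OF Ae' Y'] by simp
    have i3: "integrable M (\<lambda>\<omega>. indicator A' \<omega> * (drift * (H - t)))"
      using Ae' by (simp add: less_top[symmetric])
    have "(\<integral>\<omega>\<in>A. X \<omega> \<partial>M) = (\<integral>\<omega>. indicator A' \<omega> * (jump_sum 0 t \<omega> - c) + indicator A' \<omega> * jump_sum t H \<omega> \<partial>M)"
      unfolding set_lebesgue_integral_def
    proof (rule integral_cong_AE)
      show "AE \<omega> in M. indicator A \<omega> *\<^sub>R X \<omega> =
          indicator A' \<omega> * (jump_sum 0 t \<omega> - c) + indicator A' \<omega> * jump_sum t H \<omega>"
        using A'(2) split by eventually_elim (auto simp: indicator_def)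
    qed (use X(1) Ae i1 i2 in auto)
    also have "\<dots> = (\<integral>\<omega>. indicator A' \<omega> * (jump_sum 0 t \<omega> - c) \<partial>M) + prob A' * ((H - t) * drift)"
      using i1 i2 integral_jump_sum(2)[OF t' order_refl A'(1)] by simp
    also have "prob A' * ((H - t) * drift) = (\<integral>\<omega>. indicator A' \<omega> * (drift * (H - t)) \<partial>M)"
      using Ae' by (simp add: less_top[symmetric])
    also have "(\<integral>\<omega>. indicator A' \<omega> * (jump_sum 0 t \<omega> - c) \<partial>M) + \<dots> = (\<integral>\<omega>\<in>A. g \<omega> \<partial>M)"
      unfolding set_lebesgue_integral_def Bochner_Integration.integral_add[OF i1 i3, symmetric]
    proof (rule integral_cong_AE)
      show "AE \<omega> in M. indicator A' \<omega> * (jump_sum 0 t \<omega> - c) + indicator A' \<omega> * (drift * (H - t)) = indicator A \<omega> *\<^sub>R g \<omega>"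
        using A'(2) by eventually_elim (auto simp: indicator_def g_def)
    qed (use g Ae i1 i3 in auto)
    finally show "(\<integral>\<omega>\<in>A. X \<omega> \<partial>M) = (\<integral>\<omega>\<in>A. g \<omega> \<partial>M)" .
  qed
  then show ?thesis by (simp add: g_def)
qed

text \<open>Both sides of \<open>V t = E[X | F t] - c\<close> are right-continuous with explicit jumps, so comparing
  their jumps identifies the integrand along the jumps of \<open>Z\<close>.\<close>
lemma integrand_at_jumps:
  assumes \<psi>: "\<psi> \<in> Psi12" and I: "wiener_integral \<theta> I"
    and V: "AE \<omega> in M. \<forall>t\<in>{0..H}. V t \<omega> = I t \<omega> + compensated_integral \<psi> t \<omega>"
    and mart: "martingale_on M H F_aug V"
    and rep: "AE \<omega> in M. jump_sum 0 H \<omega> = c + V H \<omega>"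
  shows "AE \<omega> in M. \<forall>u\<in>jump_times \<omega>. \<psi> u (jump u \<omega>) \<omega> = weight (jump u \<omega>)"
proof -
  \<comment> \<open>The identity that follows holds almost surely for each \<open>t\<close>; on a
    countable set of times one null set serves them all.\<close>
  define D where "D = (\<rat> \<inter> {0..H}) \<union> {H}"
  have D: "countable D" "D \<subseteq> {0..H}" unfolding D_def using countable_rat horizon by auto
  have "AE \<omega> in M. V t \<omega> = jump_sum 0 t \<omega> + drift * (H - t) - c" if "t \<in> {0..H}" for t
  proof -
    have "AE \<omega> in M. real_cond_exp M (F_aug t) (V H) \<omega> = V t \<omega>"
      using mart that unfolding martingale_on_def by auto
    moreover have "AE \<omega> in M. real_cond_exp M (F_aug t) (V H) \<omega> = jump_sum 0 t \<omega> + drift * (H - t) - c"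
    proof (rule cond_exp_jump_sum[OF that])
      show "integrable M (V H)" using mart horizon unfolding martingale_on_def by auto
      show "AE \<omega> in M. V H \<omega> = jump_sum 0 H \<omega> - c" using rep by eventually_elim simp
    qed
    ultimately show ?thesis by eventually_elim simp
  qed
  then have "AE \<omega> in M. \<forall>t\<in>D. V t \<omega> = jump_sum 0 t \<omega> + drift * (H - t) - c"
    using D by (subst AE_ball_countable) auto
  then show ?thesis
    using V wiener_integral_continuous[OF I] compensator_continuous[OF \<psi>] AE_finite_jump_times
  proof eventually_elim
    case (elim \<omega>)
    define C where "C t = (LINT s:{0..t}|lborel. (LINT x|\<nu>. \<psi> s x \<omega>))" for t
    \<comment> \<open>Collects everything that does not jump; what remains on the other side is the
      step function of the differences between integrand and weight.\<close>
    define h where "h t = C t - I t \<omega> + drift * (H - t) - c" for t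
    have h: "continuous_on {0..H} h"
      unfolding h_def C_def using elim(3,4) by (intro continuous_intros)
    have step: "(\<Sum>u | u \<in> jump_times \<omega> \<and> u \<le> q. \<psi> u (jump u \<omega>) \<omega> - weight (jump u \<omega>)) = h q"
      if "q \<in> (\<rat> \<inter> {0..H}) \<union> {H}" for q
    proof -
      have q: "q \<in> D" "q \<in> {0..H}" using that D(2) by (auto simp: D_def)
      have eq: "{s\<in>{0..q}. jump s \<omega> \<noteq> 0} = {u. u \<in> jump_times \<omega> \<and> u \<le> q}"
        using q by (auto simp: jump_times_def less_le)
      have "compensated_integral \<psi> q \<omega> = (\<Sum>u | u \<in> jump_times \<omega> \<and> u \<le> q. \<psi> u (jump u \<omega>) \<omega>) - C q"
        unfolding compensated_integral_def jump_integral_def eq C_def using elim(5) by (subst infsum_finite) auto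
      moreover have "jump_sum 0 q \<omega> = (\<Sum>u | u \<in> jump_times \<omega> \<and> u \<le> q. weight (jump u \<omega>))"
      proof -
        have "{u. u \<in> jump_times \<omega> \<and> 0 < u \<and> u \<le> q} = {u. u \<in> jump_times \<omega> \<and> u \<le> q}"
          by (auto simp: jump_times_def)
        then show ?thesis using jump_sum_eq[OF elim(5), of 0 q] q by simp
      qed
      moreover have "V q \<omega> = jump_sum 0 q \<omega> + drift * (H - q) - c" using elim(1) q by blast
      moreover have "V q \<omega> = I q \<omega> + compensated_integral \<psi> q \<omega>" using elim(2) q by blast
      ultimately show ?thesis unfolding sum_subtractf h_def by linarith
    qed
    have "jump_times \<omega> \<subseteq> {0<..H}" by (auto simp: jump_times_def)
    from continuous_step_zero[OF h elim(5) this step] show ?case by auto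
  qed
qed

text \<open>For the predictable version of the integrand, the set where it differs from
  \<open>k\<close> at size \<open>y k\<close> is predictable and meets no jump of that size, so it
  is null. Countably many \<open>k\<close> share one exceptional set.\<close>

lemma integrand_identified:
  assumes \<psi>: "\<psi> \<in> Psi12"
    and at_jumps: "AE \<omega> in M. \<forall>u\<in>jump_times \<omega>. \<psi> u (jump u \<omega>) \<omega> = weight (jump u \<omega>)"
  shows "AE \<omega> in M. AE s in lborel. s \<in> {0..H} \<longrightarrow> (\<forall>k. \<psi> s (y k) \<omega> = real k)"
proof -
  obtain \<psi>' where \<psi>': "(\<lambda>((\<omega>, s), x). \<psi>' s x \<omega>) \<in> borel_measurable (Pred \<Otimes>\<^sub>M borel)"
      "AE \<omega> in M. \<forall>s\<in>{0..H}. \<forall>x. \<psi> s x \<omega> = \<psi>' s x \<omega>"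
    using \<psi> unfolding Psi12_def by blast
  have "AE \<omega> in M. AE s in lborel. s \<in> {0..H} \<longrightarrow> \<psi>' s (y k) \<omega> = real k" for k
  proof -
    define A where "A = {z \<in> space Pred. \<psi>' (snd z) (y k) (fst z) \<noteq> real k}"
    have "(\<lambda>z. (z, y k)) \<in> measurable Pred (Pred \<Otimes>\<^sub>M borel)" by (intro measurable_Pair2') simp
    from measurable_compose[OF this \<psi>'(1)]
    have [measurable]: "(\<lambda>z. \<psi>' (snd z) (y k) (fst z)) \<in> borel_measurable Pred"
      by (simp add: split_beta')
    have A: "A \<in> sets Pred" unfolding A_def by measurable
    have "AE \<omega> in M. \<forall>u\<in>{0<..H}. jump u \<omega> = y k \<longrightarrow> (\<omega>, u) \<notin> A"
      using at_jumps \<psi>'(2)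
    proof eventually_elim
      case (elim \<omega>)
      show ?case
      proof (intro ballI impI)
        fix u assume u: "u \<in> {0<..H}" "jump u \<omega> = y k"
        then have "u \<in> jump_times \<omega>" using y_nonzero by (simp add: jump_times_def)
        then have "\<psi> u (y k) \<omega> = real k" using elim(1) u by force
        then show "(\<omega>, u) \<notin> A" using elim(2) u by (auto simp: A_def)
      qed
    qed
    from predictable_null_of_no_jumps[OF y_nonzero intensity_pos A this] show ?thesis
      using AE_space
    proof eventually_elim
      case (elim \<omega>)
      from elim(1) show ?case
        by eventually_elim (use elim(2) in \<open>auto simp: A_def space_Pred\<close>)
    qed
  qed
  then have "AE \<omega> in M. \<forall>k. AE s in lborel. s \<in> {0..H} \<longrightarrow> \<psi>' s (y k) \<omega> = real k"
    by (simp add: AE_all_countable)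
  then show ?thesis
    using \<psi>'(2)
  proof eventually_elim
    case (elim \<omega>)
    have "AE s in lborel. \<forall>k. s \<in> {0..H} \<longrightarrow> \<psi>' s (y k) \<omega> = real k"
      using elim(1) by (subst AE_all_countable) blast
    then show ?case by eventually_elim (use elim(2) in auto)
  qed
qed

end

section \<open>Choice of the jump sizes and the contradiction\<close>

section \<open>Incompleteness\<close>

text \<open>As the sizes tend to infinity in modulus, a bounded interval contains finitely many of
  them. So each point is isolated in the support, a small ball around it carries mass only at its
  centre, and 0, unless it is itself a point, is separated from all of them.\<close>

lemma support_atoms:
  fixes x :: "nat \<Rightarrow> real"
  assumes sets: "sets \<nu> = sets borel" and supp: "measure_support \<nu> = range x"
    and lim: "filterlim (\<lambda>i. \<bar>x i\<bar>) at_top sequentially"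
  shows "0 < emeasure \<nu> {x i}"
    and "0 \<notin> range x \<Longrightarrow> \<exists>d>0. \<forall>z\<in>range x. d \<le> \<bar>z\<bar>"
proof -
  have fin: "finite (range x \<inter> {-c..c})" for c
  proof -
    obtain n0 where "\<And>n. n \<ge> n0 \<Longrightarrow> c < \<bar>x n\<bar>"
      using lim unfolding filterlim_at_top_dense eventually_sequentially by blast
    then have "range x \<inter> {-c..c} \<subseteq> x ` {..<n0}"
      by (force simp: abs_le_iff not_le[symmetric])
    then show ?thesis by (rule finite_subset) simp
  qed
  \<comment> \<open>The interval \<open>[-c, c]\<close> contains the ball of radius 1 around
    \<open>x i\<close>.\<close>
  define c where "c = \<bar>x i\<bar> + 1"
  obtain d where d: "d > 0" "\<And>z. z \<in> range x \<inter> {-c..c} \<Longrightarrow> z \<noteq> x i \<Longrightarrow> d \<le> dist (x i) z"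
    using finite_set_avoid[OF fin[of c], of "x i"] by blast
  define U where "U = ball (x i) (min d 1)"
  have U: "U \<in> sets \<nu>" "U - {x i} \<in> sets \<nu>"
    unfolding sets U_def by (auto intro: borel_open)
  have sub: "U - {x i} \<subseteq> - measure_support \<nu>"
  proof
    fix z assume z: "z \<in> U - {x i}"
    then have "dist (x i) z < d" "dist (x i) z < 1" by (auto simp: U_def)
    moreover from this(2) have "z \<in> {-c..c}" by (auto simp: c_def dist_real_def)
    ultimately show "z \<in> - measure_support \<nu>"
      using d(2)[of z] z unfolding supp by fastforce
  qed
  have "U - {x i} \<in> null_sets \<nu>"
    by (rule null_sets_subset[OF measure_support_compl_null[OF sets] U(2) sub])
  then have "emeasure \<nu> U = emeasure \<nu> (U - (U - {x i}))"
    using U(1) by (rule emeasure_Diff_null_set[symmetric])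
  also have "U - (U - {x i}) = {x i}" using d(1) by (auto simp: U_def)
  finally have "emeasure \<nu> U = emeasure \<nu> {x i}" .
  moreover have "x i \<in> measure_support \<nu>" using supp by simp
  then have "0 < emeasure \<nu> U"
    unfolding measure_support_def using d(1) by (auto simp: U_def)
  ultimately show "0 < emeasure \<nu> {x i}" by simp
  assume "0 \<notin> range x"
  obtain e where e: "e > 0" "\<And>z. z \<in> range x \<inter> {-1..1} \<Longrightarrow> z \<noteq> 0 \<Longrightarrow> e \<le> dist 0 z"
    using finite_set_avoid[OF fin[of 1], of 0] by blast
  have "min e 1 \<le> \<bar>z\<bar>" if "z \<in> range x" for z
  proof (cases "\<bar>z\<bar> \<le> 1")
    case True
    have "z \<noteq> 0" using that \<open>0 \<notin> range x\<close> by metis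
    then have "e \<le> dist 0 z" using True that by (intro e(2)) auto
    then show ?thesis by (simp add: dist_real_def)
  qed simp
  then show "\<exists>d>0. \<forall>z\<in>range x. d \<le> \<bar>z\<bar>"
    using e(1) by (intro exI[of _ "min e 1"]) auto
qed

lemma subsequence_below:
  fixes f e :: "nat \<Rightarrow> real"
  assumes "f \<longlonglongrightarrow> 0" "\<And>k. 0 < e k"
  obtains r :: "nat \<Rightarrow> nat" where "strict_mono r" "\<And>k. f (r k) \<le> e k"
proof -
  have ev: "\<exists>n>m. f n \<le> e k" for k m
  proof -
    have "\<forall>\<^sub>F n in sequentially. f n < e k \<and> m < n"
      using order_tendstoD(2)[OF assms] eventually_gt_at_top[of m] by (rule eventually_conj)
    then obtain n where "f n < e k \<and> m < n" unfolding eventually_sequentially by blast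
    then show ?thesis by (intro exI[of _ n]) auto
  qed
  have "\<exists>r. \<forall>k. f (r k) \<le> e k \<and> r k < r (Suc k)"
    by (rule dependent_nat_choice) (use ev in blast)+
  then show ?thesis using that by (auto simp: strict_mono_Suc_iff)
qed

text \<open>Finiteness of \<nu> makes the masses of the distinct atoms summable, so they tend to 0
  and a subsequence meets any prescribed rate. No atom sits at 0 because \<nu>{0} = 0.\<close>

lemma (in levy_noise) sparse_subsequence:
  assumes x: "inj x" "measure_support \<nu> = range x" "filterlim (\<lambda>i. \<bar>x i\<bar>) at_top sequentially"
  obtains r :: "nat \<Rightarrow> nat" where "sparse_jump_sizes M H Z \<nu> W a b (\<lambda>k. x (r k))"
proof -
  interpret \<nu>: finite_measure \<nu> by (rule levy_measure_finite)
  note atom = support_atoms[OF levy_measure_sets x(2,3)]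
  have pos: "0 < measure \<nu> {x i}" for i
    using atom(1)[of i] by (simp add: \<nu>.emeasure_eq_measure)
  have nz: "x i \<noteq> 0" for i
    using atom(1)[of i] levy_measure_zero by auto
  have "(\<lambda>i. measure \<nu> {x i}) sums measure \<nu> (\<Union>i. {x i})"
    by (intro \<nu>.finite_measure_UNION) (auto simp: levy_measure_sets disjoint_family_on_def inj_eq[OF x(1)])
  then have "(\<lambda>i. measure \<nu> {x i}) \<longlonglongrightarrow> 0"
    by (intro summable_LIMSEQ_zero sums_summable)
  then have "(\<lambda>i. H * measure \<nu> {x i} + (H * measure \<nu> {x i})\<^sup>2) \<longlonglongrightarrow> H * 0 + (H * 0)\<^sup>2"
    by (intro tendsto_intros)
  then have lim: "(\<lambda>i. H * measure \<nu> {x i} + (H * measure \<nu> {x i})\<^sup>2) \<longlonglongrightarrow> 0" by simp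
  have eps: "0 < 1 / (8 ^ k * (real k + 1)\<^sup>2)" for k :: nat by (simp add: add_nonneg_eq_0_iff)
  obtain r :: "nat \<Rightarrow> nat" where r: "strict_mono r"
    "\<And>k. H * measure \<nu> {x (r k)} + (H * measure \<nu> {x (r k)})\<^sup>2 \<le> 1 / (8 ^ k * (real k + 1)\<^sup>2)"
    by (fact subsequence_below[OF lim eps])
  show ?thesis
  proof (rule that[of r], unfold_locales)
    show "inj (\<lambda>k. x (r k))"
      using inj_compose[OF x(1) strict_mono_imp_inj_on[OF r(1)]] by (simp add: comp_def)
    show "\<exists>d>0. \<forall>z\<in>measure_support \<nu>. d \<le> \<bar>z\<bar>"
    proof -
      have "0 \<notin> range x" using nz by (metis rangeE)
      then show ?thesis unfolding x(2) by (rule atom(2))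
    qed
  qed (use nz pos r(2) in auto)
qed

lemma (in bond_setup) jump_integrand_bound:
  assumes sum: "summable (\<lambda>j. \<bar>\<phi> s j \<omega>\<bar>)"
    and C: "\<And>j. \<bar>discounted_left s (Tm j) \<omega>\<bar> \<le> C"
    and G: "\<And>j. G s x (Tm j) \<omega> \<le> 0"
  shows "\<bar>jump_integrand \<phi> s x \<omega>\<bar> \<le> (\<Sum>j. \<bar>\<phi> s j \<omega>\<bar>) * C"
proof -
  have le: "norm (\<phi> s j \<omega> * (discounted_left s (Tm j) \<omega> * (exp (G s x (Tm j) \<omega>) - 1))) \<le> \<bar>\<phi> s j \<omega>\<bar> * C" for j
  proof -
    have "\<bar>exp (G s x (Tm j) \<omega>) - 1\<bar> \<le> 1"
      using G[of j] by (simp add: abs_le_iff)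
    then have "\<bar>discounted_left s (Tm j) \<omega>\<bar> * \<bar>exp (G s x (Tm j) \<omega>) - 1\<bar> \<le> C * 1"
      by (intro mult_mono C order_trans[OF abs_ge_zero C]) auto
    then show ?thesis by (simp add: abs_mult mult_left_mono)
  qed
  have sm: "summable (\<lambda>j. \<bar>\<phi> s j \<omega>\<bar> * C)" by (rule summable_mult2[OF sum])
  have "norm (jump_integrand \<phi> s x \<omega>) \<le> (\<Sum>j. \<bar>\<phi> s j \<omega>\<bar> * C)"
    unfolding jump_integrand_def pairing_def by (rule norm_suminf_le[OF le sm])
  also have "\<dots> = (\<Sum>j. \<bar>\<phi> s j \<omega>\<bar>) * C" by (rule suminf_mult2[OF sum, symmetric])
  finally show ?thesis by simp
qed

lemma (in levy_noise) positive_measure_fiber: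
  assumes A: "0 < emeasure prod_time A" and null: "AE \<omega> in M. AE s in lborel. s \<in> {0..H} \<longrightarrow> (\<omega>, s) \<notin> A"
  shows False
proof -
  let ?R = "restrict_space lborel {0..H}"
  interpret R: finite_measure ?R by (rule finite_measure_time)
  \<comment> \<open>\<open>emeasure\<close> is 0 outside the sigma-algebra, so positivity includes
    measurability of \<open>A\<close>.\<close>
  have sets: "A \<in> sets prod_time" using A emeasure_notin_sets by fastforce
  have "emeasure prod_time A = (\<integral>\<^sup>+ \<omega>. emeasure ?R (Pair \<omega> -` A) \<partial>M)"
    by (rule R.emeasure_pair_measure_alt[OF sets])
  also have "\<dots> = (\<integral>\<^sup>+ \<omega>. 0 \<partial>M)"
  proof (rule nn_integral_cong_AE)
    show "AE \<omega> in M. emeasure ?R (Pair \<omega> -` A) = 0"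
      using null
    proof eventually_elim
      case (elim \<omega>)
      have "Pair \<omega> -` A \<in> sets ?R" by (rule sets_Pair1[OF sets])
      moreover have "AE s in ?R. s \<notin> Pair \<omega> -` A"
        using elim by (simp add: AE_restrict_space_iff)
      ultimately show ?case by (simp add: AE_iff_null_sets null_setsD1)
    qed
  qed
  finally show False using A by simp
qed

theorem theorem4p14:
  fixes M :: "'a measure" and H a b :: real
    and Z W :: "real \<Rightarrow> 'a \<Rightarrow> real" and \<nu> :: "real measure"
    and \<alpha> \<sigma> f :: "real \<Rightarrow> real \<Rightarrow> 'a \<Rightarrow> real"
    and \<gamma> :: "real \<Rightarrow> real \<Rightarrow> real \<Rightarrow> 'a \<Rightarrow> real"
    and bank :: "real \<Rightarrow> 'a \<Rightarrow> real" and Tm :: "nat \<Rightarrow> real"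
    and x :: "nat \<Rightarrow> real"
  assumes market: "bond_market M H Z \<nu> W a b \<alpha> \<sigma> \<gamma> f bank Tm"
    and support: "inj x" "measure_support \<nu> = range x"
    and unbounded: "filterlim (\<lambda>i. \<bar>x i\<bar>) at_top sequentially"
    and positive: "emeasure (M \<Otimes>\<^sub>M restrict_space lborel {0..H})
      {(\<omega>, t). \<omega> \<in> space M \<and> t \<in> {0..H} \<and>
         (\<forall>T\<in>{0..H}. \<forall>i. bond_setup.G \<gamma> t (x i) T \<omega> \<le> 0)} > 0"
  shows "\<not> bond_setup.L2_complete M H Z \<nu> W \<sigma> \<gamma> f bank Tm"
proof
  interpret bond_market M H Z \<nu> W a b \<alpha> \<sigma> \<gamma> f bank Tm by (rule market)
  assume complete: L2_complete
  obtain r where "sparse_jump_sizes M H Z \<nu> W a b (\<lambda>k. x (r k))"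
    using sparse_subsequence[OF support unbounded] .
  then interpret sparse_jump_sizes M H Z \<nu> W a b "\<lambda>k. x (r k)" .
  \<comment> \<open>The claim is measurable for \<open>F H\<close> itself, without null sets, as the
    definition of completeness demands.\<close>
  have "replicable (jump_sum 0 H)"
    using complete square_integrable_jump_sum jump_sum_measurable_F[of 0 H H] horizon
    unfolding L2_complete_def by auto
  then obtain c \<phi> V where adm: "admissible \<phi>" and V: "gains \<phi> V"
    and rep: "AE \<omega> in M. jump_sum 0 H \<omega> = c + V H \<omega>"
    unfolding replicable_def by blast
  \<comment> \<open>The martingale behind admissibility may be another version than the
    \<open>V\<close> that replicates.\<close>
  obtain V' where V': "gains \<phi> V'" "martingale_on M H F_aug V'"
    using adm unfolding admissible_def by blast
  have \<phi>: "strategy \<phi>" "jump_integrand \<phi> \<in> Psi12"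
    using adm unfolding admissible_def P_integrable_def by auto
  obtain I where I: "wiener_integral (wiener_integrand \<phi>) I"
    "AE \<omega> in M. \<forall>t\<in>{0..H}. V t \<omega> = I t \<omega> + compensated_integral (jump_integrand \<phi>) t \<omega>"
    using V unfolding gains_def by blast
  obtain I' where I': "wiener_integral (wiener_integrand \<phi>) I'"
    "AE \<omega> in M. \<forall>t\<in>{0..H}. V' t \<omega> = I' t \<omega> + compensated_integral (jump_integrand \<phi>) t \<omega>"
    using V'(1) unfolding gains_def by blast
  \<comment> \<open>Up to null sets the two versions can differ only in the Wiener part, so
    uniqueness at the horizon moves the replication over to the martingale.\<close>
  have "AE \<omega> in M. jump_sum 0 H \<omega> = c + V' H \<omega>"
    using rep wiener_integral_unique[OF I(1) I'(1)] I(2) I'(2)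
    by eventually_elim (use horizon in auto)
  from integrand_identified[OF \<phi>(2) integrand_at_jumps[OF \<phi>(2) I' V'(2) this]]
  have ident: "AE \<omega> in M. AE s in lborel. s \<in> {0..H} \<longrightarrow> (\<forall>k. jump_integrand \<phi> s (x (r k)) \<omega> = real k)" .
  have "AE \<omega> in M. AE s in lborel. s \<in> {0..H} \<longrightarrow>
    (\<omega>, s) \<notin> {(\<omega>, t). \<omega> \<in> space M \<and> t \<in> {0..H} \<and> (\<forall>T\<in>{0..H}. \<forall>i. G t (x i) T \<omega> \<le> 0)}"
    using ident bounded_sequences
  proof eventually_elim
    case (elim \<omega>)
    from elim show ?case
    proof eventually_elim
      case (elim s)
      show ?case
      proof (intro impI notI)
        assume s: "s \<in> {0..H}"
          and "(\<omega>, s) \<in> {(\<omega>, t). \<omega> \<in> space M \<and> t \<in> {0..H} \<and> (\<forall>T\<in>{0..H}. \<forall>i. G t (x i) T \<omega> \<le> 0)}"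
        then have \<omega>: "\<omega> \<in> space M" and G: "\<And>T i. T \<in> {0..H} \<Longrightarrow> G s (x i) T \<omega> \<le> 0" by auto
        obtain C where C: "\<And>j. \<bar>discounted_left s (Tm j) \<omega>\<bar> \<le> C"
          using elim(2) s unfolding bounded_iff by auto
        \<comment> \<open>\<open>C\<close> and the norm of the strategy depend on
          \<open>(\<omega>, s)\<close> but not on the jump size, and the identity holds at this
          point for all \<open>k\<close> at once, so \<open>k\<close> may be chosen after
          them.\<close>
        obtain k :: nat where "(\<Sum>j. \<bar>\<phi> s j \<omega>\<bar>) * C < real k" using reals_Archimedean2 by blast
        moreover have "\<bar>jump_integrand \<phi> s (x (r k)) \<omega>\<bar> \<le> (\<Sum>j. \<bar>\<phi> s j \<omega>\<bar>) * C"
        proof (rule jump_integrand_bound[OF _ C])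
          show "summable (\<lambda>j. \<bar>\<phi> s j \<omega>\<bar>)" using \<phi>(1) s \<omega> unfolding strategy_def by blast
          show "G s (x (r k)) (Tm j) \<omega> \<le> 0" for j
            using subsetD[OF maturities(1), of "Tm j"] by (intro G) simp
        qed
        ultimately show False using elim(1) s by simp
      qed
    qed
  qed
  then show False by (rule positive_measure_fiber[OF positive])
qed

end
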